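(* Let $F$ be a field of characteristic zero and $k\ge1$. For all $k$-bounded partitions $\lambda,\eta$, $$\mathcal E^{(k)}[X|Y]\;s^{(k)}_{\lambda/\eta}[X]=\sum_{\rho,\mu\in\mathscr P^{(k)}}\widetilde F^{(k)}_{\eta/\mu}[-Y]\;\widetilde F^{(k)}_{\rho/\lambda}[Y]\;s^{(k)}_{\rho/\mu}[X],\qquad \mathcal E^{(k)}[X|Y]=\sum_{\lambda\in\mathscr P^{(k)}}s^{(k)}_\lambda[X]\,\widetilde F^{(k)}_\lambda[Y].$$
   Context: $\Lambda_F$ is the Hopf algebra of symmetric functions over $F$. $\Lambda_{(k)}=F[h_1,\dots,h_k]\subset\Lambda_F$ is a Hopf subalgebra; its graded Hopf dual under the Hall pairing is the quotient $\Lambda^{(k)}=\Lambda_F/\langle p_j:j>k\rangle=\Lambda_F/\langle m_\nu:\nu_1>k\rangle$, with coproduct $\Delta^\vee$. $\mathscr P^{(k)}$ is the set of $k$-bounded partitions ($\lambda_1\le k$). **$k$-Schur functions.** A $(k+1)$-core is a partition with no hook length equal to $k+1$. The bijection $\mathrm{core}_{k+1}$ from $\mathscr P^{(k)}$ to $(k+1)$-cores is inverse to the map sending a core to the partition whose $i$th part is the number of boxes in row $i$ with hook length $\le k$; the $k$-conjugate of $\lambda$ is $\lambda^{(k)}=\mathrm{core}_{k+1}^{-1}(\mathrm{core}_{k+1}(\lambda)^t)$. The $k$-Schur functions $s^{(k)}_\lambda$, $\lambda\in\mathscr P^{(k)}$, form the basis of $\Lambda_{(k)}$ determined by $s^{(k)}_\varnothing=1$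 and, for $1\le r\le k$, $h_rs^{(k)}_\alpha=\sum_\beta s^{(k)}_\beta$ over $\beta\in\mathscr P^{(k)}$ with $\alpha\subseteq\beta$, $|\beta/\alpha|=r$, $\beta/\alpha$ a horizontal strip and $\beta^{(k)}/\alpha^{(k)}$ a vertical strip. The dual $k$-Schur functions $\widetilde F^{(k)}_\lambda\in\Lambda^{(k)}$ are the dual basis: $\langle s^{(k)}_\lambda,\widetilde F^{(k)}_\mu\rangle=\delta_{\lambda\mu}$. **Skew elements.** $\Delta(s^{(k)}_\lambda)=\sum_\mu s^{(k)}_{\lambda/\mu}\otimes s^{(k)}_\mu$ and $\Delta^\vee(\widetilde F^{(k)}_\lambda)=\sum_\mu\widetilde F^{(k)}_{\lambda/\mu}\otimes\widetilde F^{(k)}_\mu$. **Reading of the identity.** It is an identity in the degree completion $\prod_n(\Lambda_{(k)}\otimes\Lambda^{(k)})_n$, with $f[X]$ standing for the first tensor factor and $g[Y]$ for the second; $g[-Y]$ denotes the antipode $S^\vee(g)$ of $\Lambda^{(k)}$ (i.e. $p_r\mapsto-p_r$ on representatives). Infinite sums are finite in each degree. *)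

theory Defs
  imports Complex_Main "HOL-Library.FuncSet" "HOL-Library.Poly_Mapping"
    "HOL-Library.Nat_Bijection" "HOL-Library.Multiset"
begin

section \<open>Formal power series in an arbitrary alphabet\<close>

text \<open>
  A monomial is a finitely supported exponent vector \<^typ>\<open>'v \<Rightarrow>\<^sub>0 nat\<close>; the alphabet \<open>'v\<close> may be
  infinite.
\<close>

typedef ('v, 'a) mps = "UNIV :: (('v \<Rightarrow>\<^sub>0 nat) \<Rightarrow> 'a) set"
  morphisms mcoeff Mps ..

setup_lifting type_definition_mps

lemma mps_eqI: "(\<And>\<alpha>. mcoeff f \<alpha> = mcoeff g \<alpha>) \<Longrightarrow> f = g"
  by (metis ext mcoeff_inject)

lemma mcoeff_Mps [simp]: "mcoeff (Mps f) = f"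
  by (simp add: Mps_inverse)

definition splits :: "('v \<Rightarrow>\<^sub>0 nat) \<Rightarrow> (('v \<Rightarrow>\<^sub>0 nat) \<times> ('v \<Rightarrow>\<^sub>0 nat)) set" where
  "splits \<alpha> = {(\<beta>, \<gamma>). \<beta> + \<gamma> = \<alpha>}"

lemma finite_splits [simp]:
  fixes \<alpha> :: "'v \<Rightarrow>\<^sub>0 nat"
  shows "finite (splits \<alpha>)"
proof -
  define B where "B = {\<beta> :: 'v \<Rightarrow>\<^sub>0 nat. \<exists>\<gamma>. \<beta> + \<gamma> = \<alpha>}"
  have "finite B"
  proof (rule inj_on_finite)
    show "inj_on (\<lambda>\<beta>. restrict (Poly_Mapping.lookup \<beta>) (Poly_Mapping.keys \<alpha>)) B"
    proof (rule inj_onI)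
      fix \<beta> \<beta>' :: "'v \<Rightarrow>\<^sub>0 nat" assume B: "\<beta> \<in> B" "\<beta>' \<in> B"
        and eq: "restrict (Poly_Mapping.lookup \<beta>) (Poly_Mapping.keys \<alpha>) = restrict (Poly_Mapping.lookup \<beta>') (Poly_Mapping.keys \<alpha>)"
      show "\<beta> = \<beta>'"
      proof (rule poly_mapping_eqI)
        fix i show "Poly_Mapping.lookup \<beta> i = Poly_Mapping.lookup \<beta>' i"
        proof (cases "i \<in> Poly_Mapping.keys \<alpha>")
          case True
          then show ?thesis using fun_cong[OF eq, of i] by simp
        next
          case False
          then have "Poly_Mapping.lookup \<alpha> i = 0" by (simp add: in_keys_iff)
          then have "Poly_Mapping.lookup \<delta> i = 0" if "\<delta> \<in> B" for \<delta>
            using that unfolding B_def by (auto simp: lookup_add)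
          then show ?thesis using B by simp
        qed
      qed
    qed
    show "(\<lambda>\<beta>. restrict (Poly_Mapping.lookup \<beta>) (Poly_Mapping.keys \<alpha>)) ` B \<subseteq> PiE (Poly_Mapping.keys \<alpha>) (\<lambda>i. {..Poly_Mapping.lookup \<alpha> i})"
      unfolding B_def by (auto simp: lookup_add)
    show "finite (PiE (Poly_Mapping.keys \<alpha>) (\<lambda>i. {..Poly_Mapping.lookup \<alpha> i}))"
      by (intro finite_PiE) auto
  qed
  moreover have "splits \<alpha> \<subseteq> (\<lambda>\<beta>. (\<beta>, \<alpha> - \<beta>)) ` B"
    unfolding splits_def B_def by auto
  ultimately show ?thesis by (meson finite_imageI finite_subset)
qed

instantiation mps :: (type, comm_ring_1) comm_ring_1
begin

lift_definition zero_mps :: "('a, 'b) mps" is "\<lambda>_. 0" .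
lift_definition one_mps :: "('a, 'b) mps" is "\<lambda>\<alpha>. if \<alpha> = 0 then 1 else 0" .
lift_definition plus_mps :: "('a, 'b) mps \<Rightarrow> ('a, 'b) mps \<Rightarrow> ('a, 'b) mps" is "\<lambda>f g \<alpha>. f \<alpha> + g \<alpha>" .
lift_definition minus_mps :: "('a, 'b) mps \<Rightarrow> ('a, 'b) mps \<Rightarrow> ('a, 'b) mps" is "\<lambda>f g \<alpha>. f \<alpha> - g \<alpha>" .
lift_definition uminus_mps :: "('a, 'b) mps \<Rightarrow> ('a, 'b) mps" is "\<lambda>f \<alpha>. - f \<alpha>" .
lift_definition times_mps :: "('a, 'b) mps \<Rightarrow> ('a, 'b) mps \<Rightarrow> ('a, 'b) mps"
  is "\<lambda>f g \<alpha>. \<Sum>(\<beta>, \<gamma>)\<in>splits \<alpha>. f \<beta> * g \<gamma>" .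

instance
proof
  fix f g h :: "('a, 'b) mps"
  show "f * g * h = f * (g * h)"
  proof (rule mps_eqI)
    fix \<alpha>
    have "mcoeff (f * g * h) \<alpha> =
        (\<Sum>x\<in>splits \<alpha>. \<Sum>y\<in>splits (fst x). mcoeff f (fst y) * mcoeff g (snd y) * mcoeff h (snd x))"
      by (simp add: times_mps.rep_eq sum_distrib_right case_prod_beta)
    also have "\<dots> = (\<Sum>(x, y)\<in>Sigma (splits \<alpha>) (\<lambda>x. splits (fst x)).
        mcoeff f (fst y) * mcoeff g (snd y) * mcoeff h (snd x))"
      by (subst sum.Sigma) auto
    also have "\<dots> = (\<Sum>(x, y)\<in>Sigma (splits \<alpha>) (\<lambda>x. splits (snd x)).
        mcoeff f (fst x) * (mcoeff g (fst y) * mcoeff h (snd y)))"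
      by (rule sum.reindex_bij_witness
            [where i = "\<lambda>((a, bc), (b, c)). ((a + b, c), (a, b))"
               and j = "\<lambda>((ab, c), (a, b)). ((a, b + c), (b, c))"])
         (auto simp: splits_def add.assoc mult.assoc)
    also have "\<dots> = (\<Sum>x\<in>splits \<alpha>. \<Sum>y\<in>splits (snd x).
        mcoeff f (fst x) * (mcoeff g (fst y) * mcoeff h (snd y)))"
      by (subst sum.Sigma) auto
    also have "\<dots> = mcoeff (f * (g * h)) \<alpha>"
      by (simp add: times_mps.rep_eq sum_distrib_left case_prod_beta)
    finally show "mcoeff (f * g * h) \<alpha> = mcoeff (f * (g * h)) \<alpha>" .
  qed
  show "f * g = g * f"
  proof (rule mps_eqI)
    fix \<alpha>
    show "mcoeff (f * g) \<alpha> = mcoeff (g * f) \<alpha>"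
      unfolding times_mps.rep_eq
      by (rule sum.reindex_bij_witness[where i = "\<lambda>(a, b). (b, a)" and j = "\<lambda>(a, b). (b, a)"])
         (auto simp: splits_def add.commute mult.commute)
  qed
  show "1 * f = f"
  proof (rule mps_eqI)
    fix \<alpha>
    have "mcoeff (1 * f) \<alpha> = (\<Sum>x\<in>splits \<alpha>. if fst x = 0 then mcoeff f (snd x) else 0)"
      by (auto simp: times_mps.rep_eq one_mps.rep_eq case_prod_beta intro!: sum.cong)
    also have "\<dots> = (\<Sum>x\<in>{(0 :: 'a \<Rightarrow>\<^sub>0 nat, \<alpha>)}. if fst x = 0 then mcoeff f (snd x) else 0)"
      by (rule sum.mono_neutral_right[OF finite_splits]) (auto simp: splits_def)
    finally show "mcoeff (1 * f) \<alpha> = mcoeff f \<alpha>" by simp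
  qed
  show "(f + g) * h = f * h + g * h"
    by (rule mps_eqI)
       (simp add: times_mps.rep_eq plus_mps.rep_eq case_prod_beta distrib_right sum.distrib)
  show "(0::('a, 'b) mps) \<noteq> 1"
  proof
    assume "(0::('a, 'b) mps) = 1"
    then have "mcoeff (0::('a, 'b) mps) 0 = mcoeff 1 0" by simp
    then show False by (simp add: zero_mps.rep_eq one_mps.rep_eq)
  qed
qed (rule mps_eqI; simp add: plus_mps.rep_eq minus_mps.rep_eq uminus_mps.rep_eq zero_mps.rep_eq
       add_ac)+

end

lift_definition mscale :: "'a::comm_ring_1 \<Rightarrow> ('v, 'a) mps \<Rightarrow> ('v, 'a) mps"
  is "\<lambda>c f \<alpha>. c * f \<alpha>" .

interpretation mps: vector_space "mscale :: 'a::field \<Rightarrow> ('v, 'a) mps \<Rightarrow> ('v, 'a) mps"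
  by standard
     (rule mps_eqI; simp add: mscale.rep_eq plus_mps.rep_eq distrib_left distrib_right mult.assoc)+

definition mdeg :: "('v \<Rightarrow>\<^sub>0 nat) \<Rightarrow> nat" where
  "mdeg \<alpha> = (\<Sum>i\<in>Poly_Mapping.keys \<alpha>. Poly_Mapping.lookup \<alpha> i)"

definition degree_part :: "nat \<Rightarrow> ('v, 'a::comm_ring_1) mps \<Rightarrow> ('v, 'a) mps" where
  "degree_part n f = Mps (\<lambda>\<alpha>. if mdeg \<alpha> = n then mcoeff f \<alpha> else 0)"

definition finite_in_each_degree :: "'i set \<Rightarrow> ('i \<Rightarrow> ('v, 'a::comm_ring_1) mps) \<Rightarrow> bool" where
  "finite_in_each_degree A f \<longleftrightarrow> (\<forall>n. finite {i \<in> A. degree_part n (f i) \<noteq> 0})"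

text \<open>The sum of a family which is finite in each degree (the value is meaningless otherwise).\<close>

definition formal_sum :: "'i set \<Rightarrow> ('i \<Rightarrow> ('v, 'a::comm_ring_1) mps) \<Rightarrow> ('v, 'a) mps" where
  "formal_sum A f = Mps (\<lambda>\<alpha>. \<Sum>i\<in>{i \<in> A. mcoeff (f i) \<alpha> \<noteq> 0}. mcoeff (f i) \<alpha>)"


section \<open>Symmetric functions\<close>

text \<open>
  Note that \<open>Poly_Mapping.map_key \<pi> \<alpha>\<close> is \<open>\<alpha> \<circ> \<pi>\<close> for injective \<open>\<pi>\<close>.
\<close>

definition Lam :: "(nat, 'a::comm_ring_1) mps set" where
  "Lam = {f. (\<forall>\<pi> \<alpha>. bij \<pi> \<longrightarrow> mcoeff f (Poly_Mapping.map_key \<pi> \<alpha>) = mcoeff f \<alpha>) \<and>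
             (\<exists>N. \<forall>\<alpha>. mcoeff f \<alpha> \<noteq> 0 \<longrightarrow> mdeg \<alpha> \<le> N)}"

definition hsym :: "nat \<Rightarrow> (nat, 'a::comm_ring_1) mps" where
  "hsym r = Mps (\<lambda>\<alpha>. if mdeg \<alpha> = r then 1 else 0)"

definition psym :: "nat \<Rightarrow> (nat, 'a::comm_ring_1) mps" where
  "psym r = Mps (\<lambda>\<alpha>. if \<exists>i. \<alpha> = Poly_Mapping.single i r then 1 else 0)"

definition partitions :: "nat list set" where
  "partitions = {\<nu>. sorted_wrt (\<ge>) \<nu> \<and> (\<forall>x\<in>set \<nu>. 1 \<le> x)}"

definition msym :: "nat list \<Rightarrow> (nat, 'a::comm_ring_1) mps" where
  "msym \<nu> = Mps (\<lambda>\<alpha>.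
     if image_mset (Poly_Mapping.lookup \<alpha>) (mset_set (Poly_Mapping.keys \<alpha>)) = mset \<nu>
     then 1 else 0)"

text \<open>
  The Hall pairing, characterised by \<open>\<langle>h\<^sub>\<lambda>, m\<^sub>\<mu>\<rangle> = \<delta>\<^sub>\<lambda>\<^sub>\<mu>\<close>. As \<open>(h\<^sub>\<lambda>)\<close> and \<open>(m\<^sub>\<mu>)\<close> are bases of
  \<open>Lam\<close>, the choice is unique on \<open>Lam \<times> Lam\<close>, and it is used only there.
\<close>

definition is_hall :: "((nat, 'a::field) mps \<Rightarrow> (nat, 'a) mps \<Rightarrow> 'a) \<Rightarrow> bool" where
  "is_hall B \<longleftrightarrow>
     (\<forall>f\<in>Lam. \<forall>g\<in>Lam. \<forall>u\<in>Lam. B (f + g) u = B f u + B g u \<and> B u (f + g) = B u f + B u g) \<and>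
     (\<forall>c. \<forall>f\<in>Lam. \<forall>u\<in>Lam. B (mscale c f) u = c * B f u \<and> B u (mscale c f) = c * B u f) \<and>
     (\<forall>\<nu>\<in>partitions. \<forall>\<mu>\<in>partitions.
        B (prod_list (map hsym \<nu>)) (msym \<mu>) = (if \<nu> = \<mu> then 1 else 0))"

definition hall :: "(nat, 'a::field) mps \<Rightarrow> (nat, 'a) mps \<Rightarrow> 'a" where
  "hall = (SOME B. is_hall B)"

text \<open>
  The antipode of \<open>Lam\<close>, the algebra endomorphism with \<open>p\<^sub>r \<mapsto> - p\<^sub>r\<close>. In characteristic zero
  the \<open>p\<^sub>r\<close> are algebraically independent generators of \<open>Lam\<close>, so the choice is unique on \<open>Lam\<close>.
\<close>

definition is_antipode :: "((nat, 'a::field_char_0) mps \<Rightarrow> (nat, 'a) mps) \<Rightarrow> bool" where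
  "is_antipode S \<longleftrightarrow>
     (\<forall>f\<in>Lam. S f \<in> Lam) \<and> S 1 = 1 \<and>
     (\<forall>f\<in>Lam. \<forall>g\<in>Lam. S (f + g) = S f + S g \<and> S (f * g) = S f * S g) \<and>
     (\<forall>c. \<forall>f\<in>Lam. S (mscale c f) = mscale c (S f)) \<and>
     (\<forall>r\<ge>1. S (psym r) = - psym r)"

definition antipode :: "(nat, 'a::field_char_0) mps \<Rightarrow> (nat, 'a) mps" where
  "antipode = (SOME S. is_antipode S)"


section \<open>Tensor products as power series in two alphabets\<close>

text \<open>
  With \<open>X = Inl\<close> and \<open>Y = Inr\<close>, the map \<open>f \<otimes> g \<mapsto> f[X] g[Y]\<close> embeds the tensor product of spaces
  of power series, and the degree completion of \<open>Lam \<otimes> Lam\<close>, into power series in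
  the alphabet \<^typ>\<open>nat + nat\<close>.
\<close>

definition tensor :: "(nat, 'a::comm_ring_1) mps \<Rightarrow> (nat, 'a) mps \<Rightarrow> (nat + nat, 'a) mps" where
  "tensor f g = Mps (\<lambda>\<gamma>. mcoeff f (Poly_Mapping.map_key Inl \<gamma>) * mcoeff g (Poly_Mapping.map_key Inr \<gamma>))"

abbreviation inX :: "(nat, 'a::comm_ring_1) mps \<Rightarrow> (nat + nat, 'a) mps" where
  "inX f \<equiv> tensor f 1"

abbreviation inY :: "(nat, 'a::comm_ring_1) mps \<Rightarrow> (nat + nat, 'a) mps" where
  "inY g \<equiv> tensor 1 g"

text \<open>
  The coproduct \<open>f \<mapsto> f[X + Y]\<close>: evaluate \<open>f\<close> on the disjoint union of two alphabets, listed via the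
  bijection \<^const>\<open>sum_decode\<close>. For symmetric \<open>f\<close> the choice of the bijection is immaterial.
\<close>

definition coproduct :: "(nat, 'a::comm_ring_1) mps \<Rightarrow> (nat + nat, 'a) mps" where
  "coproduct f = Mps (\<lambda>\<gamma>. mcoeff f (Poly_Mapping.map_key sum_decode \<gamma>))"


section \<open>The Hopf algebras \<open>\<Lambda>\<^sub>(\<^sub>k\<^sub>)\<close> and \<open>\<Lambda>\<^sup>(\<^sup>k\<^sup>)\<close>\<close>

definition Lam_sub :: "nat \<Rightarrow> (nat, 'a::field) mps set" where
  "Lam_sub k = mps.span {prod_list (map hsym rs) |rs. set rs \<subseteq> {1..k}}"

text \<open>
  The ideal with \<open>\<Lambda>\<^sup>(\<^sup>k\<^sup>) = Lam / Lam_ideal k\<close>. Elements of the quotient are handled through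
  representatives in \<open>Lam\<close>. The two subspaces after it are the kernels of
  \<open>\<Lambda>\<^sub>F \<otimes> \<Lambda>\<^sub>F \<rightarrow> \<Lambda>\<^sup>(\<^sup>k\<^sup>) \<otimes> \<Lambda>\<^sup>(\<^sup>k\<^sup>)\<close> and of \<open>\<Lambda>\<^sub>(\<^sub>k\<^sub>) \<otimes> \<Lambda>\<^sub>F \<rightarrow> \<Lambda>\<^sub>(\<^sub>k\<^sub>) \<otimes> \<Lambda>\<^sup>(\<^sup>k\<^sup>)\<close>.
\<close>

definition Lam_ideal :: "nat \<Rightarrow> (nat, 'a::field) mps set" where
  "Lam_ideal k = mps.span {f * psym j |f j. f \<in> Lam \<and> k < j}"

definition quot_quot_kernel :: "nat \<Rightarrow> (nat + nat, 'a::field) mps set" where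
  "quot_quot_kernel k = mps.span
     {tensor f g |f g. f \<in> Lam \<and> g \<in> Lam \<and> (f \<in> Lam_ideal k \<or> g \<in> Lam_ideal k)}"

definition sub_quot_kernel :: "nat \<Rightarrow> (nat + nat, 'a::field) mps set" where
  "sub_quot_kernel k = mps.span {tensor f g |f g. f \<in> Lam_sub k \<and> g \<in> Lam_ideal k}"

text \<open>Equality in the degree completion of \<open>\<Lambda>\<^sub>(\<^sub>k\<^sub>) \<otimes> \<Lambda>\<^sup>(\<^sup>k\<^sup>)\<close>.\<close>

definition sub_quot_eq ::
    "nat \<Rightarrow> (nat + nat, 'a::field) mps \<Rightarrow> (nat + nat, 'a) mps \<Rightarrow> bool" where
  "sub_quot_eq k U V \<longleftrightarrow> (\<forall>n. degree_part n (U - V) \<in> sub_quot_kernel k)"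


section \<open>Bounded partitions, cores and strips\<close>

definition bounded_partitions :: "nat \<Rightarrow> nat list set" where
  "bounded_partitions k = {\<nu> \<in> partitions. \<forall>x\<in>set \<nu>. x \<le> k}"

definition diagram :: "nat list \<Rightarrow> (nat \<times> nat) set" where
  "diagram \<nu> = {(i, j). i < length \<nu> \<and> j < \<nu> ! i}"

definition hook_length :: "nat list \<Rightarrow> nat \<times> nat \<Rightarrow> nat" where
  "hook_length \<nu> b = (case b of (i, j) \<Rightarrow>
     card {(i', j') \<in> diagram \<nu>. (i' = i \<and> j \<le> j') \<or> (j' = j \<and> i \<le> i')})"

definition transpose_partition :: "nat list \<Rightarrow> nat list" where
  "transpose_partition \<nu> = (THE \<mu>. \<mu> \<in> partitions \<and> diagram \<mu> = {(j, i). (i, j) \<in> diagram \<nu>})"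

definition cores :: "nat \<Rightarrow> nat list set" where
  "cores n = {\<kappa> \<in> partitions. \<forall>b\<in>diagram \<kappa>. hook_length \<kappa> b \<noteq> n}"

definition core_to_bounded :: "nat \<Rightarrow> nat list \<Rightarrow> nat list" where
  "core_to_bounded k \<kappa> =
     map (\<lambda>i. card {j. (i, j) \<in> diagram \<kappa> \<and> hook_length \<kappa> (i, j) \<le> k}) [0..<length \<kappa>]"

text \<open>\<open>core k\<close> is the bijection onto \<open>(k+1)\<close>-cores, i.e. \<open>core_{k+1}\<close>.\<close>

definition core :: "nat \<Rightarrow> nat list \<Rightarrow> nat list" where
  "core k = the_inv_into (cores (k + 1)) (core_to_bounded k)"

definition k_conjugate :: "nat \<Rightarrow> nat list \<Rightarrow> nat list" where
  "k_conjugate k \<nu> = core_to_bounded k (transpose_partition (core k \<nu>))"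

definition horizontal_strip :: "nat list \<Rightarrow> nat list \<Rightarrow> bool" where
  "horizontal_strip \<beta> \<alpha> \<longleftrightarrow> diagram \<alpha> \<subseteq> diagram \<beta> \<and>
     (\<forall>i i' j. (i, j) \<in> diagram \<beta> - diagram \<alpha> \<and> (i', j) \<in> diagram \<beta> - diagram \<alpha> \<longrightarrow> i = i')"

definition vertical_strip :: "nat list \<Rightarrow> nat list \<Rightarrow> bool" where
  "vertical_strip \<beta> \<alpha> \<longleftrightarrow> diagram \<alpha> \<subseteq> diagram \<beta> \<and>
     (\<forall>i j j'. (i, j) \<in> diagram \<beta> - diagram \<alpha> \<and> (i, j') \<in> diagram \<beta> - diagram \<alpha> \<longrightarrow> j = j')"

definition pieri_set :: "nat \<Rightarrow> nat \<Rightarrow> nat list \<Rightarrow> nat list set" where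
  "pieri_set k r \<alpha> = {\<beta> \<in> bounded_partitions k.
     card (diagram \<beta> - diagram \<alpha>) = r \<and> horizontal_strip \<beta> \<alpha> \<and>
     vertical_strip (k_conjugate k \<beta>) (k_conjugate k \<alpha>)}"


section \<open>\<open>k\<close>-Schur functions, their duals, and skew elements\<close>

definition is_kschur :: "nat \<Rightarrow> (nat list \<Rightarrow> (nat, 'a::field_char_0) mps) \<Rightarrow> bool" where
  "is_kschur k s \<longleftrightarrow>
     inj_on s (bounded_partitions k) \<and>
     mps.independent (s ` bounded_partitions k) \<and>
     mps.span (s ` bounded_partitions k) = Lam_sub k \<and>
     s [] = 1 \<and>
     (\<forall>r\<in>{1..k}. \<forall>\<alpha>\<in>bounded_partitions k. hsym r * s \<alpha> = (\<Sum>\<beta>\<in>pieri_set k r \<alpha>. s \<beta>))"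

text \<open>\<open>Ft \<mu>\<close> is any representative in \<open>Lam\<close> of the class of the dual \<open>k\<close>-Schur function.\<close>

definition is_dual_kschur ::
    "nat \<Rightarrow> (nat list \<Rightarrow> (nat, 'a::field_char_0) mps) \<Rightarrow> (nat list \<Rightarrow> (nat, 'a) mps) \<Rightarrow> bool" where
  "is_dual_kschur k s Ft \<longleftrightarrow>
     (\<forall>\<mu>\<in>bounded_partitions k. Ft \<mu> \<in> Lam) \<and>
     (\<forall>\<nu>\<in>bounded_partitions k. \<forall>\<mu>\<in>bounded_partitions k.
        hall (s \<nu>) (Ft \<mu>) = (if \<nu> = \<mu> then 1 else 0))"

definition is_skew_kschur ::
    "nat \<Rightarrow> (nat list \<Rightarrow> (nat, 'a::field_char_0) mps) \<Rightarrow> (nat list \<Rightarrow> nat list \<Rightarrow> (nat, 'a) mps) \<Rightarrow> bool"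
  where
  "is_skew_kschur k s sk \<longleftrightarrow> (\<forall>\<nu>\<in>bounded_partitions k.
     (\<forall>\<mu>\<in>bounded_partitions k. sk \<nu> \<mu> \<in> Lam_sub k) \<and>
     finite {\<mu> \<in> bounded_partitions k. sk \<nu> \<mu> \<noteq> 0} \<and>
     coproduct (s \<nu>) = (\<Sum>\<mu>\<in>{\<mu> \<in> bounded_partitions k. sk \<nu> \<mu> \<noteq> 0}. tensor (sk \<nu> \<mu>) (s \<mu>)))"

text \<open>
  Again \<open>Fsk \<nu> \<mu>\<close> is a representative of a class in \<open>\<Lambda>\<^sup>(\<^sup>k\<^sup>)\<close>; for given \<open>\<nu>\<close> all but finitely many of
  these classes vanish, and all but finitely many representatives are taken to be \<open>0\<close>.
\<close>

definition is_skew_dual_kschur ::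
    "nat \<Rightarrow> (nat list \<Rightarrow> (nat, 'a::field_char_0) mps) \<Rightarrow> (nat list \<Rightarrow> nat list \<Rightarrow> (nat, 'a) mps) \<Rightarrow> bool"
  where
  "is_skew_dual_kschur k Ft Fsk \<longleftrightarrow> (\<forall>\<nu>\<in>bounded_partitions k.
     (\<forall>\<mu>\<in>bounded_partitions k. Fsk \<nu> \<mu> \<in> Lam) \<and>
     finite {\<mu> \<in> bounded_partitions k. Fsk \<nu> \<mu> \<noteq> 0} \<and>
     coproduct (Ft \<nu>) - (\<Sum>\<mu>\<in>{\<mu> \<in> bounded_partitions k. Fsk \<nu> \<mu> \<noteq> 0}. tensor (Fsk \<nu> \<mu>) (Ft \<mu>))
       \<in> quot_quot_kernel k)"

definition Cauchy_kernel ::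
    "nat \<Rightarrow> (nat list \<Rightarrow> (nat, 'a::field_char_0) mps) \<Rightarrow> (nat list \<Rightarrow> (nat, 'a) mps) \<Rightarrow>
     (nat + nat, 'a) mps" where
  "Cauchy_kernel k s Ft = formal_sum (bounded_partitions k) (\<lambda>\<nu>. inX (s \<nu>) * inY (Ft \<nu>))"

end

theory Submission
  imports Defs
begin

text \<open>
  Taking the coefficient of \<open>y\<^sup>\<alpha>\<close> for an exponent vector \<open>\<alpha>\<close> with entries at most \<open>k\<close> is pairing with
  \<open>h\<^sub>\<alpha>\<close>, and these coefficients separate the points of the quotient by \<open>\<langle>p\<^sub>j : j > k\<rangle>\<close>. So the identity
  may be checked coefficientwise in \<open>Y\<close>. The left side gives \<open>h\<^sub>\<alpha> s\<^sub>\<lambda>\<^sub>/\<^sub>\<eta>\<close>. On the right,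
  \<open>\<Sum>\<^sub>\<rho> \<langle>x, F\<^sub>\<rho>\<rangle> s\<^sub>\<rho>\<^sub>/\<^sub>\<mu>\<close> is the component of \<open>\<Delta> x\<close> along \<open>s\<^sub>\<mu>\<close>. For \<open>x = h\<^sub>\<gamma> s\<^sub>\<lambda>\<close> one has
  \<open>\<Delta> x = \<Sum> h\<^sub>\<delta> s\<^sub>\<lambda>\<^sub>/\<^sub>\<theta> \<otimes> h\<^sub>\<epsilon> s\<^sub>\<theta>\<close> over \<open>\<delta> + \<epsilon> = \<gamma>\<close> and \<open>\<theta>\<close>, and \<open>\<langle>h\<^sub>\<epsilon> s\<^sub>\<theta>, F\<^sub>\<mu>\<rangle>\<close> is a coefficient of
  \<open>F\<^sub>\<mu>\<^sub>/\<^sub>\<theta>\<close>. The right side thereby becomes a sum of \<open>h\<^sub>\<delta> s\<^sub>\<lambda>\<^sub>/\<^sub>\<theta>\<close> with coefficients from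
  \<open>\<Sum>\<^sub>\<mu> S(F\<^sub>\<eta>\<^sub>/\<^sub>\<mu>) F\<^sub>\<mu>\<^sub>/\<^sub>\<theta>\<close>, which is \<open>\<delta>\<^sub>\<eta>\<^sub>\<theta>\<close> by the antipode axiom. The combinatorics of cores is not
  needed: the Pieri rule puts \<open>h\<^sub>M\<close> into the span of the \<open>s\<^sub>\<nu>\<close> with \<open>|\<nu>| = |M|\<close>, and since the \<open>h\<^sub>M\<close>
  span, every \<open>s\<^sub>\<nu>\<close> is homogeneous of degree \<open>|\<nu>|\<close>.
\<close>

section \<open>Exponent vectors and coefficients\<close>

text \<open>Quotient elements are available only through representatives, so coefficients carry
  information only at exponents bounded by \<open>k\<close>. This suffices because splitting a
  bounded exponent yields bounded exponents: a product coefficient there depends only on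
  coefficients there. A monomial in \<open>X\<close> is fixed as well, which replaces pairings on
  tensor products by scalar equations.

  \<open>hall\<close> and \<open>antipode\<close> are choices, so existence comes first; each is
  prescribed on a basis, products of \<open>hsym\<close> for one and of \<open>psym\<close> for the
  other. Independence of these families is a count: up to a given degree each spans the monomial
  functions and has no more members than they have. Characteristic zero enters through
  triangularity: the leading coefficient of \<open>psym j * monsym N\<close> is a positive count
  that has to be inverted. The same triangularity puts monomial functions with a part above
  \<open>k\<close> into the ideal, which is why bounded coefficients separate the quotient. The
  chosen antipode is uncontrolled outside \<open>Lam\<close>, whence its replacement by a linear map
  on all power series.\<close>

lemma mcoeff_simps [simp]:
  "mcoeff 0 \<alpha> = 0"
  "mcoeff (f + g) \<alpha> = mcoeff f \<alpha> + mcoeff g \<alpha>"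
  "mcoeff (f - g) \<alpha> = mcoeff f \<alpha> - mcoeff g \<alpha>"
  "mcoeff (- f) \<alpha> = - mcoeff f \<alpha>"
  "mcoeff (mscale c f) \<alpha> = c * mcoeff f \<alpha>"
  by (simp_all add: zero_mps.rep_eq plus_mps.rep_eq minus_mps.rep_eq uminus_mps.rep_eq mscale.rep_eq)

lemma mcoeff_one: "mcoeff 1 \<alpha> = (if \<alpha> = 0 then 1 else 0)"
  by (simp add: one_mps.rep_eq)

lemma mcoeff_mult: "mcoeff (f * g) \<alpha> = (\<Sum>(\<beta>, \<gamma>)\<in>splits \<alpha>. mcoeff f \<beta> * mcoeff g \<gamma>)"
  by (simp add: times_mps.rep_eq)

lemma mcoeff_sum [simp]: "mcoeff (sum f A) \<alpha> = (\<Sum>i\<in>A. mcoeff (f i) \<alpha>)"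
  by (induction A rule: infinite_finite_induct) auto

lemma mscale_mult_left [simp]: "mscale c f * g = mscale c (f * g)"
  by (rule mps_eqI) (simp add: mcoeff_mult sum_distrib_left case_prod_beta mult.assoc)

lemma mscale_mult_right [simp]: "f * mscale c g = mscale c (f * g)"
  by (metis mscale_mult_left mult.commute)

lemma mem_splits [simp]: "(\<beta>, \<gamma>) \<in> splits \<alpha> \<longleftrightarrow> \<beta> + \<gamma> = \<alpha>"
  by (simp add: splits_def)

section \<open>Types of exponent vectors as orbit invariants under renaming of variables\<close>

definition mtype :: "('v \<Rightarrow>\<^sub>0 nat) \<Rightarrow> nat multiset" where
  "mtype \<alpha> = image_mset (Poly_Mapping.lookup \<alpha>) (mset_set (Poly_Mapping.keys \<alpha>))"

lemma mdeg_mtype: "mdeg \<alpha> = sum_mset (mtype \<alpha>)"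
  by (simp add: mdeg_def mtype_def sum_unfold_sum_mset)

lemma mdeg_superset:
  assumes "finite A" "Poly_Mapping.keys \<alpha> \<subseteq> A"
  shows "mdeg \<alpha> = (\<Sum>i\<in>A. Poly_Mapping.lookup \<alpha> i)"
  unfolding mdeg_def using assms by (intro sum.mono_neutral_left) (auto simp: in_keys_iff)

lemma mdeg_add [simp]: "mdeg (\<alpha> + \<beta>) = mdeg \<alpha> + mdeg \<beta>"
proof -
  let ?A = "Poly_Mapping.keys \<alpha> \<union> Poly_Mapping.keys \<beta>"
  have "mdeg (\<alpha> + \<beta>) = (\<Sum>i\<in>?A. Poly_Mapping.lookup (\<alpha> + \<beta>) i)"
    by (intro mdeg_superset) (use Poly_Mapping.keys_add[of \<alpha> \<beta>] in auto)
  also have "\<dots> = mdeg \<alpha> + mdeg \<beta>"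
    by (simp add: lookup_add sum.distrib flip: mdeg_superset)
  finally show ?thesis .
qed

lemma mdeg_zero [simp]: "mdeg 0 = 0"
  by (simp add: mdeg_def)

lemma mdeg_eq_0_iff [simp]: "mdeg \<alpha> = 0 \<longleftrightarrow> \<alpha> = 0"
  by (auto simp: mdeg_def in_keys_iff intro: poly_mapping_eqI)

lemma mtype_zero [simp]: "mtype 0 = {#}"
  by (simp add: mtype_def)

lemma zero_notin_mtype [simp]: "0 \<notin># mtype \<alpha>"
  by (auto simp: mtype_def in_keys_iff)

lemma in_mtype_iff: "n \<in># mtype \<alpha> \<longleftrightarrow> n \<noteq> 0 \<and> (\<exists>i. Poly_Mapping.lookup \<alpha> i = n)"
  by (auto simp: mtype_def in_keys_iff)

lemma mtype_map_key:
  assumes "bij \<pi>"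
  shows "mtype (Poly_Mapping.map_key \<pi> \<alpha>) = mtype \<alpha>"
proof -
  have inj: "inj \<pi>" using assms by (rule bij_is_inj)
  have "\<pi> ` (\<pi> -` Poly_Mapping.keys \<alpha>) = Poly_Mapping.keys \<alpha>"
    using assms by (simp add: bij_is_surj surj_image_vimage_eq)
  then have "mset_set (Poly_Mapping.keys \<alpha>) = image_mset \<pi> (mset_set (\<pi> -` Poly_Mapping.keys \<alpha>))"
    using inj by (subst image_mset_mset_set) (auto intro: inj_on_subset)
  then show ?thesis
    using inj by (simp add: mtype_def keys_map_key map_key.rep_eq multiset.map_comp)
qed

lemma mdeg_map_key: "bij \<pi> \<Longrightarrow> mdeg (Poly_Mapping.map_key \<pi> \<alpha>) = mdeg \<alpha>"
  by (simp add: mdeg_mtype mtype_map_key)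

text \<open>Equal types mean equally many variables with each nonzero exponent, so the supports can
  be matched exponent by exponent. The matching must then be extended to a permutation of the whole,
  possibly infinite, alphabet.\<close>

lemma mtype_eq_imp_bij:
  fixes \<alpha> \<beta> :: "'v \<Rightarrow>\<^sub>0 nat"
  assumes "mtype \<alpha> = mtype \<beta>"
  obtains \<pi> where "bij \<pi>" "\<beta> = Poly_Mapping.map_key \<pi> \<alpha>"
proof -
  let ?A = "Poly_Mapping.keys \<alpha>" and ?B = "Poly_Mapping.keys \<beta>"
  have fib: "card {x\<in>?A. Poly_Mapping.lookup \<alpha> x = n} = card {x\<in>?B. Poly_Mapping.lookup \<beta> x = n}" for n
  proof -
    have "count (mtype \<gamma>) n = card {x\<in>Poly_Mapping.keys \<gamma>. Poly_Mapping.lookup \<gamma> x = n}" for \<gamma> :: "'v \<Rightarrow>\<^sub>0 nat"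
      by (auto simp: mtype_def count_image_mset' intro!: arg_cong[where f = card])
    then show ?thesis using assms by metis
  qed
  have "\<exists>h. bij_betw h {x\<in>?B. Poly_Mapping.lookup \<beta> x = n} {x\<in>?A. Poly_Mapping.lookup \<alpha> x = n}" for n
    using fib by (intro finite_same_card_bij) auto
  then obtain h where h: "\<And>n. bij_betw (h n) {x\<in>?B. Poly_Mapping.lookup \<beta> x = n} {x\<in>?A. Poly_Mapping.lookup \<alpha> x = n}"
    by metis
  define \<sigma> where "\<sigma> x = h (Poly_Mapping.lookup \<beta> x) x" for x
  have \<sigma>in: "\<sigma> x \<in> ?A \<and> Poly_Mapping.lookup \<alpha> (\<sigma> x) = Poly_Mapping.lookup \<beta> x" if "x \<in> ?B" for x
    using bij_betwE[OF h[of "Poly_Mapping.lookup \<beta> x"]] that unfolding \<sigma>_def by auto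
  have inj: "inj_on \<sigma> ?B"
  proof (rule inj_onI)
    fix x y assume xy: "x \<in> ?B" "y \<in> ?B" "\<sigma> x = \<sigma> y"
    then have eq: "Poly_Mapping.lookup \<beta> x = Poly_Mapping.lookup \<beta> y" using \<sigma>in by metis
    then show "x = y"
      using bij_betw_imp_inj_on[OF h[of "Poly_Mapping.lookup \<beta> x"]] xy
      by (simp add: \<sigma>_def inj_on_def)
  qed
  have "\<sigma> ` ?B = ?A"
  proof (intro equalityI subsetI)
    fix y assume "y \<in> ?A"
    then have "y \<in> h (Poly_Mapping.lookup \<alpha> y) ` {x\<in>?B. Poly_Mapping.lookup \<beta> x = Poly_Mapping.lookup \<alpha> y}"
      using bij_betw_imp_surj_on[OF h] by auto
    then obtain x where "x \<in> ?B" "Poly_Mapping.lookup \<beta> x = Poly_Mapping.lookup \<alpha> y" "y = h (Poly_Mapping.lookup \<alpha> y) x"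
      by auto
    then show "y \<in> \<sigma> ` ?B" by (metis \<sigma>_def imageI)
  qed (use \<sigma>in in auto)
  then have bij: "bij_betw \<sigma> ?B ?A" using inj by (simp add: bij_betw_def)
  \<comment> \<open>The supports have equal size, so what is left of \<open>?A\<close> outside
    \<open>?B\<close> can be sent to what is left of \<open>?B\<close> outside \<open>?A\<close>;
    the identity does the rest.\<close>
  have c: "card (?A - ?B) = card (?B - ?A)"
    using bij_betw_same_card[OF bij] by (simp add: card_le_sym_Diff card_Diff_subset_Int Int_commute)
  obtain \<tau> where \<tau>: "bij_betw \<tau> (?A - ?B) (?B - ?A)"
    using finite_same_card_bij[OF _ _ c] by auto
  define \<pi> where "\<pi> x = (if x \<in> ?B then \<sigma> x else if x \<in> ?A then \<tau> x else x)" for x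
  have 1: "bij_betw \<pi> ?B ?A" by (rule bij_betw_cong[THEN iffD1, OF _ bij]) (simp add: \<pi>_def)
  have 2: "bij_betw \<pi> (?A - ?B) (?B - ?A)" by (rule bij_betw_cong[THEN iffD1, OF _ \<tau>]) (simp add: \<pi>_def)
  have 3: "bij_betw \<pi> (- (?A \<union> ?B)) (- (?A \<union> ?B))"
    by (rule bij_betw_cong[THEN iffD1, OF _ bij_betw_id]) (simp add: \<pi>_def)
  have "bij_betw \<pi> (?B \<union> (?A - ?B)) (?A \<union> (?B - ?A))"
    by (rule bij_betw_combine[OF 1 2]) auto
  then have "bij_betw \<pi> (?A \<union> ?B) (?A \<union> ?B)"
    by (simp add: Un_commute)
  from bij_betw_combine[OF this 3] have bij\<pi>: "bij \<pi>"
    by (simp only: Compl_disjoint Compl_partition simp_thms)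
  moreover have "\<beta> = Poly_Mapping.map_key \<pi> \<alpha>"
  proof (rule poly_mapping_eqI)
    fix x
    have "Poly_Mapping.lookup \<beta> x = Poly_Mapping.lookup \<alpha> (\<pi> x)"
    proof (cases "x \<in> ?B")
      case True
      then show ?thesis using \<sigma>in by (simp add: \<pi>_def)
    next
      case False
      then have "\<pi> x \<notin> ?A"
        using bij_betwE[OF 2] bij_betwE[OF 3] by (cases "x \<in> ?A") auto
      with False show ?thesis by (simp add: in_keys_iff)
    qed
    then show "Poly_Mapping.lookup \<beta> x = Poly_Mapping.lookup (Poly_Mapping.map_key \<pi> \<alpha>) x"
      using bij\<pi> by (simp add: map_key.rep_eq bij_is_inj)
  qed
  ultimately show ?thesis using that by blast
qed

lemma mtype_nth_list: "mtype (Poly_Mapping.nth xs) = filter_mset (\<lambda>x. x \<noteq> 0) (mset xs)"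
proof -
  have k: "Poly_Mapping.keys (Poly_Mapping.nth xs) = {i \<in> {..<length xs}. xs ! i \<noteq> 0}"
    by (auto simp: in_keys_iff nth_default_def simp del: keys_nth split: if_splits)
  have "mtype (Poly_Mapping.nth xs) = image_mset ((!) xs) (mset_set {i \<in> {..<length xs}. xs ! i \<noteq> 0})"
    unfolding mtype_def k by (intro image_mset_cong) (auto simp: nth_default_def)
  also have "mset_set {i \<in> {..<length xs}. xs ! i \<noteq> 0} = filter_mset (\<lambda>i. xs ! i \<noteq> 0) (mset_set {..<length xs})"
    by simp
  also have "image_mset ((!) xs) \<dots> = filter_mset (\<lambda>x. x \<noteq> 0) (image_mset ((!) xs) (mset_set {..<length xs}))"
    by (simp add: filter_mset_image_mset)
  also have "image_mset ((!) xs) (mset_set {..<length xs}) = mset xs"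
  proof -
    have "mset xs = mset (map ((!) xs) [0..<length xs])" by (simp add: map_nth)
    also have "\<dots> = image_mset ((!) xs) (mset_set {..<length xs})"
      by (simp flip: mset_set_set[of "[0..<length xs]"] add: lessThan_atLeast0)
    finally show ?thesis ..
  qed
  finally show ?thesis .
qed

text \<open>Some exponent vector in the orbit \<open>M\<close>; sorting only makes the choice
  definite.\<close>

definition exps_of :: "nat multiset \<Rightarrow> (nat \<Rightarrow>\<^sub>0 nat)" where
  "exps_of M = Poly_Mapping.nth (sorted_list_of_multiset M)"

lemma mtype_exps_of: "0 \<notin># M \<Longrightarrow> mtype (exps_of M) = M"
  by (rule multiset_eqI) (auto simp: exps_of_def mtype_nth_list not_in_iff)

lemma mtype_single: "r \<noteq> 0 \<Longrightarrow> mtype (Poly_Mapping.single i r) = {#r#}"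
  by (simp add: mtype_def)

lemma mtype_disjoint_add:
  assumes "Poly_Mapping.keys \<alpha> \<inter> Poly_Mapping.keys \<beta> = {}"
  shows "mtype (\<alpha> + \<beta>) = mtype \<alpha> + mtype \<beta>"
proof -
  have k: "Poly_Mapping.keys (\<alpha> + \<beta>) = Poly_Mapping.keys \<alpha> \<union> Poly_Mapping.keys \<beta>"
    by (auto simp: in_keys_iff lookup_add)
  have "mtype (\<alpha> + \<beta>) = image_mset (Poly_Mapping.lookup (\<alpha> + \<beta>)) (mset_set (Poly_Mapping.keys \<alpha>))
      + image_mset (Poly_Mapping.lookup (\<alpha> + \<beta>)) (mset_set (Poly_Mapping.keys \<beta>))"
    unfolding mtype_def k using assms by (simp add: mset_set_Union)
  also have "\<dots> = mtype \<alpha> + mtype \<beta>"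
    unfolding mtype_def using assms
    by (intro arg_cong2[where f = "(+)"] image_mset_cong) (auto simp: lookup_add in_keys_iff disjoint_iff)
  finally show ?thesis .
qed

section \<open>Exponent vectors and tensors in two alphabets\<close>

lift_definition join :: "('u \<Rightarrow>\<^sub>0 nat) \<Rightarrow> ('v \<Rightarrow>\<^sub>0 nat) \<Rightarrow> ('u + 'v \<Rightarrow>\<^sub>0 nat)" is
  "\<lambda>f g x. case x of Inl u \<Rightarrow> f u | Inr v \<Rightarrow> g v"
proof -
  fix f :: "'u \<Rightarrow> nat" and g :: "'v \<Rightarrow> nat"
  assume "finite {x. f x \<noteq> 0}" "finite {x. g x \<noteq> 0}"
  moreover have "{x. (case x of Inl u \<Rightarrow> f u | Inr v \<Rightarrow> g v) \<noteq> 0} = Inl ` {x. f x \<noteq> 0} \<union> Inr ` {x. g x \<noteq> 0}"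
  proof (rule set_eqI)
    fix x show "x \<in> {x. (case x of Inl u \<Rightarrow> f u | Inr v \<Rightarrow> g v) \<noteq> 0} \<longleftrightarrow> x \<in> Inl ` {x. f x \<noteq> 0} \<union> Inr ` {x. g x \<noteq> 0}"
      by (cases x) auto
  qed
  ultimately show "finite {x. (case x of Inl u \<Rightarrow> f u | Inr v \<Rightarrow> g v) \<noteq> 0}" by simp
qed

lemma lookup_join [simp]:
  "Poly_Mapping.lookup (join \<beta> \<gamma>) (Inl u) = Poly_Mapping.lookup \<beta> u"
  "Poly_Mapping.lookup (join \<beta> \<gamma>) (Inr v) = Poly_Mapping.lookup \<gamma> v"
  by (simp_all add: join.rep_eq)

lemma map_key_join [simp]:
  "Poly_Mapping.map_key Inl (join \<beta> \<gamma>) = \<beta>" "Poly_Mapping.map_key Inr (join \<beta> \<gamma>) = \<gamma>"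
  by (auto intro!: poly_mapping_eqI simp: map_key.rep_eq)

lemma join_eq_iff [simp]: "join \<beta> \<gamma> = join \<beta>' \<gamma>' \<longleftrightarrow> \<beta> = \<beta>' \<and> \<gamma> = \<gamma>'"
  by (metis map_key_join)

lemma join_map_key: "join (Poly_Mapping.map_key Inl \<gamma>) (Poly_Mapping.map_key Inr \<gamma>) = \<gamma>"
proof (rule poly_mapping_eqI)
  fix x show "Poly_Mapping.lookup (join (Poly_Mapping.map_key Inl \<gamma>) (Poly_Mapping.map_key Inr \<gamma>)) x = Poly_Mapping.lookup \<gamma> x"
    by (cases x) (simp_all add: map_key.rep_eq)
qed

lemma join_cases: obtains \<beta> \<gamma> where "\<alpha> = join \<beta> \<gamma>"
  by (metis join_map_key)

lemma join_add: "join (\<beta> + \<beta>') (\<gamma> + \<gamma>') = join \<beta> \<gamma> + join \<beta>' \<gamma>'"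
proof (rule poly_mapping_eqI)
  fix x show "Poly_Mapping.lookup (join (\<beta> + \<beta>') (\<gamma> + \<gamma>')) x = Poly_Mapping.lookup (join \<beta> \<gamma> + join \<beta>' \<gamma>') x"
    by (cases x) (simp_all add: lookup_add)
qed

lemma join_zero [simp]: "join 0 0 = 0"
proof (rule poly_mapping_eqI)
  fix x show "Poly_Mapping.lookup (join 0 0) x = Poly_Mapping.lookup 0 x"
    by (cases x) simp_all
qed

lemma join_eq_0_iff [simp]: "join \<beta> \<gamma> = 0 \<longleftrightarrow> \<beta> = 0 \<and> \<gamma> = 0"
  by (metis join_eq_iff join_zero)

lemma mtype_join [simp]: "mtype (join \<beta> \<gamma>) = mtype \<beta> + mtype \<gamma>"
proof -
  have k: "Poly_Mapping.keys (join \<beta> \<gamma>) = Inl ` Poly_Mapping.keys \<beta> \<union> Inr ` Poly_Mapping.keys \<gamma>"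
  proof (rule set_eqI)
    fix x show "x \<in> Poly_Mapping.keys (join \<beta> \<gamma>) \<longleftrightarrow> x \<in> Inl ` Poly_Mapping.keys \<beta> \<union> Inr ` Poly_Mapping.keys \<gamma>"
      by (cases x) (auto simp: in_keys_iff)
  qed
  have "mset_set (Poly_Mapping.keys (join \<beta> \<gamma>)) =
      image_mset Inl (mset_set (Poly_Mapping.keys \<beta>)) + image_mset Inr (mset_set (Poly_Mapping.keys \<gamma>))"
    unfolding k by (subst mset_set_Union) (auto simp: image_mset_mset_set)
  then show ?thesis by (simp add: mtype_def multiset.map_comp comp_def)
qed

lemma mdeg_join [simp]: "mdeg (join \<beta> \<gamma>) = mdeg \<beta> + mdeg \<gamma>"
  by (simp add: mdeg_mtype)

text \<open>The exponents in the two alphabets split independently of each other.\<close>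

lemma splits_join:
  "splits (join \<beta> \<gamma>) = (\<lambda>((b, b'), (c, c')). (join b c, join b' c')) ` (splits \<beta> \<times> splits \<gamma>)"
proof (intro equalityI subsetI)
  fix x assume "x \<in> splits (join \<beta> \<gamma>)"
  moreover obtain b c b' c' where "x = (join b c, join b' c')"
    by (metis join_cases surj_pair)
  ultimately show "x \<in> (\<lambda>((b, b'), (c, c')). (join b c, join b' c')) ` (splits \<beta> \<times> splits \<gamma>)"
    by (auto simp flip: join_add intro!: rev_image_eqI[of "((b, b'), (c, c'))"])
qed (auto simp flip: join_add)

lemma mps_eqI_join: "(\<And>\<beta> \<gamma>. mcoeff S (join \<beta> \<gamma>) = mcoeff T (join \<beta> \<gamma>)) \<Longrightarrow> S = T"
  by (metis join_cases mps_eqI)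

lemma mcoeff_mult_join:
  "mcoeff (S * T) (join \<beta> \<gamma>) =
     (\<Sum>(b, b')\<in>splits \<beta>. \<Sum>(c, c')\<in>splits \<gamma>. mcoeff S (join b c) * mcoeff T (join b' c'))"
  unfolding mcoeff_mult splits_join
  by (subst sum.reindex) (auto simp: inj_on_def sum.cartesian_product case_prod_beta)

lemma mcoeff_tensor [simp]: "mcoeff (tensor f g) (join \<beta> \<gamma>) = mcoeff f \<beta> * mcoeff g \<gamma>"
  by (simp add: tensor_def)

lemma tensor_mult: "tensor f g * tensor f' g' = tensor (f * f') (g * g')"
  by (rule mps_eqI_join) (simp only: mcoeff_mult_join, simp add: mcoeff_mult sum_product case_prod_beta mult_ac)

lemma tensor_add:
  "tensor (f + f') g = tensor f g + tensor f' g" "tensor f (g + g') = tensor f g + tensor f g'"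
  by (rule mps_eqI_join; simp add: algebra_simps)+

lemma tensor_scale:
  "tensor (mscale c f) g = mscale c (tensor f g)" "tensor f (mscale c g) = mscale c (tensor f g)"
  by (rule mps_eqI_join; simp add: algebra_simps)+

lemma tensor_zero [simp]: "tensor 0 g = 0" "tensor f 0 = 0"
  by (rule mps_eqI_join; simp)+

lemma tensor_one [simp]: "tensor 1 1 = 1"
  by (rule mps_eqI_join) (simp add: mcoeff_one)

lemma tensor_sum_left: "tensor (sum f A) g = (\<Sum>i\<in>A. tensor (f i) g)"
  by (rule mps_eqI_join) (simp add: sum_distrib_right)

lemma inX_inY: "inX f * inY g = tensor f g"
  by (simp add: tensor_mult)

section \<open>The coproduct as a renaming of variables\<close>

lemma mcoeff_coproduct: "mcoeff (coproduct f) \<gamma> = mcoeff f (Poly_Mapping.map_key sum_decode \<gamma>)"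
  by (simp add: coproduct_def)

lemma coproduct_simps:
  "coproduct (f + g) = coproduct f + coproduct g" "coproduct (mscale c f) = mscale c (coproduct f)"
  "coproduct 0 = 0"
  by (rule mps_eqI; simp add: mcoeff_coproduct)+

lemma coproduct_sum: "coproduct (sum f A) = (\<Sum>i\<in>A. coproduct (f i))"
  by (rule mps_eqI) (simp add: mcoeff_coproduct)

lemma splits_map_key:
  assumes "bij \<pi>"
  shows "splits (Poly_Mapping.map_key \<pi> \<alpha>) =
    (\<lambda>(\<beta>, \<gamma>). (Poly_Mapping.map_key \<pi> \<beta>, Poly_Mapping.map_key \<pi> \<gamma>)) ` splits \<alpha>"
proof (intro equalityI subsetI)
  have inj: "inj \<pi>" "inj (inv \<pi>)" using assms by (auto simp: bij_is_inj bij_imp_bij_inv)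
  fix x assume "x \<in> splits (Poly_Mapping.map_key \<pi> \<alpha>)"
  then obtain \<beta> \<gamma> where x: "x = (\<beta>, \<gamma>)" "\<beta> + \<gamma> = Poly_Mapping.map_key \<pi> \<alpha>"
    by (auto simp: splits_def)
  have lr: "Poly_Mapping.map_key \<pi> (Poly_Mapping.map_key (inv \<pi>) \<delta>) = \<delta>" for \<delta> :: "'a \<Rightarrow>\<^sub>0 nat"
    using inj by (auto intro!: poly_mapping_eqI simp: map_key.rep_eq)
  have rl: "Poly_Mapping.map_key (inv \<pi>) (Poly_Mapping.map_key \<pi> \<delta>) = \<delta>" for \<delta> :: "'b \<Rightarrow>\<^sub>0 nat"
    using inj assms by (auto intro!: poly_mapping_eqI simp: map_key.rep_eq bij_is_surj surj_f_inv_f)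
  have "(Poly_Mapping.map_key (inv \<pi>) \<beta>, Poly_Mapping.map_key (inv \<pi>) \<gamma>) \<in> splits \<alpha>"
    using x inj by (simp add: map_key_plus[symmetric] rl)
  then show "x \<in> (\<lambda>(\<beta>, \<gamma>). (Poly_Mapping.map_key \<pi> \<beta>, Poly_Mapping.map_key \<pi> \<gamma>)) ` splits \<alpha>"
    by (rule rev_image_eqI) (simp add: x lr)
qed (use assms in \<open>auto simp: bij_is_inj map_key_plus[symmetric]\<close>)

lemma map_key_bij_inject: "bij \<pi> \<Longrightarrow> Poly_Mapping.map_key \<pi> \<beta> = Poly_Mapping.map_key \<pi> \<gamma> \<longleftrightarrow> \<beta> = \<gamma>"
  by (auto intro!: poly_mapping_eqI simp: poly_mapping_eq_iff map_key.rep_eq bij_is_inj fun_eq_iff)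
     (metis bij_pointE)

lemma mcoeff_mult_map_key:
  assumes "bij \<pi>"
  shows "mcoeff (f * g) (Poly_Mapping.map_key \<pi> \<alpha>) = (\<Sum>(\<beta>, \<gamma>)\<in>splits \<alpha>.
     mcoeff f (Poly_Mapping.map_key \<pi> \<beta>) * mcoeff g (Poly_Mapping.map_key \<pi> \<gamma>))"
  unfolding mcoeff_mult splits_map_key[OF assms]
  by (subst sum.reindex) (auto simp: inj_on_def map_key_bij_inject[OF assms] case_prod_beta)

text \<open>\<open>coproduct\<close> only renames variables along the bijection
  \<open>sum_decode\<close>, and renaming is a ring homomorphism.\<close>

lemma coproduct_mult: "coproduct (f * g) = coproduct f * coproduct g"
  by (rule mps_eqI) (simp only: mcoeff_coproduct mcoeff_mult_map_key[OF bij_sum_decode], simp add: mcoeff_mult mcoeff_coproduct)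

lemma coproduct_one [simp]: "coproduct 1 = 1"
  by (rule mps_eqI) (simp add: mcoeff_coproduct mcoeff_one flip: mdeg_eq_0_iff, simp add: mdeg_map_key bij_sum_decode del: mdeg_eq_0_iff)

lemma mcoeff_degree_part [simp]: "mcoeff (degree_part n f) \<alpha> = (if mdeg \<alpha> = n then mcoeff f \<alpha> else 0)"
  by (simp add: degree_part_def)

lemma degree_part_simps:
  "degree_part n (f + g) = degree_part n f + degree_part n g"
  "degree_part n (f - g) = degree_part n f - degree_part n g"
  "degree_part n (mscale c f) = mscale c (degree_part n f)"
  "degree_part n 0 = 0"
  by (rule mps_eqI; simp)+

lemma mps_neq_0_iff: "f \<noteq> 0 \<longleftrightarrow> (\<exists>\<alpha>. mcoeff f \<alpha> \<noteq> 0)"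
  by (metis mcoeff_simps(1) mps_eqI)

lemma degree_part_neq_0_iff: "degree_part n f \<noteq> 0 \<longleftrightarrow> (\<exists>\<alpha>. mdeg \<alpha> = n \<and> mcoeff f \<alpha> \<noteq> 0)"
  unfolding mps_neq_0_iff by auto

section \<open>Symmetric functions\<close>

text \<open>On \<open>Lam\<close> this is the coefficient of the monomial function of type
  \<open>M\<close>, independent of the representative \<open>exps_of M\<close>.\<close>

definition gcoeff :: "(nat, 'a::comm_ring_1) mps \<Rightarrow> nat multiset \<Rightarrow> 'a" where
  "gcoeff f M = mcoeff f (exps_of M)"

lemma gcoeff_simps [simp]:
  "gcoeff 0 M = 0" "gcoeff (f + g) M = gcoeff f M + gcoeff g M"
  "gcoeff (mscale c f) M = c * gcoeff f M"
  by (simp_all add: gcoeff_def)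

lemma gcoeff_sum [simp]: "gcoeff (sum f A) M = (\<Sum>i\<in>A. gcoeff (f i) M)"
  by (simp add: gcoeff_def)

lemma Lam_mcoeff:
  assumes "f \<in> Lam"
  shows "mcoeff f \<alpha> = gcoeff f (mtype \<alpha>)"
proof -
  have "mtype \<alpha> = mtype (exps_of (mtype \<alpha>))" by (simp add: mtype_exps_of)
  then obtain \<pi> where "bij \<pi>" "exps_of (mtype \<alpha>) = Poly_Mapping.map_key \<pi> \<alpha>"
    by (rule mtype_eq_imp_bij)
  then show ?thesis using assms by (simp add: Lam_def gcoeff_def)
qed

lemma Lam_bound: "f \<in> Lam \<Longrightarrow> \<exists>N. \<forall>\<alpha>. mcoeff f \<alpha> \<noteq> 0 \<longrightarrow> mdeg \<alpha> \<le> N"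
  by (simp add: Lam_def)

lemma LamI:
  assumes "\<And>\<alpha>. mcoeff f \<alpha> = h (mtype \<alpha>)" "\<And>\<alpha>. mcoeff f \<alpha> \<noteq> 0 \<Longrightarrow> mdeg \<alpha> \<le> N"
  shows "f \<in> Lam"
  using assms unfolding Lam_def by (auto simp: mtype_map_key)

lemma Lam_zero [simp]: "0 \<in> Lam"
  by (rule LamI[where h = "\<lambda>_. 0"]) auto

lemma Lam_add [simp]: "f \<in> Lam \<Longrightarrow> g \<in> Lam \<Longrightarrow> f + g \<in> Lam"
proof -
  assume fg: "f \<in> Lam" "g \<in> Lam"
  obtain N where "\<And>\<alpha>. mcoeff f \<alpha> \<noteq> 0 \<Longrightarrow> mdeg \<alpha> \<le> N" using Lam_bound fg by blast
  moreover obtain N' where "\<And>\<alpha>. mcoeff g \<alpha> \<noteq> 0 \<Longrightarrow> mdeg \<alpha> \<le> N'" using Lam_bound fg by blast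
  ultimately show ?thesis
    by (intro LamI[where h = "\<lambda>M. gcoeff f M + gcoeff g M" and N = "max N N'"])
       (simp add: Lam_mcoeff[OF fg(1)] Lam_mcoeff[OF fg(2)], metis add.right_neutral le_max_iff_disj mcoeff_simps(2))
qed

lemma Lam_mscale [simp]: "f \<in> Lam \<Longrightarrow> mscale c f \<in> Lam"
proof -
  assume f: "f \<in> Lam"
  obtain N where "\<And>\<alpha>. mcoeff f \<alpha> \<noteq> 0 \<Longrightarrow> mdeg \<alpha> \<le> N" using Lam_bound f by blast
  then show ?thesis
    by (intro LamI[where h = "\<lambda>M. c * gcoeff f M" and N = N])
       (simp add: Lam_mcoeff[OF f], metis mult_zero_right mcoeff_simps(5))
qed

lemma Lam_uminus [simp]: "f \<in> Lam \<Longrightarrow> - f \<in> Lam"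
proof -
  have "- f = mscale (- 1) f" by (rule mps_eqI) simp
  then show "f \<in> Lam \<Longrightarrow> - f \<in> Lam" by simp
qed

lemma Lam_sum [simp]: "(\<And>i. i \<in> A \<Longrightarrow> f i \<in> Lam) \<Longrightarrow> sum f A \<in> Lam"
  by (induction A rule: infinite_finite_induct) auto

lemma mps_subspace_Lam [simp]: "mps.subspace Lam"
  by (simp add: mps.subspace_def)

lemma Lam_mult [simp]:
  assumes "f \<in> Lam" "g \<in> Lam"
  shows "f * g \<in> Lam"
proof -
  obtain N where N: "\<And>\<alpha>. mcoeff f \<alpha> \<noteq> 0 \<Longrightarrow> mdeg \<alpha> \<le> N" using Lam_bound assms by blast
  obtain N' where N': "\<And>\<alpha>. mcoeff g \<alpha> \<noteq> 0 \<Longrightarrow> mdeg \<alpha> \<le> N'" using Lam_bound assms by blast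
  have "mcoeff (f * g) (Poly_Mapping.map_key \<pi> \<alpha>) = mcoeff (f * g) \<alpha>" if "bij \<pi>" for \<pi> \<alpha>
    using assms that unfolding mcoeff_mult_map_key[OF that] by (simp add: Lam_def mcoeff_mult)
  moreover have "mdeg \<alpha> \<le> N + N'" if "mcoeff (f * g) \<alpha> \<noteq> 0" for \<alpha>
  proof -
    from that obtain \<beta> \<gamma> where "\<beta> + \<gamma> = \<alpha>" "mcoeff f \<beta> * mcoeff g \<gamma> \<noteq> 0"
      unfolding mcoeff_mult by (auto elim!: sum.not_neutral_contains_not_neutral simp: splits_def)
    then have "mcoeff f \<beta> \<noteq> 0" "mcoeff g \<gamma> \<noteq> 0" by auto
    with N[of \<beta>] N'[of \<gamma>] \<open>\<beta> + \<gamma> = \<alpha>\<close> show ?thesis by auto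
  qed
  ultimately show ?thesis unfolding Lam_def by blast
qed

lemma Lam_one [simp]: "1 \<in> Lam"
  by (rule LamI[where h = "\<lambda>M. if sum_mset M = 0 then 1 else 0" and N = 0])
     (auto simp: mcoeff_one mdeg_mtype[symmetric] split: if_splits)

lemma Lam_prod_mset [simp]: "(\<And>r. r \<in># M \<Longrightarrow> f r \<in> Lam) \<Longrightarrow> prod_mset (image_mset f M) \<in> Lam"
  by (induction M) auto

lemma mcoeff_hsym: "mcoeff (hsym r) \<alpha> = (if mdeg \<alpha> = r then 1 else 0)"
  by (simp add: hsym_def)

lemma mcoeff_psym: "mcoeff (psym r) \<alpha> = (if \<exists>i. \<alpha> = Poly_Mapping.single i r then 1 else 0)"
  by (simp add: psym_def)

lemma Lam_hsym [simp]: "hsym r \<in> Lam"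
  by (rule LamI[where h = "\<lambda>M. if sum_mset M = r then 1 else 0" and N = r])
     (auto simp: mcoeff_hsym mdeg_mtype[symmetric] split: if_splits)

lemma hsym_0 [simp]: "hsym 0 = 1"
  by (rule mps_eqI) (simp add: mcoeff_hsym mcoeff_one)

lemma mtype_eq_empty_iff: "mtype \<alpha> = {#} \<longleftrightarrow> \<alpha> = 0"
  by (metis mdeg_eq_0_iff mdeg_mtype mtype_zero sum_mset.empty)

lemma mtype_eq_single_iff:
  assumes "r \<noteq> 0"
  shows "mtype \<alpha> = {#r#} \<longleftrightarrow> (\<exists>i. \<alpha> = Poly_Mapping.single i r)"
proof
  assume "mtype \<alpha> = {#r#}"
  moreover from this have "size (mset_set (Poly_Mapping.keys \<alpha>)) = 1"
    by (metis mtype_def size_image_mset size_single)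
  then obtain i where "Poly_Mapping.keys \<alpha> = {i}" by (auto simp: card_1_singleton_iff)
  ultimately have "Poly_Mapping.lookup \<alpha> i = r" "Poly_Mapping.keys \<alpha> = {i}" by (auto simp: mtype_def)
  then have "\<alpha> = Poly_Mapping.single i r"
    by (intro poly_mapping_eqI) (auto simp: lookup_single when_def, auto simp: in_keys_iff)
  then show "\<exists>i. \<alpha> = Poly_Mapping.single i r" ..
qed (use assms in \<open>auto simp: mtype_single\<close>)

lemma Lam_psym [simp]: "r \<noteq> 0 \<Longrightarrow> psym r \<in> Lam"
  by (rule LamI[where h = "\<lambda>M. if M = {#r#} then 1 else 0" and N = r])
     (auto simp: mcoeff_psym mtype_eq_single_iff mdeg_mtype mtype_single split: if_splits)

section \<open>Monomial symmetric functions\<close>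

definition monsym :: "nat multiset \<Rightarrow> (nat, 'a::comm_ring_1) mps" where
  "monsym M = Mps (\<lambda>\<alpha>. if mtype \<alpha> = M then 1 else 0)"

lemma msym_eq_monsym: "msym \<nu> = monsym (mset \<nu>)"
  by (simp add: msym_def monsym_def mtype_def)

lemma mcoeff_monsym: "mcoeff (monsym M) \<alpha> = (if mtype \<alpha> = M then 1 else 0)"
  by (simp add: monsym_def)

lemma Lam_monsym [simp]: "monsym M \<in> Lam"
  by (rule LamI[where h = "\<lambda>M'. if M' = M then 1 else 0" and N = "sum_mset M"])
     (auto simp: mcoeff_monsym mdeg_mtype split: if_splits)

lemma gcoeff_monsym: "0 \<notin># N \<Longrightarrow> gcoeff (monsym M) N = (if N = M then 1 else 0)"
  by (simp add: gcoeff_def mcoeff_monsym mtype_exps_of)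

definition parts_le :: "nat \<Rightarrow> nat multiset set" where
  "parts_le N = {M. 0 \<notin># M \<and> sum_mset M \<le> N}"

lemma size_le_sum_mset: "0 \<notin># M \<Longrightarrow> size M \<le> sum_mset (M :: nat multiset)"
  by (induction M) auto

lemma finite_parts_le [simp]: "finite (parts_le N)"
proof (rule finite_subset)
  show "parts_le N \<subseteq> mset ` {xs. set xs \<subseteq> {..N} \<and> length xs \<le> N}"
  proof
    fix M assume M: "M \<in> parts_le N"
    obtain xs where xs: "M = mset xs" by (metis ex_mset)
    have "x \<le> N" if "x \<in># M" for x
      using M that by (auto simp: parts_le_def dest!: multi_member_split)
    then show "M \<in> mset ` {xs. set xs \<subseteq> {..N} \<and> length xs \<le> N}"
      using M size_le_sum_mset[of M] by (auto simp: parts_le_def xs)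
  qed
  show "finite (mset ` {xs. set xs \<subseteq> {..N} \<and> length xs \<le> N})"
    by (intro finite_imageI finite_lists_length_le) simp
qed

text \<open>Bounded degree makes the expansion finite. Every larger bound is allowed too, so that
  later the index set can be made to contain a prescribed type.\<close>

lemma Lam_expand_monsym:
  assumes "f \<in> Lam"
  obtains N where "\<And>D. N \<le> D \<Longrightarrow> f = (\<Sum>M\<in>parts_le D. mscale (gcoeff f M) (monsym M))"
proof -
  obtain N where N: "\<And>\<alpha>. mcoeff f \<alpha> \<noteq> 0 \<Longrightarrow> mdeg \<alpha> \<le> N" using Lam_bound assms by blast
  have "f = (\<Sum>M\<in>parts_le D. mscale (gcoeff f M) (monsym M))" if "N \<le> D" for D
  proof (rule mps_eqI)
    fix \<alpha>
    have "mcoeff (\<Sum>M\<in>parts_le D. mscale (gcoeff f M) (monsym M)) \<alpha> =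
        (\<Sum>M\<in>parts_le D. if mtype \<alpha> = M then gcoeff f (mtype \<alpha>) else 0)"
      unfolding mcoeff_sum by (intro sum.cong) (auto simp: mcoeff_monsym)
    also have "\<dots> = mcoeff f \<alpha>"
      using N[of \<alpha>] that
      by (subst sum.delta'[OF finite_parts_le]) (force simp: parts_le_def mdeg_mtype Lam_mcoeff[OF assms])
    finally show "mcoeff f \<alpha> = mcoeff (\<Sum>M\<in>parts_le D. mscale (gcoeff f M) (monsym M)) \<alpha>" ..
  qed
  then show ?thesis using that by blast
qed

text \<open>The joint alphabet carries the union of the two types and renaming keeps types, so for
  symmetric \<open>f\<close> the enumeration of the joint alphabet disappears.\<close>

lemma Lam_coproduct:
  assumes "f \<in> Lam"
  shows "mcoeff (coproduct f) (join \<beta> \<gamma>) = gcoeff f (mtype \<beta> + mtype \<gamma>)"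
  using assms by (simp add: mcoeff_coproduct Lam_mcoeff mtype_map_key bij_sum_decode)

lemma Lam_degree_part [simp]:
  assumes "f \<in> Lam"
  shows "degree_part n f \<in> Lam"
  by (rule LamI[where h = "\<lambda>M. if sum_mset M = n then gcoeff f M else 0" and N = n])
     (auto simp: mdeg_mtype Lam_mcoeff[OF assms] split: if_splits)

section \<open>Power sums span\<close>

definition Pprod :: "nat multiset \<Rightarrow> (nat, 'a::comm_ring_1) mps" where
  "Pprod M = prod_mset (image_mset psym M)"

definition Hprod :: "nat multiset \<Rightarrow> (nat, 'a::comm_ring_1) mps" where
  "Hprod M = prod_mset (image_mset hsym M)"

lemma Pprod_simps [simp]: "Pprod {#} = 1" "Pprod (add_mset r M) = psym r * Pprod M"
  by (simp_all add: Pprod_def)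

lemma Hprod_simps [simp]: "Hprod {#} = 1" "Hprod (add_mset r M) = hsym r * Hprod M"
  by (simp_all add: Hprod_def)

lemma Hprod_add: "Hprod (M + N) = Hprod M * Hprod N"
  by (simp add: Hprod_def)

lemma Lam_Pprod [simp]: "0 \<notin># M \<Longrightarrow> Pprod M \<in> Lam"
  unfolding Pprod_def by (rule Lam_prod_mset) (metis Lam_psym)

lemma Lam_Hprod [simp]: "Hprod M \<in> Lam"
  by (simp add: Hprod_def)

text \<open>Multiplying by a power of one variable either appends the part \<open>j\<close>, if the
  variable was absent, or enlarges an existing part by \<open>j\<close>. The number of parts grows
  only in the first case.\<close>

lemma mtype_single_add:
  assumes "j \<noteq> 0"
  obtains R where "mtype \<gamma> = R + (if Poly_Mapping.lookup \<gamma> i = 0 then {#} else {#Poly_Mapping.lookup \<gamma> i#})"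
    "mtype (Poly_Mapping.single i j + \<gamma>) = R + {#Poly_Mapping.lookup \<gamma> i + j#}"
proof -
  let ?a = "Poly_Mapping.lookup \<gamma> i"
  define \<gamma>' where "\<gamma>' = \<gamma> - Poly_Mapping.single i ?a"
  have \<gamma>: "\<gamma> = Poly_Mapping.single i ?a + \<gamma>'"
    by (rule poly_mapping_eqI) (auto simp: \<gamma>'_def lookup_add lookup_minus lookup_single when_def)
  have i: "i \<notin> Poly_Mapping.keys \<gamma>'"
    by (simp add: in_keys_iff \<gamma>'_def lookup_minus)
  have *: "mtype (Poly_Mapping.single i b + \<gamma>') = (if b = 0 then {#} else {#b#}) + mtype \<gamma>'" for b
    using i by (subst mtype_disjoint_add) (auto simp: mtype_single)
  have "Poly_Mapping.single i j + \<gamma> = Poly_Mapping.single i (?a + j) + \<gamma>'"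
    by (subst \<gamma>) (simp add: single_add add_ac)
  then have "mtype (Poly_Mapping.single i j + \<gamma>) = mtype \<gamma>' + {#?a + j#}"
    using assms *[of "?a + j"] by (simp only: add_ac) simp
  moreover have "mtype \<gamma> = mtype \<gamma>' + (if ?a = 0 then {#} else {#?a#})"
    by (subst \<gamma>, subst *) (simp add: add_ac)
  ultimately show ?thesis using that by blast
qed

lemma mcoeff_psym_monsym:
  "mcoeff (psym j * monsym N) \<alpha> =
     of_nat (card {(\<beta>, \<gamma>) \<in> splits \<alpha>. (\<exists>i. \<beta> = Poly_Mapping.single i j) \<and> mtype \<gamma> = N})"
proof -
  have "mcoeff (psym j * monsym N) \<alpha> = (\<Sum>x\<in>splits \<alpha>.
      if (\<exists>i. fst x = Poly_Mapping.single i j) \<and> mtype (snd x) = N then 1 else 0)"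
    unfolding mcoeff_mult
    by (intro sum.cong) (auto simp: mcoeff_psym mcoeff_monsym)
  also have "\<dots> = of_nat (card {x \<in> splits \<alpha>. (\<exists>i. fst x = Poly_Mapping.single i j) \<and> mtype (snd x) = N})"
    by (simp flip: sum.inter_filter)
  also have "{x \<in> splits \<alpha>. (\<exists>i. fst x = Poly_Mapping.single i j) \<and> mtype (snd x) = N} =
      {(\<beta>, \<gamma>) \<in> splits \<alpha>. (\<exists>i. \<beta> = Poly_Mapping.single i j) \<and> mtype \<gamma> = N}"
    by auto
  finally show ?thesis .
qed

text \<open>
  Modulo monomial functions with fewer parts (whose largest part is at least as large),
  \<open>p\<^sub>j m\<^sub>N\<close> is a nonzero multiple of \<open>m\<^sub>N\<^sub>\<union>\<^sub>j\<close>.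
\<close>

lemma gcoeff_psym_monsym:
  assumes "j \<noteq> 0" "0 \<notin># K" "gcoeff (psym j * monsym N :: (nat, 'a::field_char_0) mps) K \<noteq> 0" "K \<noteq> add_mset j N"
  shows "size K \<le> size N \<and> sum_mset K = j + sum_mset N \<and> (\<exists>l\<in>#K. j \<le> l)"
proof -
  from assms(3) obtain \<beta> \<gamma> where "(\<beta>, \<gamma>) \<in> {(\<beta>, \<gamma>) \<in> splits (exps_of K). (\<exists>i. \<beta> = Poly_Mapping.single i j) \<and> mtype \<gamma> = N}"
    unfolding gcoeff_def mcoeff_psym_monsym
    by (metis (no_types, lifting) card.empty of_nat_0 ex_in_conv surj_pair)
  then obtain i where i: "exps_of K = Poly_Mapping.single i j + \<gamma>" and N: "mtype \<gamma> = N"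
    by (auto simp: splits_def) metis
  obtain R where R: "mtype \<gamma> = R + (if Poly_Mapping.lookup \<gamma> i = 0 then {#} else {#Poly_Mapping.lookup \<gamma> i#})"
    "mtype (Poly_Mapping.single i j + \<gamma>) = R + {#Poly_Mapping.lookup \<gamma> i + j#}"
    using mtype_single_add[OF assms(1)] .
  have K: "K = R + {#Poly_Mapping.lookup \<gamma> i + j#}"
    using R(2) mtype_exps_of[OF assms(2)] i by simp
  \<comment> \<open>Otherwise \<open>j\<close> is appended as a new part, which is the excluded
    leading type.\<close>
  have "Poly_Mapping.lookup \<gamma> i \<noteq> 0"
  proof
    assume "Poly_Mapping.lookup \<gamma> i = 0"
    then show False using assms(4) R(1) N K by simp
  qed
  with K R(1) N show ?thesis by auto
qed

text \<open>The coefficient counts splittings, and splitting off a variable whose exponent is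
  exactly \<open>j\<close> is one of them. In characteristic zero a positive count is
  nonzero.\<close>

lemma gcoeff_psym_monsym_leading:
  assumes "j \<noteq> 0" "0 \<notin># N"
  shows "gcoeff (psym j * monsym N :: (nat, 'a::field_char_0) mps) (add_mset j N) \<noteq> 0"
proof -
  let ?\<alpha> = "exps_of (add_mset j N)"
  have t: "mtype ?\<alpha> = add_mset j N" using assms by (simp add: mtype_exps_of)
  then have "j \<in># mtype ?\<alpha>" by simp
  then obtain i where i: "Poly_Mapping.lookup ?\<alpha> i = j" by (auto simp: in_mtype_iff)
  define \<gamma> where "\<gamma> = ?\<alpha> - Poly_Mapping.single i j"
  have \<alpha>: "?\<alpha> = Poly_Mapping.single i j + \<gamma>"
    by (rule poly_mapping_eqI) (auto simp: \<gamma>_def lookup_add lookup_minus lookup_single when_def i)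
  have "Poly_Mapping.lookup \<gamma> i = 0" by (simp add: \<gamma>_def lookup_minus i)
  then have "mtype \<gamma> = N" using mtype_single_add[OF assms(1), of \<gamma> i] t \<alpha> by auto
  define S where "S = {(\<beta>, \<gamma>) \<in> splits ?\<alpha>. (\<exists>i. \<beta> = Poly_Mapping.single i j) \<and> mtype \<gamma> = N}"
  have "(Poly_Mapping.single i j, \<gamma>) \<in> S"
    using \<alpha> \<open>mtype \<gamma> = N\<close> by (auto simp: S_def)
  moreover have "finite S"
    unfolding S_def by (rule finite_subset[OF _ finite_splits[of ?\<alpha>]]) auto
  ultimately have "card S \<noteq> 0" by auto
  then show ?thesis unfolding gcoeff_def mcoeff_psym_monsym S_def[symmetric] by simp
qed

text \<open>Induction on the number of parts: remove a part \<open>j\<close>, leaving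
  \<open>N\<close>, and solve for \<open>monsym M\<close> in the expansion of
  \<open>psym j * monsym N\<close>, whose other terms have fewer parts. Merging only enlarges parts,
  so some part of size at least \<open>j\<close> always survives. That clause later yields
  membership in the ideal, and the control of the degree serves the dimension count.\<close>

lemma monsym_in_span_Pprod:
  assumes "0 \<notin># M" "j \<in># M"
  shows "(monsym M :: (nat, 'a::field_char_0) mps) \<in>
    mps.span {Pprod L |L. 0 \<notin># L \<and> sum_mset L = sum_mset M \<and> (\<exists>l\<in>#L. j \<le> l)}"
  using assms
proof (induction "size M" arbitrary: M j rule: less_induct)
  case less
  let ?S = "{Pprod L |L. 0 \<notin># L \<and> sum_mset L = sum_mset M \<and> (\<exists>l\<in>#L. j \<le> l)} :: (nat, 'a) mps set"
  from less.prems obtain N where M: "M = add_mset j N" by (metis multi_member_split)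
  with less.prems have j: "j \<noteq> 0" and N: "0 \<notin># N" by auto
  define f :: "(nat, 'a) mps" where "f = psym j * monsym N"
  have fin: "f \<in> mps.span ?S"
  proof (cases "N = {#}")
    case True
    have "monsym {#} = (1 :: (nat, 'a) mps)"
      by (rule mps_eqI) (auto simp: mcoeff_monsym mcoeff_one mtype_eq_empty_iff)
    then have "f = Pprod M" by (simp add: f_def M True)
    then show ?thesis using less.prems by (intro mps.span_base) auto
  next
    case False
    \<comment> \<open>Any part of \<open>N\<close> will do here, because the large part demanded of
      \<open>L\<close> is supplied by the factor \<open>psym j\<close>.\<close>
    then obtain j' where "j' \<in># N" by blast
    with less.hyps[of N j'] N M
    have "monsym N \<in> mps.span {Pprod L :: (nat, 'a) mps |L. 0 \<notin># L \<and> sum_mset L = sum_mset N \<and> (\<exists>l\<in>#L. j' \<le> l)}"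
      by simp
    then show ?thesis unfolding f_def
    proof (induction rule: mps.span_induct_alt)
      case base
      then show ?case by (simp add: mps.span_zero)
    next
      case (step c x y)
      then obtain L where L: "x = Pprod L" "0 \<notin># L" "sum_mset L = sum_mset N" by auto
      then have "psym j * x = Pprod (add_mset j L)" by simp
      moreover have "Pprod (add_mset j L) \<in> ?S" using L j M
        by (intro CollectI exI[of _ "add_mset j L"]) auto
      ultimately have "psym j * x \<in> mps.span ?S" by (simp add: mps.span_base)
      then show ?case using step.IH by (simp add: distrib_left mps.span_add mps.span_scale)
    qed
  qed
  have "f \<in> Lam" using j by (simp add: f_def)
  then obtain D0 where D0: "\<And>D. D0 \<le> D \<Longrightarrow> f = (\<Sum>K\<in>parts_le D. mscale (gcoeff f K) (monsym K))"
    by (rule Lam_expand_monsym) blast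
  define D where "D = max D0 (sum_mset M)"
  have MD: "M \<in> parts_le D" using less.prems by (simp add: parts_le_def D_def)
  have "f = mscale (gcoeff f M) (monsym M) + (\<Sum>K\<in>parts_le D - {M}. mscale (gcoeff f K) (monsym K))"
    using MD by (subst D0[of D]) (auto simp: D_def sum.remove)
  then have eq: "mscale (gcoeff f M) (monsym M) = f - (\<Sum>K\<in>parts_le D - {M}. mscale (gcoeff f K) (monsym K))"
    by (metis add_diff_cancel_right')
  have "mscale (gcoeff f K) (monsym K) \<in> mps.span ?S" if K: "K \<in> parts_le D - {M}" for K
  proof (cases "gcoeff f K = 0")
    case False
    then have *: "size K \<le> size N \<and> sum_mset K = j + sum_mset N \<and> (\<exists>l\<in>#K. j \<le> l)"
      using K M j by (intro gcoeff_psym_monsym) (auto simp: f_def parts_le_def)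
    then obtain l where l: "l \<in># K" "j \<le> l" by blast
    \<comment> \<open>\<open>K\<close> has fewer parts than \<open>M\<close>, and its own large part
      \<open>l\<close> takes over the role of \<open>j\<close>.\<close>
    have "monsym K \<in> mps.span {Pprod L :: (nat, 'a) mps |L. 0 \<notin># L \<and> sum_mset L = sum_mset K \<and> (\<exists>l'\<in>#L. l \<le> l')}"
      using * l K M by (intro less.hyps) (auto simp: parts_le_def)
    also have "\<dots> \<subseteq> mps.span ?S"
      using * l M by (intro mps.span_mono) (auto, metis le_trans)
    finally show ?thesis by (rule mps.span_scale)
  qed (simp add: mps.span_zero)
  then have "mscale (gcoeff f M) (monsym M) \<in> mps.span ?S"
    unfolding eq by (intro mps.span_diff fin mps.span_sum)
  then have "mscale (inverse (gcoeff f M)) (mscale (gcoeff f M) (monsym M)) \<in> mps.span ?S"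
    by (rule mps.span_scale)
  moreover have "gcoeff f M \<noteq> 0"
    unfolding f_def M using j N by (rule gcoeff_psym_monsym_leading)
  ultimately show ?case by simp
qed

section \<open>Power sums and complete symmetric functions as bases\<close>

definition parts :: "nat multiset set" where
  "parts = {M. 0 \<notin># M}"

lemma parts_le_subset_parts: "parts_le N \<subseteq> parts"
  by (auto simp: parts_le_def parts_def)

text \<open>A maximal independent subset of \<open>S\<close> still spans \<open>T\<close>, so by the
  exchange bound it is no smaller than \<open>T\<close>, hence all of \<open>S\<close>.\<close>

lemma (in vector_space) independent_if_spans_large:
  assumes "finite S" "independent T" "T \<subseteq> span S" "card S \<le> card T"
  shows "independent S"
proof -
  obtain B where B: "B \<subseteq> S" "independent B" "S \<subseteq> span B"
    by (rule maximal_independent_subset)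
  have "T \<subseteq> span B" using assms(3) B(3) by (metis span_minimal subspace_span order_trans)
  moreover have "finite B" using B(1) assms(1) by (rule finite_subset)
  ultimately have "card T \<le> card B" using independent_span_bound assms(2) by blast
  then have "B = S" using B(1) assms(1,4) by (intro card_seteq) auto
  with B(2) show ?thesis by simp
qed

lemma inj_on_monsym: "inj_on (monsym :: nat multiset \<Rightarrow> (nat, 'a::field) mps) parts"
proof (rule inj_onI)
  fix M N assume "M \<in> parts" "N \<in> parts" "monsym M = (monsym N :: (nat, 'a) mps)"
  then have "gcoeff (monsym M :: (nat, 'a) mps) M = gcoeff (monsym N) M" by simp
  with \<open>M \<in> parts\<close> show "M = N" by (simp add: parts_def gcoeff_monsym split: if_splits)
qed

lemma independent_monsym: "mps.independent ((monsym :: _ \<Rightarrow> (nat, 'a::field) mps) ` parts_le N)"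
proof (rule mps.independent_if_scalars_zero)
  fix f :: "(nat, 'a) mps \<Rightarrow> 'a" and x :: "(nat, 'a) mps"
  assume 0: "(\<Sum>x\<in>monsym ` parts_le N. mscale (f x) x) = 0" and x: "x \<in> monsym ` parts_le N"
  have "inj_on (monsym :: _ \<Rightarrow> (nat, 'a) mps) (parts_le N)"
    using inj_on_monsym parts_le_subset_parts by (rule inj_on_subset)
  then have 0: "(\<Sum>M\<in>parts_le N. mscale (f (monsym M)) (monsym M)) = 0"
    using 0 by (subst (asm) sum.reindex) (auto simp: comp_def)
  from x obtain K where K: "x = monsym K" "K \<in> parts_le N" by auto
  have "0 = gcoeff (\<Sum>M\<in>parts_le N. mscale (f (monsym M)) (monsym M :: (nat, 'a) mps)) K"
    by (simp add: 0)
  also have "\<dots> = (\<Sum>M\<in>parts_le N. if K = M then f (monsym K) else 0)"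
    using K by (auto simp: gcoeff_monsym parts_le_def intro!: sum.cong)
  also have "\<dots> = f x" using K by simp
  finally show "f x = 0" ..
qed simp

text \<open>A dimension count at each degree bound: the family spans as many independent monomial
  functions as it has indices, so it can neither repeat nor satisfy a linear relation. The stages
  form a chain, so both properties pass to the union.\<close>

lemma spanning_family_basis:
  fixes G :: "nat multiset \<Rightarrow> (nat, 'a::field) mps"
  assumes "\<And>N. monsym ` parts_le N \<subseteq> mps.span (G ` parts_le N)"
  shows "mps.independent (G ` parts)" "inj_on G parts"
proof -
  have inj: "inj_on G (parts_le N)" and ind: "mps.independent (G ` parts_le N)" for N
  proof -
    have c: "card ((monsym :: _ \<Rightarrow> (nat, 'a) mps) ` parts_le N) = card (parts_le N)"
      by (intro card_image inj_on_subset[OF inj_on_monsym parts_le_subset_parts])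
    have "card ((monsym :: _ \<Rightarrow> (nat, 'a) mps) ` parts_le N) \<le> card (G ` parts_le N)"
      using mps.independent_span_bound[OF _ independent_monsym assms] by simp
    then have "card (G ` parts_le N) = card (parts_le N)"
      using c card_image_le[of "parts_le N" G] by simp
    then show "inj_on G (parts_le N)" by (intro eq_card_imp_inj_on) auto
    show "mps.independent (G ` parts_le N)"
      using c card_image_le[of "parts_le N" G]
      by (intro mps.independent_if_spans_large[OF _ independent_monsym assms]) auto
  qed
  have parts: "parts = (\<Union>N. parts_le N)" by (auto simp: parts_def parts_le_def)
  have "parts_le a \<subseteq> parts_le b" if "a \<le> b" for a b using that by (auto simp: parts_le_def)
  then have mono: "parts_le a \<subseteq> parts_le b \<or> parts_le b \<subseteq> parts_le a" for a b
    by (meson nat_le_linear)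
  show "inj_on G parts"
    unfolding parts using mono inj by (intro inj_on_UNION_chain) auto
  have "mps.independent (\<Union> (range (\<lambda>N. G ` parts_le N)))"
    using mono ind by (intro mps.independent_Union_directed) (auto, metis image_mono subsetD imageI)
  then show "mps.independent (G ` parts)"
    unfolding parts by (simp add: image_UN)
qed

lemma monsym_in_span_Pprod_le:
  "(monsym :: _ \<Rightarrow> (nat, 'a::field_char_0) mps) ` parts_le N \<subseteq> mps.span (Pprod ` parts_le N)"
proof
  fix x :: "(nat, 'a) mps" assume "x \<in> monsym ` parts_le N"
  then obtain M where M: "x = monsym M" "M \<in> parts_le N" by auto
  show "x \<in> mps.span (Pprod ` parts_le N)"
  proof (cases "M = {#}")
    case True
    then have "x = Pprod {#}"
      by (intro mps_eqI) (auto simp: M(1) mcoeff_monsym mcoeff_one mtype_eq_empty_iff)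
    then show ?thesis using M True by (auto simp del: Pprod_simps intro: mps.span_base)
  next
    case False
    then obtain j where j: "j \<in># M" by blast
    have "x \<in> mps.span {Pprod L |L. 0 \<notin># L \<and> sum_mset L = sum_mset M \<and> (\<exists>l\<in>#L. j \<le> l)}"
      unfolding M(1) using M(2) j by (intro monsym_in_span_Pprod) (auto simp: parts_le_def)
    also have "\<dots> \<subseteq> mps.span (Pprod ` parts_le N)"
      using M(2) by (intro mps.span_mono) (auto simp: parts_le_def)
    finally show ?thesis .
  qed
qed

lemmas independent_Pprod = spanning_family_basis(1)[OF monsym_in_span_Pprod_le]
lemmas inj_on_Pprod = spanning_family_basis(2)[OF monsym_in_span_Pprod_le]

lemma Lam_span_Pprod:
  fixes f :: "(nat, 'a::field_char_0) mps"
  assumes "f \<in> Lam"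
  shows "f \<in> mps.span (Pprod ` parts)"
proof -
  obtain N where N: "f = (\<Sum>M\<in>parts_le N. mscale (gcoeff f M) (monsym M))"
    using Lam_expand_monsym[OF assms] by blast
  have "monsym M \<in> mps.span (Pprod ` parts :: (nat, 'a) mps set)" if "M \<in> parts_le N" for M
  proof -
    have "monsym M \<in> mps.span (Pprod ` parts_le N :: (nat, 'a) mps set)"
      using monsym_in_span_Pprod_le that by blast
    then show ?thesis
      using mps.span_mono[OF image_mono[OF parts_le_subset_parts]] by blast
  qed
  then show ?thesis by (subst N) (intro mps.span_sum mps.span_scale)
qed

section \<open>Newton's identity\<close>

lemma card_single_splits:
  assumes "i \<noteq> 0"
  shows "card {(\<beta>, \<gamma>) \<in> splits \<alpha>. \<exists>v. \<beta> = Poly_Mapping.single v i} =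
    card {v \<in> Poly_Mapping.keys \<alpha>. i \<le> Poly_Mapping.lookup \<alpha> v}"
proof -
  have "bij_betw (\<lambda>v. (Poly_Mapping.single v i, \<alpha> - Poly_Mapping.single v i))
    {v \<in> Poly_Mapping.keys \<alpha>. i \<le> Poly_Mapping.lookup \<alpha> v}
    {(\<beta>, \<gamma>) \<in> splits \<alpha>. \<exists>v. \<beta> = Poly_Mapping.single v i}"
    unfolding bij_betw_def
  proof (intro conjI equalityI subsetI)
    show "inj_on (\<lambda>v. (Poly_Mapping.single v i, \<alpha> - Poly_Mapping.single v i))
        {v \<in> Poly_Mapping.keys \<alpha>. i \<le> Poly_Mapping.lookup \<alpha> v}"
      using assms by (auto simp: inj_on_def dest!: arg_cong[where f = Poly_Mapping.keys])
  next
    fix x assume "x \<in> (\<lambda>v. (Poly_Mapping.single v i, \<alpha> - Poly_Mapping.single v i)) `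
        {v \<in> Poly_Mapping.keys \<alpha>. i \<le> Poly_Mapping.lookup \<alpha> v}"
    then obtain v where v: "x = (Poly_Mapping.single v i, \<alpha> - Poly_Mapping.single v i)" "i \<le> Poly_Mapping.lookup \<alpha> v"
      by auto
    then have "Poly_Mapping.single v i + (\<alpha> - Poly_Mapping.single v i) = \<alpha>"
      by (intro poly_mapping_eqI) (auto simp: lookup_add lookup_minus lookup_single when_def)
    with v(1) show "x \<in> {(\<beta>, \<gamma>) \<in> splits \<alpha>. \<exists>v. \<beta> = Poly_Mapping.single v i}" by auto
  next
    fix x assume "x \<in> {(\<beta>, \<gamma>) \<in> splits \<alpha>. \<exists>v. \<beta> = Poly_Mapping.single v i}"
    then obtain v \<gamma> where v: "x = (Poly_Mapping.single v i, \<gamma>)" "\<alpha> = Poly_Mapping.single v i + \<gamma>"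
      by (auto simp: splits_def)
    then have "i \<le> Poly_Mapping.lookup \<alpha> v" "\<gamma> = \<alpha> - Poly_Mapping.single v i" by (auto simp: lookup_add)
    moreover from this have "v \<in> Poly_Mapping.keys \<alpha>" using assms by (auto simp: in_keys_iff)
    ultimately show "x \<in> (\<lambda>v. (Poly_Mapping.single v i, \<alpha> - Poly_Mapping.single v i)) `
        {v \<in> Poly_Mapping.keys \<alpha>. i \<le> Poly_Mapping.lookup \<alpha> v}"
      using v(1) by (intro rev_image_eqI[of v]) simp_all
  qed
  then show ?thesis by (rule bij_betw_same_card[symmetric])
qed

lemma mdeg_single [simp]: "mdeg (Poly_Mapping.single v i) = i"
  by (simp add: mdeg_def)

text \<open>At a monomial of degree \<open>n\<close> the right side counts the pairs of a variable
  and a number from 1 up to its exponent. There are as many of these as the degree.\<close>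

lemma newton_identity:
  "mscale (of_nat n) (hsym n) = (\<Sum>i\<in>{1..n}. psym i * hsym (n - i) :: (nat, 'a::comm_ring_1) mps)"
proof (rule mps_eqI)
  fix \<alpha> :: "nat \<Rightarrow>\<^sub>0 nat"
  have tm: "mcoeff (psym i * hsym (n - i) :: (nat, 'a) mps) \<alpha> =
      (if mdeg \<alpha> = n then of_nat (card {v \<in> Poly_Mapping.keys \<alpha>. i \<le> Poly_Mapping.lookup \<alpha> v}) else 0)"
    if i: "i \<in> {1..n}" for i
  proof -
    have "mcoeff (psym i * hsym (n - i) :: (nat, 'a) mps) \<alpha> = (\<Sum>x\<in>splits \<alpha>.
        if mdeg \<alpha> = n \<and> (\<exists>v. fst x = Poly_Mapping.single v i) then 1 else 0)"
      unfolding mcoeff_mult using i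
      by (intro sum.cong) (auto simp: mcoeff_psym mcoeff_hsym)
    also have "\<dots> = (if mdeg \<alpha> = n then of_nat (card {x \<in> splits \<alpha>. \<exists>v. fst x = Poly_Mapping.single v i}) else 0)"
      by (simp flip: sum.inter_filter)
    also have "{x \<in> splits \<alpha>. \<exists>v. fst x = Poly_Mapping.single v i} =
        {(\<beta>, \<gamma>) \<in> splits \<alpha>. \<exists>v. \<beta> = Poly_Mapping.single v i}"
      by auto
    finally show ?thesis using i card_single_splits[of i \<alpha>] by simp
  qed
  have "(\<Sum>i\<in>{1..n}. card {v \<in> Poly_Mapping.keys \<alpha>. i \<le> Poly_Mapping.lookup \<alpha> v}) = n" if n: "mdeg \<alpha> = n"
  proof -
    have "(\<Sum>i\<in>{1..n}. card {v \<in> Poly_Mapping.keys \<alpha>. i \<le> Poly_Mapping.lookup \<alpha> v}) =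
        (\<Sum>i\<in>{1..n}. \<Sum>v\<in>Poly_Mapping.keys \<alpha>. if i \<le> Poly_Mapping.lookup \<alpha> v then 1 else 0)"
      by (simp flip: sum.inter_filter)
    also have "\<dots> = (\<Sum>v\<in>Poly_Mapping.keys \<alpha>. \<Sum>i\<in>{1..n}. if i \<le> Poly_Mapping.lookup \<alpha> v then 1 else 0)"
      by (rule sum.swap)
    also have "\<dots> = (\<Sum>v\<in>Poly_Mapping.keys \<alpha>. Poly_Mapping.lookup \<alpha> v)"
    proof (rule sum.cong)
      fix v assume "v \<in> Poly_Mapping.keys \<alpha>"
      \<comment> \<open>No exponent exceeds the degree, so stopping the outer sum at
        \<open>n\<close> loses nothing.\<close>
      then have "Poly_Mapping.lookup \<alpha> v \<le> n"
        unfolding n[symmetric] mdeg_def by (intro member_le_sum) auto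
      then have "{i \<in> {1..n}. i \<le> Poly_Mapping.lookup \<alpha> v} = {1..Poly_Mapping.lookup \<alpha> v}" by auto
      then show "(\<Sum>i\<in>{1..n}. if i \<le> Poly_Mapping.lookup \<alpha> v then 1 else 0) = Poly_Mapping.lookup \<alpha> v"
        by (simp flip: sum.inter_filter)
    qed simp
    finally show ?thesis using n by (simp add: mdeg_def)
  qed
  then have "(\<Sum>i\<in>{1..n}. of_nat (card {v \<in> Poly_Mapping.keys \<alpha>. i \<le> Poly_Mapping.lookup \<alpha> v})) = (of_nat n :: 'a)"
    if "mdeg \<alpha> = n"
    using that by (simp flip: of_nat_sum)
  then show "mcoeff (mscale (of_nat n) (hsym n)) \<alpha> = mcoeff (\<Sum>i\<in>{1..n}. psym i * hsym (n - i) :: (nat, 'a) mps) \<alpha>"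
    by (simp add: tm mcoeff_hsym)
qed

section \<open>Spans of products of complete symmetric functions\<close>

definition Hspan :: "nat \<Rightarrow> (nat, 'a::field) mps set" where
  "Hspan n = mps.span {Hprod L |L. 0 \<notin># L \<and> sum_mset L = n}"

lemma Hspan_mult:
  assumes "x \<in> Hspan a" "y \<in> Hspan b"
  shows "x * y \<in> Hspan (a + b)"
  using assms(1) unfolding Hspan_def
proof (induction rule: mps.span_induct_alt)
  case (step c u v)
  then obtain L where L: "u = Hprod L" "0 \<notin># L" "sum_mset L = a" by auto
  have "u * y \<in> mps.span {Hprod L |L. 0 \<notin># L \<and> sum_mset L = a + b}"
    using assms(2) unfolding Hspan_def
  proof (induction rule: mps.span_induct_alt)
    case (step d u' v')
    then obtain L' where L': "u' = Hprod L'" "0 \<notin># L'" "sum_mset L' = b" by auto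
    have "u * u' = Hprod (L + L')" by (simp add: L L' Hprod_add)
    then have "u * u' \<in> mps.span {Hprod L |L. 0 \<notin># L \<and> sum_mset L = a + b}"
      using L L' by (intro mps.span_base) (auto intro!: exI[of _ "L + L'"])
    then show ?case using step.IH by (simp add: distrib_left mps.span_add mps.span_scale)
  qed (simp add: mps.span_zero)
  then show ?case using step.IH by (simp add: distrib_right mps.span_add mps.span_scale)
qed (simp add: mps.span_zero)

lemma Hspan_hsym: "hsym n \<in> Hspan n"
proof (cases "n = 0")
  case True
  then show ?thesis unfolding Hspan_def
    by (intro mps.span_base) (auto intro!: exI[of _ "{#}"])
next
  case False
  then show ?thesis unfolding Hspan_def
    by (intro mps.span_base) (auto intro!: exI[of _ "{#n#}"])
qed

text \<open>As \<open>hsym 0 = 1\<close>, the term \<open>i = n\<close> of Newton's identity is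
  \<open>psym n\<close> itself; the remaining terms are covered by induction.\<close>

lemma Hspan_psym:
  "n \<noteq> 0 \<Longrightarrow> (psym n :: (nat, 'a::field_char_0) mps) \<in> Hspan n"
proof (induction n rule: less_induct)
  case (less n)
  then have n: "{1..n} = insert n {1..<n}" by auto
  have "mscale (of_nat n) (hsym n) = psym n + (\<Sum>i\<in>{1..<n}. psym i * hsym (n - i) :: (nat, 'a) mps)"
    unfolding newton_identity n by simp
  then have "psym n = mscale (of_nat n) (hsym n) - (\<Sum>i\<in>{1..<n}. psym i * hsym (n - i) :: (nat, 'a) mps)"
    by simp
  also have "\<dots> \<in> Hspan n"
  proof -
    have "psym i * hsym (n - i) \<in> (Hspan n :: (nat, 'a) mps set)" if "i \<in> {1..<n}" for i
      using Hspan_mult[OF less.IH[of i] Hspan_hsym[of "n - i"]] that by simp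
    then show ?thesis
      using Hspan_hsym[of n] unfolding Hspan_def by (intro mps.span_diff mps.span_scale mps.span_sum)
  qed
  finally show ?case .
qed

lemma Hspan_Pprod: "0 \<notin># M \<Longrightarrow> (Pprod M :: (nat, 'a::field_char_0) mps) \<in> Hspan (sum_mset M)"
proof (induction M)
  case empty
  then show ?case using Hspan_hsym[of 0] by simp
next
  case (add r M)
  then show ?case using Hspan_mult[OF Hspan_psym] by auto
qed

text \<open>The degree bound survives the passage from monomial functions through power sums to
  complete functions, as the dimension count requires.\<close>

lemma monsym_in_span_Hprod_le:
  "(monsym :: _ \<Rightarrow> (nat, 'a::field_char_0) mps) ` parts_le N \<subseteq> mps.span (Hprod ` parts_le N)"
proof -
  have "Pprod M \<in> mps.span (Hprod ` parts_le N :: (nat, 'a) mps set)" if "M \<in> parts_le N" for M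
  proof -
    have "Pprod M \<in> mps.span {Hprod L :: (nat, 'a) mps |L. 0 \<notin># L \<and> sum_mset L = sum_mset M}"
      using Hspan_Pprod[of M] that by (simp add: parts_le_def Hspan_def)
    also have "\<dots> \<subseteq> mps.span (Hprod ` parts_le N)"
      using that by (intro mps.span_mono) (auto simp: parts_le_def)
    finally show ?thesis .
  qed
  then have "mps.span (Pprod ` parts_le N) \<subseteq> mps.span (Hprod ` parts_le N :: (nat, 'a) mps set)"
    by (intro mps.span_minimal) auto
  then show ?thesis using monsym_in_span_Pprod_le by blast
qed

lemmas independent_Hprod = spanning_family_basis(1)[OF monsym_in_span_Hprod_le]
lemmas inj_on_Hprod = spanning_family_basis(2)[OF monsym_in_span_Hprod_le]

section \<open>The Hall pairing and the antipode\<close>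

lemma prod_list_hsym: "prod_list (map hsym xs) = Hprod (mset xs)"
  by (induction xs) auto

lemma partitions_mset_inject:
  assumes "\<nu> \<in> partitions" "\<mu> \<in> partitions" "mset \<nu> = mset \<mu>"
  shows "\<nu> = \<mu>"
proof -
  have "sorted (rev \<nu>)" "sorted (rev \<mu>)"
    using assms by (auto simp: partitions_def sorted_wrt_rev)
  then have "rev \<nu> = rev \<mu>" using assms(3) by (metis mset_rev properties_for_sort)
  then show ?thesis by simp
qed

lemma partitions_mset_parts: "\<nu> \<in> partitions \<Longrightarrow> mset \<nu> \<in> parts"
  by (auto simp: partitions_def parts_def)

lemma parts_obtain_partition:
  assumes "M \<in> parts"
  obtains \<nu> where "\<nu> \<in> partitions" "mset \<nu> = M"
proof
  show "rev (sorted_list_of_multiset M) \<in> partitions"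
    using assms by (auto simp: partitions_def parts_def sorted_wrt_rev Suc_le_eq intro: gr0I)
qed simp

text \<open>On the basis of complete products, pairing with \<open>u\<close> is prescribed as taking
  the coefficient \<open>gcoeff u\<close>. \<open>construct\<close> is linear in the prescribed
  values too, which gives linearity in the second argument.\<close>

lemma is_hall_exists: "\<exists>B :: (nat, 'a::field_char_0) mps \<Rightarrow> (nat, 'a) mps \<Rightarrow> 'a. is_hall B"
proof -
  interpret vector_space_pair "mscale :: 'a \<Rightarrow> (nat, 'a) mps \<Rightarrow> (nat, 'a) mps" "(*) :: 'a \<Rightarrow> 'a \<Rightarrow> 'a"
    by unfold_locales (simp_all add: algebra_simps)
  define bas :: "(nat, 'a) mps set" where "bas = Hprod ` parts"
  define \<phi> where "\<phi> u b = gcoeff u (the_inv_into parts Hprod b)" for u b :: "(nat, 'a) mps"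
  have ind: "mps.independent bas" unfolding bas_def by (rule independent_Hprod)
  define B where "B f u = construct bas (\<phi> u) f" for f u
  have lin: "Vector_Spaces.linear mscale (*) (construct bas (\<phi> u))" for u
    by (rule linear_construct[OF ind])
  have "is_hall B" unfolding is_hall_def
  proof (intro conjI ballI allI)
    fix f g u :: "(nat, 'a) mps"
    show "B (f + g) u = B f u + B g u"
      using lin[of u] by (simp add: B_def Vector_Spaces.linear_iff)
    have "\<phi> (f + g) = (\<lambda>b. \<phi> f b + \<phi> g b)" by (auto simp: \<phi>_def)
    then show "B u (f + g) = B u f + B u g"
      using construct_add[OF ind] by (simp add: B_def)
  next
    fix c and f u :: "(nat, 'a) mps"
    show "B (mscale c f) u = c * B f u"
      using lin[of u] by (simp add: B_def Vector_Spaces.linear_iff)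
    have "\<phi> (mscale c f) = (\<lambda>b. c * \<phi> f b)" by (auto simp: \<phi>_def)
    then show "B u (mscale c f) = c * B u f"
      using construct_scale[OF ind] by (simp add: B_def)
  next
    fix \<nu> \<mu> assume *: "\<nu> \<in> partitions" "\<mu> \<in> partitions"
    have "B (Hprod (mset \<nu>)) (msym \<mu>) = \<phi> (msym \<mu>) (Hprod (mset \<nu>))"
      unfolding B_def by (rule construct_basis[OF ind]) (simp add: bas_def partitions_mset_parts *)
    also have "\<dots> = gcoeff (msym \<mu>) (mset \<nu>)"
      unfolding \<phi>_def using * by (simp add: the_inv_into_f_f[OF inj_on_Hprod] partitions_mset_parts)
    also have "\<dots> = (if \<nu> = \<mu> then 1 else 0)"
      using * partitions_mset_parts[OF *(1)] partitions_mset_inject[OF *]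
      by (auto simp: msym_eq_monsym gcoeff_monsym parts_def)
    finally show "B (prod_list (map hsym \<nu>)) (msym \<mu>) = (if \<nu> = \<mu> then 1 else 0)"
      by (simp add: prod_list_hsym)
  qed
  then show ?thesis by (rule exI[where x = B])
qed

lemma is_hall_hall: "is_hall (hall :: (nat, 'a::field_char_0) mps \<Rightarrow> _)"
  unfolding hall_def using is_hall_exists by (rule someI_ex)

lemma hall_simps:
  fixes f g u :: "(nat, 'a::field_char_0) mps"
  assumes "f \<in> Lam" "u \<in> Lam"
  shows "g \<in> Lam \<Longrightarrow> hall (f + g) u = hall f u + hall g u" "g \<in> Lam \<Longrightarrow> hall u (f + g) = hall u f + hall u g"
    "hall (mscale c f) u = c * hall f u" "hall u (mscale c f) = c * hall u f"
  using is_hall_hall assms unfolding is_hall_def by auto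

lemma hall_zero:
  fixes u :: "(nat, 'a::field_char_0) mps"
  assumes "u \<in> Lam"
  shows "hall 0 u = 0" "hall u 0 = 0"
  using hall_simps(1)[of 0 u 0] hall_simps(2)[of 0 u 0] assms by auto

lemma hall_sum:
  fixes u :: "(nat, 'a::field_char_0) mps"
  assumes "u \<in> Lam" "\<And>i. i \<in> A \<Longrightarrow> f i \<in> Lam"
  shows "hall (\<Sum>i\<in>A. mscale (c i) (f i)) u = (\<Sum>i\<in>A. c i * hall (f i) u)"
    "hall u (\<Sum>i\<in>A. mscale (c i) (f i)) = (\<Sum>i\<in>A. c i * hall u (f i))"
proof -
  have "hall (\<Sum>i\<in>A. mscale (c i) (f i)) u = (\<Sum>i\<in>A. c i * hall (f i) u) \<and>
    hall u (\<Sum>i\<in>A. mscale (c i) (f i)) = (\<Sum>i\<in>A. c i * hall u (f i))"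
    using assms(2) by (induction A rule: infinite_finite_induct) (auto simp: hall_zero hall_simps assms(1))
  then show "hall (\<Sum>i\<in>A. mscale (c i) (f i)) u = (\<Sum>i\<in>A. c i * hall (f i) u)"
    "hall u (\<Sum>i\<in>A. mscale (c i) (f i)) = (\<Sum>i\<in>A. c i * hall u (f i))" by auto
qed

text \<open>Expanding \<open>u\<close> in monomial functions turns duality into extraction of
  coefficients. This is the bridge from the pairing with the \<open>Ft \<mu>\<close> to coefficients
  in \<open>Y\<close>.\<close>

lemma hall_Hprod:
  fixes u :: "(nat, 'a::field_char_0) mps"
  assumes "M \<in> parts" "u \<in> Lam"
  shows "hall (Hprod M) u = gcoeff u M"
proof -
  obtain N where N: "u = (\<Sum>K\<in>parts_le N. mscale (gcoeff u K) (monsym K))" "sum_mset M \<le> N"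
    using Lam_expand_monsym[OF assms(2)] by (metis nat_le_linear)
  have pair: "hall (Hprod M) (monsym K :: (nat, 'a) mps) = (if M = K then 1 else 0)" if K: "K \<in> parts" for K
  proof -
    obtain \<nu> where \<nu>: "\<nu> \<in> partitions" "mset \<nu> = M" using assms(1) by (rule parts_obtain_partition)
    obtain \<mu> where \<mu>: "\<mu> \<in> partitions" "mset \<mu> = K" using K by (rule parts_obtain_partition)
    have "hall (prod_list (map hsym \<nu>)) (msym \<mu> :: (nat, 'a) mps) = (if \<nu> = \<mu> then 1 else 0)"
      using is_hall_hall \<nu> \<mu> unfolding is_hall_def by blast
    then show ?thesis
      using \<nu> \<mu> partitions_mset_inject[of \<nu> \<mu>] by (auto simp: prod_list_hsym msym_eq_monsym)
  qed
  have "hall (Hprod M) u = (\<Sum>K\<in>parts_le N. gcoeff u K * hall (Hprod M) (monsym K))"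
    by (subst N(1)) (rule hall_sum(2), auto)
  also have "\<dots> = (\<Sum>K\<in>parts_le N. if M = K then gcoeff u M else 0)"
    using pair parts_le_subset_parts[of N] by (intro sum.cong) (auto simp: subset_iff)
  also have "\<dots> = gcoeff u M"
    using assms(1) N(2) by (subst sum.delta'[OF finite_parts_le]) (auto simp: parts_le_def parts_def)
  finally show ?thesis .
qed

section \<open>The antipode and its linear extension\<close>

lemma Pprod_add: "Pprod (M + N) = Pprod M * Pprod N"
  by (simp add: Pprod_def)

text \<open>The choice behind \<open>antipode\<close> is controlled only on \<open>Lam\<close>,
  whereas \<open>apply_mult\<close> feeds its map the slices of arbitrary series in two alphabets.
  Linearity on all power series is what makes that construction linear.\<close>

lemma antipode_linear_ext:
  obtains S :: "(nat, 'a::field_char_0) mps \<Rightarrow> (nat, 'a) mps"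
  where "\<And>f g. S (f + g) = S f + S g" "\<And>c f. S (mscale c f) = mscale c (S f)"
    "\<And>f. f \<in> Lam \<Longrightarrow> S f = antipode f" "is_antipode S"
proof -
  interpret vector_space_pair "mscale :: 'a \<Rightarrow> (nat, 'a) mps \<Rightarrow> (nat, 'a) mps" "mscale :: 'a \<Rightarrow> (nat, 'a) mps \<Rightarrow> (nat, 'a) mps"
    by unfold_locales
  define bas :: "(nat, 'a) mps set" where "bas = Pprod ` parts"
  have ind: "mps.independent bas" unfolding bas_def by (rule independent_Pprod)
  \<comment> \<open>Each factor \<open>psym r\<close> contributes one sign.\<close>
  define S where "S = construct bas (\<lambda>b. mscale ((- 1) ^ size (the_inv_into parts Pprod b)) b)"
  have lin: "Vector_Spaces.linear mscale mscale S"
    unfolding S_def by (rule linear_construct[OF ind])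
  have add: "S (f + g) = S f + S g" and scale: "S (mscale c f) = mscale c (S f)" for f g c
    using lin by (auto simp: Vector_Spaces.linear_iff)
  have S0: "S 0 = 0" using scale[of 0 0] by simp
  have SP: "S (Pprod M) = mscale ((- 1) ^ size M) (Pprod M)" if "M \<in> parts" for M
    using construct_basis[OF ind, of "Pprod M"] that
    by (simp add: S_def bas_def the_inv_into_f_f[OF inj_on_Pprod])
  have span: "f \<in> mps.span bas" if "f \<in> Lam" for f
    using Lam_span_Pprod[OF that] by (simp add: bas_def)
  have mult: "S (f * g) = S f * S g" if f: "f \<in> Lam" and g: "g \<in> Lam" for f g
    using span[OF f]
  proof (induction rule: mps.span_induct_alt)
    case (step c x y)
    then obtain M where M: "x = Pprod M" "M \<in> parts" by (auto simp: bas_def)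
    have "S (x * g) = S x * S g"
      using span[OF g]
    proof (induction rule: mps.span_induct_alt)
      case (step d u v)
      then obtain N where N: "u = Pprod N" "N \<in> parts" by (auto simp: bas_def)
      have "M + N \<in> parts" using M N by (auto simp: parts_def)
      then have "S (x * u) = S x * S u"
        using SP[of "M + N"] SP[of M] SP[of N] M N by (simp add: Pprod_add power_add mult.commute)
      then show ?case using step.IH by (simp add: add scale distrib_left)
    qed (simp add: S0)
    then show ?case using step.IH by (simp add: add scale distrib_right)
  qed (simp add: S0)
  have mem: "S f \<in> Lam" if f: "f \<in> Lam" for f
    using span[OF f]
  proof (induction rule: mps.span_induct_alt)
    case (step c x y)
    then obtain M where "x = Pprod M" "M \<in> parts" by (auto simp: bas_def)
    then have "S x \<in> Lam" using SP[of M] by (auto simp: parts_def)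
    then show ?case using step.IH by (simp add: add scale)
  qed (simp add: S0)
  have "S 1 = 1" using SP[of "{#}"] by (simp add: parts_def)
  moreover have "S (psym r) = - psym r" if "r \<ge> 1" for r
    using SP[of "{#r#}"] that by (auto simp: parts_def intro!: mps_eqI)
  ultimately have anti: "is_antipode S" unfolding is_antipode_def using add scale mult mem by auto
  then have anti': "is_antipode (antipode :: (nat, 'a) mps \<Rightarrow> _)" unfolding antipode_def by (rule someI[where x = S])
  \<comment> \<open>Both maps are multiplicative on \<open>Lam\<close> with the same values at the
    \<open>psym r\<close>, so they agree on the power products and, by linearity there, on
    \<open>Lam\<close>.\<close>
  have eqP: "antipode (Pprod M) = S (Pprod M) \<and> (Pprod M :: (nat, 'a) mps) \<in> Lam" if "M \<in> parts" for M
    using that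
  proof (induction M)
    case empty
    then show ?case using anti anti' by (simp add: is_antipode_def)
  next
    case (add r M)
    then have "r \<ge> 1" "M \<in> parts" by (auto simp: parts_def)
    then show ?case using add.IH anti anti' by (auto simp: is_antipode_def)
  qed
  have "S f = antipode f \<and> f \<in> Lam" if f: "f \<in> Lam" for f
    using span[OF f]
  proof (induction rule: mps.span_induct_alt)
    case base
    have "antipode (mscale 0 0) = mscale 0 (antipode (0 :: (nat, 'a) mps))"
      using anti' Lam_zero unfolding is_antipode_def by blast
    then show ?case by (simp add: S0)
  next
    case (step c x y)
    then obtain M where "x = Pprod M" "M \<in> parts" by (auto simp: bas_def)
    then have "antipode x = S x" "x \<in> Lam" using eqP[of M] by auto
    then show ?case using step.IH anti' by (auto simp: add scale is_antipode_def)
  qed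
  with add scale anti show ?thesis using that by blast
qed

section \<open>Coproducts, slices and the antipode\<close>

definition sliceX :: "(nat \<Rightarrow>\<^sub>0 nat) \<Rightarrow> (nat + nat, 'a::comm_ring_1) mps \<Rightarrow> (nat, 'a) mps" where
  "sliceX \<beta> T = Mps (\<lambda>\<gamma>. mcoeff T (join \<beta> \<gamma>))"

definition sliceY :: "(nat \<Rightarrow>\<^sub>0 nat) \<Rightarrow> (nat + nat, 'a::comm_ring_1) mps \<Rightarrow> (nat, 'a) mps" where
  "sliceY \<gamma> T = Mps (\<lambda>\<beta>. mcoeff T (join \<beta> \<gamma>))"

lemma mcoeff_slice [simp]:
  "mcoeff (sliceX \<beta> T) \<gamma> = mcoeff T (join \<beta> \<gamma>)" "mcoeff (sliceY \<gamma> T) \<beta> = mcoeff T (join \<beta> \<gamma>)"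
  by (simp_all add: sliceX_def sliceY_def)

lemma slice_simps:
  "sliceX \<beta> (T + U) = sliceX \<beta> T + sliceX \<beta> U" "sliceY \<gamma> (T + U) = sliceY \<gamma> T + sliceY \<gamma> U"
  "sliceX \<beta> (mscale c T) = mscale c (sliceX \<beta> T)" "sliceY \<gamma> (mscale c T) = mscale c (sliceY \<gamma> T)"
  "sliceX \<beta> (tensor f g) = mscale (mcoeff f \<beta>) g" "sliceY \<gamma> (tensor f g) = mscale (mcoeff g \<gamma>) f"
  by (rule mps_eqI; simp)+

lemma sliceX_sum: "sliceX \<beta> (sum T A) = (\<Sum>i\<in>A. sliceX \<beta> (T i))"
  by (rule mps_eqI) simp

text \<open>The map \<open>f \<otimes> g \<mapsto> S f \<cdot> g\<close>.\<close>

definition apply_mult :: "((nat, 'a::comm_ring_1) mps \<Rightarrow> (nat, 'a) mps) \<Rightarrow> (nat + nat, 'a) mps \<Rightarrow> (nat, 'a) mps" where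
  "apply_mult S T = Mps (\<lambda>\<alpha>. \<Sum>(\<beta>, \<gamma>)\<in>splits \<alpha>. mcoeff (S (sliceY \<gamma> T)) \<beta>)"

lemma mcoeff_apply_mult: "mcoeff (apply_mult S T) \<alpha> = (\<Sum>(\<beta>, \<gamma>)\<in>splits \<alpha>. mcoeff (S (sliceY \<gamma> T)) \<beta>)"
  by (simp add: apply_mult_def)

text \<open>A slice of a tensor in \<open>Y\<close> is a scalar multiple of the first factor, and
  homogeneity of \<open>S\<close> pulls the scalar out.\<close>

lemma apply_mult_tensor:
  assumes "\<And>c f. S (mscale c f) = mscale c (S f)"
  shows "apply_mult S (tensor f g) = S f * g"
proof (rule mps_eqI)
  fix \<alpha>
  show "mcoeff (apply_mult S (tensor f g)) \<alpha> = mcoeff (S f * g) \<alpha>"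
    unfolding mcoeff_apply_mult mcoeff_mult slice_simps assms mcoeff_simps
    by (intro sum.cong) (auto simp: mult.commute)
qed

lemma apply_mult_simps:
  assumes "\<And>c f. S (mscale c f) = mscale c (S f)" "\<And>f g. S (f + g) = S f + S g"
  shows "apply_mult S (T + U) = apply_mult S T + apply_mult S U"
    "apply_mult S (mscale c T) = mscale c (apply_mult S T)"
  by (rule mps_eqI; simp add: mcoeff_apply_mult slice_simps assms sum.distrib sum_distrib_left case_prod_beta)+

definition tensor_span :: "(nat, 'a::field) mps set \<Rightarrow> (nat, 'a) mps set \<Rightarrow> (nat + nat, 'a) mps set" where
  "tensor_span A B = mps.span {tensor f g |f g. f \<in> A \<and> g \<in> B}"

lemma gcoeff_psym:
  assumes "r \<noteq> 0" "M \<in> parts"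
  shows "gcoeff (psym r) M = (if M = {#r#} then 1 else 0)"
  unfolding gcoeff_def mcoeff_psym using assms mtype_eq_single_iff[OF assms(1), of "exps_of M"]
  by (simp add: mtype_exps_of parts_def)

lemma mtype_in_parts [simp]: "mtype \<alpha> \<in> parts"
  by (simp add: parts_def)

lemma parts_add [simp]: "M + N \<in> parts \<longleftrightarrow> M \<in> parts \<and> N \<in> parts"
  by (auto simp: parts_def)

text \<open>Primitivity of power sums: a union of two types is a single part only if one of them is
  empty and the other is that part.\<close>

lemma coproduct_psym:
  assumes "r \<noteq> 0"
  shows "coproduct (psym r) = inX (psym r) + inY (psym r :: (nat, 'a::comm_ring_1) mps)"
proof (rule mps_eqI_join)
  fix \<beta> \<gamma>
  show "mcoeff (coproduct (psym r)) (join \<beta> \<gamma>) = mcoeff (inX (psym r) + inY (psym r :: (nat, 'a) mps)) (join \<beta> \<gamma>)"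
    using assms
    by (auto simp: Lam_coproduct Lam_mcoeff[of "psym r"] gcoeff_psym union_is_single mcoeff_one mtype_eq_empty_iff)
qed

text \<open>Needed because \<open>apply_mult\<close> is evaluated by decomposing its argument into
  tensors.\<close>

lemma coproduct_Pprod_in:
  assumes "M \<in> parts"
  shows "coproduct (Pprod M :: (nat, 'a::field) mps) \<in> tensor_span Lam Lam"
  using assms
proof (induction M)
  case empty
  then show ?case unfolding tensor_span_def
    by (intro mps.span_base) (auto intro!: exI[of _ 1])
next
  case (add r M)
  then have r: "r \<noteq> 0" and "coproduct (Pprod M :: (nat, 'a) mps) \<in> tensor_span Lam Lam"
    by (auto simp: parts_def)
  from this(2) have "coproduct (psym r) * coproduct (Pprod M :: (nat, 'a) mps) \<in> tensor_span Lam Lam"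
    unfolding tensor_span_def
  proof (induction rule: mps.span_induct_alt)
    case (step c x y)
    then obtain f g where "x = tensor f g" "f \<in> Lam" "g \<in> Lam" by auto
    then have "coproduct (psym r) * x = tensor (psym r * f) g + tensor f (psym r * g)"
      using r by (simp add: coproduct_psym distrib_right tensor_mult)
    moreover have "tensor (psym r * f) g \<in> mps.span {tensor f g |f g. f \<in> Lam \<and> g \<in> Lam}"
      "tensor f (psym r * g) \<in> mps.span {tensor f g |f g. f \<in> Lam \<and> g \<in> Lam}"
      using Lam_mult[OF Lam_psym[OF r] \<open>f \<in> Lam\<close>] Lam_mult[OF Lam_psym[OF r] \<open>g \<in> Lam\<close>]
        \<open>f \<in> Lam\<close> \<open>g \<in> Lam\<close> by (blast intro: mps.span_base)+
    ultimately show ?case using step.IH by (simp add: distrib_left mps.span_add mps.span_scale)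
  qed (simp add: mps.span_zero)
  then show ?case by (simp add: coproduct_mult)
qed

text \<open>The antipode axiom, with the constant term \<open>gcoeff g {#}\<close> as counit. On a
  product with a factor \<open>psym r\<close>, primitivity yields two terms, which cancel because
  \<open>S\<close> negates \<open>psym r\<close>.\<close>

lemma apply_mult_antipode:
  fixes S :: "(nat, 'a::field_char_0) mps \<Rightarrow> (nat, 'a) mps"
  assumes lin: "\<And>c f. S (mscale c f) = mscale c (S f)" "\<And>f g. S (f + g) = S f + S g"
    and anti: "is_antipode S" and g: "g \<in> Lam"
  shows "apply_mult S (coproduct g) = mscale (gcoeff g {#}) 1"
  using Lam_span_Pprod[OF g]
proof (induction rule: mps.span_induct_alt)
  case base
  have "apply_mult S (mscale 0 0) = mscale 0 (apply_mult S 0)"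
    by (rule apply_mult_simps) (fact lin)+
  then show ?case by (simp add: coproduct_simps)
next
  case (step c x y)
  then obtain M where M: "x = Pprod M" "M \<in> parts" by auto
  have e: "exps_of {#} = 0" by (simp add: exps_of_def)
  have "apply_mult S (coproduct x) = mscale (gcoeff x {#}) 1"
  proof (cases M)
    case empty
    have "S 1 = 1" using anti by (simp add: is_antipode_def)
    then show ?thesis using apply_mult_tensor[OF lin(1), of 1 1]
      by (simp add: M(1) empty gcoeff_def mcoeff_one e)
  next
    case (add r N)
    then have r: "r \<noteq> 0" and N: "N \<in> parts" using M by (auto simp: parts_def)
    \<comment> \<open>The cancellation takes place against every finite sum of tensors, so one
      factor \<open>psym r\<close> already kills the whole product.\<close>
    have *: "apply_mult S (coproduct (psym r) * T) = 0" if "T \<in> tensor_span Lam Lam" for T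
      using that unfolding tensor_span_def
    proof (induction rule: mps.span_induct_alt)
      case base
      have "apply_mult S (mscale 0 0) = mscale 0 (apply_mult S 0)"
        by (rule apply_mult_simps) (fact lin)+
      then show ?case by simp
    next
      case (step c x y)
      then obtain f g where x: "x = tensor f g" "f \<in> Lam" "g \<in> Lam" by auto
      have "S (psym r * f) = - psym r * S f"
        using anti x(2) r by (simp add: is_antipode_def)
      then have "apply_mult S (coproduct (psym r) * x) = 0"
        using r by (simp add: x(1) coproduct_psym distrib_right tensor_mult apply_mult_simps lin
            apply_mult_tensor[OF lin(1)])
      then show ?case using step.IH by (simp add: distrib_left apply_mult_simps lin)
    qed
    have "mcoeff (psym r * Pprod N :: (nat, 'a) mps) 0 = 0"
      using r by (auto simp: mcoeff_mult splits_def mcoeff_psym add_eq_0_iff_both_eq_0 dest!: arg_cong[where f = mdeg] simp flip: mdeg_eq_0_iff intro!: sum.neutral)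
    then show ?thesis
      using *[OF coproduct_Pprod_in[OF N]] by (simp add: M(1) add coproduct_mult gcoeff_def e)
  qed
  then show ?case using step.IH by (simp add: coproduct_simps apply_mult_simps lin mps.scale_left_distrib)
qed

text \<open>Adjoint of multiplication by \<open>h\<^sub>N\<close>, for \<open>N\<close> without zero parts.\<close>

definition hskew :: "nat multiset \<Rightarrow> (nat, 'a::comm_ring_1) mps \<Rightarrow> (nat, 'a) mps" where
  "hskew N g = sliceY (exps_of N) (coproduct g)"

lemma mcoeff_hskew: "mcoeff (hskew N g) \<alpha> = mcoeff g (Poly_Mapping.map_key sum_decode (join \<alpha> (exps_of N)))"
  by (simp add: hskew_def mcoeff_coproduct)

lemma hskew_simps:
  "hskew N (f + g) = hskew N f + hskew N g" "hskew N (mscale c f) = mscale c (hskew N f)"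
  by (rule mps_eqI; simp add: mcoeff_hskew)+

lemma Lam_hskew_mcoeff: "g \<in> Lam \<Longrightarrow> N \<in> parts \<Longrightarrow> mcoeff (hskew N g) \<alpha> = gcoeff g (mtype \<alpha> + N)"
  by (simp add: hskew_def Lam_coproduct mtype_exps_of parts_def)

lemma Lam_hskew [simp]:
  assumes "g \<in> Lam" "N \<in> parts"
  shows "hskew N g \<in> Lam"
proof -
  obtain D where D: "\<And>\<alpha>. mcoeff g \<alpha> \<noteq> 0 \<Longrightarrow> mdeg \<alpha> \<le> D" using Lam_bound assms by blast
  show ?thesis
  proof (rule LamI[where h = "\<lambda>M. gcoeff g (M + N)" and N = D])
    fix \<alpha> assume "mcoeff (hskew N g) \<alpha> \<noteq> 0"
    then have "mdeg (Poly_Mapping.map_key sum_decode (join \<alpha> (exps_of N))) \<le> D"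
      by (intro D) (simp add: mcoeff_hskew)
    then show "mdeg \<alpha> \<le> D" by (simp add: mdeg_map_key bij_sum_decode)
  qed (use assms in \<open>simp add: Lam_hskew_mcoeff\<close>)
qed

text \<open>\<open>hskew N\<close> acting on the second tensor factor, written slice by slice so
  that it makes sense for all series in two alphabets.\<close>

definition hskew2 :: "nat multiset \<Rightarrow> (nat + nat, 'a::comm_ring_1) mps \<Rightarrow> (nat + nat, 'a) mps" where
  "hskew2 N T = Mps (\<lambda>\<gamma>. mcoeff (hskew N (sliceX (Poly_Mapping.map_key Inl \<gamma>) T)) (Poly_Mapping.map_key Inr \<gamma>))"

lemma mcoeff_hskew2: "mcoeff (hskew2 N T) (join \<beta> \<gamma>) = mcoeff (hskew N (sliceX \<beta> T)) \<gamma>"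
  by (simp add: hskew2_def)

lemma hskew2_simps:
  "hskew2 N (T + U) = hskew2 N T + hskew2 N U" "hskew2 N (mscale c T) = mscale c (hskew2 N T)"
  "hskew2 N (tensor f g) = tensor f (hskew N g)"
  by (rule mps_eqI_join; simp add: mcoeff_hskew2 slice_simps hskew_simps)+

text \<open>Coassociativity, read off at the coefficients of the third factor.\<close>

lemma hskew2_coproduct:
  assumes "g \<in> Lam" "N \<in> parts"
  shows "hskew2 N (coproduct g) = coproduct (hskew N g)"
proof (rule mps_eqI_join)
  fix \<beta> \<gamma>
  have "mcoeff (hskew2 N (coproduct g)) (join \<beta> \<gamma>) =
      mcoeff (coproduct g) (join \<beta> (Poly_Mapping.map_key sum_decode (join \<gamma> (exps_of N))))"
    by (simp add: mcoeff_hskew2 mcoeff_hskew)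
  also have "\<dots> = gcoeff g (mtype \<beta> + mtype \<gamma> + N)"
    using assms by (simp add: Lam_coproduct mtype_map_key bij_sum_decode mtype_exps_of parts_def add_ac)
  also have "\<dots> = gcoeff (hskew N g) (mtype \<beta> + mtype \<gamma>)"
    using assms by (simp add: gcoeff_def[of "hskew N g"] Lam_hskew_mcoeff mtype_exps_of)
  also have "\<dots> = mcoeff (coproduct (hskew N g)) (join \<beta> \<gamma>)"
    using assms by (simp add: Lam_coproduct)
  finally show "mcoeff (hskew2 N (coproduct g)) (join \<beta> \<gamma>) = mcoeff (coproduct (hskew N g)) (join \<beta> \<gamma>)" .
qed

text \<open>Coassociativity moves the skewing inside the coproduct, the antipode axiom leaves the
  constant term of \<open>hskew N g\<close>, and that is the coefficient of \<open>g\<close> at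
  \<open>N\<close>.\<close>

lemma apply_mult_hskew2_coproduct:
  fixes S :: "(nat, 'a::field_char_0) mps \<Rightarrow> (nat, 'a) mps"
  assumes "\<And>c f. S (mscale c f) = mscale c (S f)" "\<And>f g. S (f + g) = S f + S g"
    and "is_antipode S" and "g \<in> Lam" "N \<in> parts"
  shows "apply_mult S (hskew2 N (coproduct g)) = mscale (gcoeff g N) 1"
proof -
  have "exps_of {#} = 0" by (simp add: exps_of_def)
  then have "gcoeff (hskew N g) {#} = gcoeff g N"
    using assms(4,5) by (simp add: gcoeff_def[of "hskew N g"] Lam_hskew_mcoeff)
  then show ?thesis
    using apply_mult_antipode[OF assms(1,2,3) Lam_hskew[OF assms(4,5)]] assms(4,5)
    by (simp add: hskew2_coproduct)
qed

section \<open>Coproduct of complete symmetric functions\<close>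

lemma coproduct_hsym: "coproduct (hsym n) = (\<Sum>i\<le>n. tensor (hsym i) (hsym (n - i)))"
proof (rule mps_eqI_join)
  fix \<beta> \<gamma>
  have "(\<Sum>i\<le>n. mcoeff (tensor (hsym i) (hsym (n - i)) :: (nat + nat, 'a) mps) (join \<beta> \<gamma>)) =
     (\<Sum>i\<le>n. if mdeg \<beta> = i then (if mdeg \<gamma> = n - mdeg \<beta> then 1 else 0) else 0)"
    by (intro sum.cong) (auto simp: mcoeff_hsym)
  also have "\<dots> = (if mdeg \<beta> + mdeg \<gamma> = n then 1 else 0)" by auto
  also have "\<dots> = mcoeff (coproduct (hsym n)) (join \<beta> \<gamma>)"
    by (simp add: mcoeff_coproduct mcoeff_hsym mdeg_map_key bij_sum_decode)
  finally show "mcoeff (coproduct (hsym n)) (join \<beta> \<gamma>) = mcoeff (\<Sum>i\<le>n. tensor (hsym i) (hsym (n - i)) :: (nat + nat, 'a) mps) (join \<beta> \<gamma>)"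
    by simp
qed

abbreviation hmono :: "(nat \<Rightarrow>\<^sub>0 nat) \<Rightarrow> (nat, 'a::comm_ring_1) mps" where
  "hmono \<alpha> \<equiv> Hprod (mtype \<alpha>)"

lemma hmono_single_add:
  assumes "Poly_Mapping.lookup \<alpha> v = 0"
  shows "hmono (Poly_Mapping.single v n + \<alpha>) = hsym n * hmono \<alpha>"
proof (cases "n = 0")
  case False
  then show ?thesis
    using assms by (subst mtype_disjoint_add) (auto simp: mtype_single in_keys_iff)
qed simp

text \<open>The exponent of the fresh variable \<open>v\<close> is split independently of the
  remaining exponents.\<close>

lemma sum_splits_single_add:
  assumes v: "Poly_Mapping.lookup \<alpha> v = 0"
  shows "(\<Sum>x\<in>splits (Poly_Mapping.single v n + \<alpha>). F x) =
    (\<Sum>i\<le>n. \<Sum>(\<delta>, \<epsilon>)\<in>splits \<alpha>. F (Poly_Mapping.single v i + \<delta>, Poly_Mapping.single v (n - i) + \<epsilon>))"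
proof -
  let ?rest = "\<lambda>\<delta>. \<delta> - Poly_Mapping.single v (Poly_Mapping.lookup \<delta> v)"
  have rest: "Poly_Mapping.single v (Poly_Mapping.lookup \<delta> v) + ?rest \<delta> = \<delta>" for \<delta> :: "'a \<Rightarrow>\<^sub>0 nat"
    by (rule poly_mapping_eqI) (auto simp: lookup_add lookup_minus lookup_single when_def)
  have *: "Poly_Mapping.lookup \<delta> v = 0 \<and> Poly_Mapping.lookup \<epsilon> v = 0" if "(\<delta>, \<epsilon>) \<in> splits \<alpha>" for \<delta> \<epsilon>
    using that v by (auto simp: splits_def lookup_add)
  have "(\<Sum>i\<le>n. \<Sum>(\<delta>, \<epsilon>)\<in>splits \<alpha>. F (Poly_Mapping.single v i + \<delta>, Poly_Mapping.single v (n - i) + \<epsilon>)) =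
     (\<Sum>(i, \<delta>, \<epsilon>)\<in>{..n} \<times> splits \<alpha>. F (Poly_Mapping.single v i + \<delta>, Poly_Mapping.single v (n - i) + \<epsilon>))"
    by (simp add: sum.cartesian_product case_prod_beta)
  also have "\<dots> = (\<Sum>x\<in>splits (Poly_Mapping.single v n + \<alpha>). F x)"
  proof (rule sum.reindex_bij_witness[where
        i = "\<lambda>(\<delta>, \<epsilon>). (Poly_Mapping.lookup \<delta> v, ?rest \<delta>, ?rest \<epsilon>)" and
        j = "\<lambda>(i, \<delta>, \<epsilon>). (Poly_Mapping.single v i + \<delta>, Poly_Mapping.single v (n - i) + \<epsilon>)"])
    fix x assume "x \<in> {..n} \<times> splits \<alpha>"
    then obtain i \<delta> \<epsilon> where x: "x = (i, \<delta>, \<epsilon>)" "i \<le> n" "\<delta> + \<epsilon> = \<alpha>" by auto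
    with *[of \<delta> \<epsilon>] have 0: "Poly_Mapping.lookup \<delta> v = 0" "Poly_Mapping.lookup \<epsilon> v = 0" by auto
    show "(case case x of (i, \<delta>, \<epsilon>) \<Rightarrow> (Poly_Mapping.single v i + \<delta>, Poly_Mapping.single v (n - i) + \<epsilon>) of
        (\<delta>, \<epsilon>) \<Rightarrow> (Poly_Mapping.lookup \<delta> v, ?rest \<delta>, ?rest \<epsilon>)) = x"
      using 0 by (simp add: x lookup_add)
    have "Poly_Mapping.single v n = Poly_Mapping.single v i + Poly_Mapping.single v (n - i)"
      using x(2) by (simp flip: single_add)
    then show "(case x of (i, \<delta>, \<epsilon>) \<Rightarrow> (Poly_Mapping.single v i + \<delta>, Poly_Mapping.single v (n - i) + \<epsilon>))
        \<in> splits (Poly_Mapping.single v n + \<alpha>)"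
      using x by (auto simp: add_ac)
    show "F (case x of (i, \<delta>, \<epsilon>) \<Rightarrow> (Poly_Mapping.single v i + \<delta>, Poly_Mapping.single v (n - i) + \<epsilon>)) =
        (case x of (i, \<delta>, \<epsilon>) \<Rightarrow> F (Poly_Mapping.single v i + \<delta>, Poly_Mapping.single v (n - i) + \<epsilon>))"
      by (simp add: x)
  next
    fix x assume "x \<in> splits (Poly_Mapping.single v n + \<alpha>)"
    then obtain \<delta> \<epsilon> where x: "x = (\<delta>, \<epsilon>)" "\<delta> + \<epsilon> = Poly_Mapping.single v n + \<alpha>"
      by (auto simp: splits_def)
    have l: "Poly_Mapping.lookup \<delta> v + Poly_Mapping.lookup \<epsilon> v = n"
      using arg_cong[OF x(2), of "\<lambda>\<alpha>. Poly_Mapping.lookup \<alpha> v"] v by (simp add: lookup_add)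
    then have e: "n - Poly_Mapping.lookup \<delta> v = Poly_Mapping.lookup \<epsilon> v" by simp
    show "(case case x of (\<delta>, \<epsilon>) \<Rightarrow> (Poly_Mapping.lookup \<delta> v, ?rest \<delta>, ?rest \<epsilon>) of
        (i, \<delta>, \<epsilon>) \<Rightarrow> (Poly_Mapping.single v i + \<delta>, Poly_Mapping.single v (n - i) + \<epsilon>)) = x"
      by (simp add: x(1) e rest)
    have "?rest \<delta> + ?rest \<epsilon> = \<alpha>"
    proof (rule poly_mapping_eqI)
      fix w show "Poly_Mapping.lookup (?rest \<delta> + ?rest \<epsilon>) w = Poly_Mapping.lookup \<alpha> w"
        using arg_cong[OF x(2), of "\<lambda>\<alpha>. Poly_Mapping.lookup \<alpha> w"] v
        by (auto simp: lookup_add lookup_minus lookup_single when_def split: if_splits)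
    qed
    then show "(case x of (\<delta>, \<epsilon>) \<Rightarrow> (Poly_Mapping.lookup \<delta> v, ?rest \<delta>, ?rest \<epsilon>)) \<in> {..n} \<times> splits \<alpha>"
      using l by (simp add: x(1))
  qed
  finally show ?thesis ..
qed

text \<open>Induction on the support, one variable at a time. Indexing by exponent vectors instead
  of multisets makes all multiplicities one and gives the index set \<open>splits \<alpha>\<close>
  of a product coefficient; this match later turns coproducts in \<open>X\<close> into products in
  \<open>Y\<close>.\<close>

lemma coproduct_hmono:
  "coproduct (hmono \<alpha>) = (\<Sum>(\<delta>, \<epsilon>)\<in>splits \<alpha>. tensor (hmono \<delta>) (hmono \<epsilon>))"
proof (induction "Poly_Mapping.keys \<alpha>" arbitrary: \<alpha> rule: infinite_finite_induct)
  case infinite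
  then show ?case by simp
next
  case empty
  then have "\<alpha> = 0" by (metis keys_eq_empty)
  moreover have "splits (0 :: nat \<Rightarrow>\<^sub>0 nat) = {(0, 0)}"
    by (auto simp: splits_def simp flip: mdeg_eq_0_iff dest!: arg_cong[where f = mdeg])
  ultimately show ?case by simp
next
  case (insert v K)
  define n where "n = Poly_Mapping.lookup \<alpha> v"
  define \<alpha>' where "\<alpha>' = \<alpha> - Poly_Mapping.single v n"
  have \<alpha>: "\<alpha> = Poly_Mapping.single v n + \<alpha>'"
    by (rule poly_mapping_eqI) (auto simp: \<alpha>'_def n_def lookup_add lookup_minus lookup_single when_def)
  have v: "Poly_Mapping.lookup \<alpha>' v = 0" by (simp add: \<alpha>'_def n_def lookup_minus)
  have "K = Poly_Mapping.keys \<alpha>'"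
  proof (rule set_eqI)
    fix w
    have "w \<in> insert v K \<longleftrightarrow> Poly_Mapping.lookup \<alpha> w \<noteq> 0"
      unfolding insert.hyps(4) by (simp add: in_keys_iff)
    then show "w \<in> K \<longleftrightarrow> w \<in> Poly_Mapping.keys \<alpha>'"
      using insert.hyps(2) v by (cases "w = v") (auto simp: in_keys_iff \<alpha>'_def lookup_minus lookup_single when_def)
  qed
  from insert.hyps(3)[OF this]
  have IH: "coproduct (hmono \<alpha>' :: (nat, 'a) mps) = (\<Sum>(\<delta>, \<epsilon>)\<in>splits \<alpha>'. tensor (hmono \<delta>) (hmono \<epsilon>))" .
  have "coproduct (hmono \<alpha> :: (nat, 'a) mps) = (\<Sum>i\<le>n. \<Sum>(\<delta>, \<epsilon>)\<in>splits \<alpha>'.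
      tensor (hsym i * hmono \<delta>) (hsym (n - i) * hmono \<epsilon>))"
    by (simp add: \<alpha> hmono_single_add v coproduct_mult coproduct_hsym IH sum_product case_prod_beta tensor_mult)
  also have "\<dots> = (\<Sum>i\<le>n. \<Sum>(\<delta>, \<epsilon>)\<in>splits \<alpha>'.
      tensor (hmono (Poly_Mapping.single v i + \<delta>)) (hmono (Poly_Mapping.single v (n - i) + \<epsilon>)))"
  proof (intro sum.cong refl, clarify)
    fix i \<delta> \<epsilon> assume "(\<delta>, \<epsilon>) \<in> splits \<alpha>'"
    then have "Poly_Mapping.lookup \<delta> v = 0" "Poly_Mapping.lookup \<epsilon> v = 0"
      using v by (auto simp: splits_def lookup_add)
    then show "tensor (hsym i * hmono \<delta>) (hsym (n - i) * hmono \<epsilon> :: (nat, 'a) mps) =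
        tensor (hmono (Poly_Mapping.single v i + \<delta>)) (hmono (Poly_Mapping.single v (n - i) + \<epsilon>))"
      by (simp add: hmono_single_add)
  qed
  also have "\<dots> = (\<Sum>(\<delta>, \<epsilon>)\<in>splits \<alpha>. tensor (hmono \<delta>) (hmono \<epsilon>))"
    unfolding \<alpha> sum_splits_single_add[OF v] by simp
  finally show ?case .
qed

section \<open>The subalgebra and the ideal\<close>

text \<open>These exponents mark the coefficients that are well defined on the quotient.\<close>

definition exps_le :: "nat \<Rightarrow> ('v \<Rightarrow>\<^sub>0 nat) \<Rightarrow> bool" where
  "exps_le k \<alpha> \<longleftrightarrow> (\<forall>i. Poly_Mapping.lookup \<alpha> i \<le> k)"

definition parts_bounded :: "nat \<Rightarrow> nat multiset set" where
  "parts_bounded k = {M. set_mset M \<subseteq> {1..k}}"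

lemma exps_le_iff_mtype: "exps_le k \<alpha> \<longleftrightarrow> mtype \<alpha> \<in> parts_bounded k"
proof -
  have "mtype \<alpha> \<in> parts_bounded k \<longleftrightarrow> (\<forall>i. Poly_Mapping.lookup \<alpha> i \<noteq> 0 \<longrightarrow> Poly_Mapping.lookup \<alpha> i \<in> {1..k})"
    unfolding parts_bounded_def subset_iff in_mtype_iff mem_Collect_eq by blast
  then show ?thesis unfolding exps_le_def by (metis atLeastAtMost_iff le_0_eq le_cases less_one not_le)
qed

lemma exps_le_splits: "exps_le k \<alpha> \<Longrightarrow> (\<beta>, \<gamma>) \<in> splits \<alpha> \<Longrightarrow> exps_le k \<beta> \<and> exps_le k \<gamma>"
  by (auto simp: exps_le_def splits_def lookup_add) (meson add_leE)+

lemma parts_bounded_subset: "parts_bounded k \<subseteq> parts"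
  by (auto simp: parts_bounded_def parts_def)

lemma Collect_set_mset_eq: "{M. P (set_mset M)} = mset ` {xs. P (set xs)}"
proof (intro equalityI subsetI)
  fix M assume "M \<in> {M. P (set_mset M)}"
  moreover obtain xs where "mset xs = M" by (rule ex_mset[THEN exE])
  ultimately show "M \<in> mset ` {xs. P (set xs)}" by (intro rev_image_eqI[of xs]) auto
qed auto

lemma Lam_sub_eq: "Lam_sub k = (mps.span (Hprod ` parts_bounded k) :: (nat, 'a::field) mps set)"
proof -
  have "parts_bounded k = mset ` {rs. set rs \<subseteq> {1..k}}"
    unfolding parts_bounded_def by (rule Collect_set_mset_eq)
  then have "{prod_list (map hsym rs) |rs. set rs \<subseteq> {1..k}} = (Hprod ` parts_bounded k :: (nat, 'a) mps set)"
    by (auto simp: prod_list_hsym)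
  then show ?thesis by (simp add: Lam_sub_def)
qed

lemma Lam_sub_Lam: "Lam_sub k \<subseteq> (Lam :: (nat, 'a::field) mps set)"
  unfolding Lam_sub_eq by (intro mps.span_minimal) auto

lemma mps_subspace_Lam_sub [simp]: "mps.subspace (Lam_sub k)"
  by (simp add: Lam_sub_eq)

lemma Hprod_in_Lam_sub: "M \<in> parts_bounded k \<Longrightarrow> Hprod M \<in> Lam_sub k"
  unfolding Lam_sub_eq by (auto intro: mps.span_base)

lemma Lam_sub_mult:
  assumes "f \<in> Lam_sub k" "g \<in> Lam_sub k"
  shows "f * g \<in> Lam_sub k"
  using assms(1) unfolding Lam_sub_eq
proof (induction rule: mps.span_induct_alt)
  case (step c x y)
  then obtain M where M: "x = Hprod M" "M \<in> parts_bounded k" by auto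
  have "x * g \<in> Lam_sub k"
    using assms(2) unfolding Lam_sub_eq
  proof (induction rule: mps.span_induct_alt)
    case (step d u v)
    then obtain N where N: "u = Hprod N" "N \<in> parts_bounded k" by auto
    have "x * u = Hprod (M + N)" by (simp add: M N Hprod_add)
    moreover have "M + N \<in> parts_bounded k" using M N by (auto simp: parts_bounded_def)
    ultimately have "x * u \<in> mps.span (Hprod ` parts_bounded k)" by (auto intro: mps.span_base)
    then show ?case using step.IH by (simp add: distrib_left mps.span_add mps.span_scale)
  qed (simp add: mps.span_zero)
  then show ?case using step.IH unfolding Lam_sub_eq
    by (simp add: distrib_right mps.span_add mps.span_scale)
qed (simp add: mps.span_zero)

lemma mcoeff_psym_mult_exps_le:
  assumes "k < j" "exps_le k \<alpha>"
  shows "mcoeff (f * psym j) \<alpha> = 0"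
  unfolding mcoeff_mult
proof (rule sum.neutral, clarify)
  fix \<beta> \<gamma> assume "(\<beta>, \<gamma>) \<in> splits \<alpha>"
  then have "exps_le k \<gamma>" using assms exps_le_splits by blast
  then have "mcoeff (psym j :: (nat, 'a) mps) \<gamma> = 0"
    using assms(1) by (auto simp: mcoeff_psym exps_le_def) (metis lookup_single_eq not_le)
  then show "mcoeff f \<beta> * mcoeff (psym j) \<gamma> = 0" by simp
qed

text \<open>A bounded exponent has no splitting that uses a power sum of index above
  \<open>k\<close>, so the ideal has no bounded coefficients. Conversely only monomial functions
  with a part above \<open>k\<close> occur, and triangularity writes each through power products
  that contain a \<open>psym l\<close> with \<open>l > k\<close>.\<close>

lemma Lam_ideal_iff:
  fixes g :: "(nat, 'a::field_char_0) mps"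
  shows "g \<in> Lam_ideal k \<longleftrightarrow> g \<in> Lam \<and> (\<forall>\<alpha>. exps_le k \<alpha> \<longrightarrow> mcoeff g \<alpha> = 0)"
proof
  assume "g \<in> Lam_ideal k"
  then show "g \<in> Lam \<and> (\<forall>\<alpha>. exps_le k \<alpha> \<longrightarrow> mcoeff g \<alpha> = 0)"
    unfolding Lam_ideal_def
  proof (induction rule: mps.span_induct_alt)
    case (step c x y)
    then obtain f j where "x = f * psym j" "f \<in> Lam" "k < j" by auto
    then show ?case using step.IH by (simp add: mcoeff_psym_mult_exps_le)
  qed simp
next
  assume g: "g \<in> Lam \<and> (\<forall>\<alpha>. exps_le k \<alpha> \<longrightarrow> mcoeff g \<alpha> = 0)"
  then obtain N where N: "g = (\<Sum>M\<in>parts_le N. mscale (gcoeff g M) (monsym M))"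
    using Lam_expand_monsym by blast
  have "mscale (gcoeff g M) (monsym M) \<in> Lam_ideal k" if M: "M \<in> parts_le N" for M
  proof (cases "gcoeff g M = 0")
    case False
    then have "\<not> exps_le k (exps_of M)" using g by (auto simp: gcoeff_def)
    moreover have "mtype (exps_of M) = M" using M by (simp add: mtype_exps_of parts_le_def)
    ultimately obtain j where j: "j \<in># M" "k < j"
      using M by (auto simp: exps_le_iff_mtype parts_bounded_def parts_le_def Suc_le_eq subset_iff not_le)
    have "monsym M \<in> mps.span {Pprod L :: (nat, 'a) mps |L. 0 \<notin># L \<and> sum_mset L = sum_mset M \<and> (\<exists>l\<in>#L. j \<le> l)}"
      using M j by (intro monsym_in_span_Pprod) (auto simp: parts_le_def)
    also have "\<dots> \<subseteq> Lam_ideal k"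
      unfolding Lam_ideal_def
    proof (rule mps.span_mono, clarify)
      fix L l assume L: "0 \<notin># L" "l \<in># L" "j \<le> l"
      then obtain L' where "L = add_mset l L'" by (metis multi_member_split)
      then have "Pprod L = Pprod L' * psym l" "Pprod L' \<in> (Lam :: (nat, 'a) mps set)"
        using L by (auto simp: mult.commute)
      then show "\<exists>f j. Pprod L = f * (psym j :: (nat, 'a) mps) \<and> f \<in> Lam \<and> k < j"
        using L j by (intro exI[of _ "Pprod L'"] exI[of _ l]) auto
    qed
    finally show ?thesis unfolding Lam_ideal_def by (rule mps.span_scale)
  qed (simp add: Lam_ideal_def mps.span_zero)
  then show "g \<in> Lam_ideal k"
    unfolding Lam_ideal_def by (subst N) (intro mps.span_sum)
qed

section \<open>Formal sums\<close>

text \<open>Trades the index set that depends on the coefficient for any finite set outside which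
  the coefficient vanishes.\<close>

lemma mcoeff_formal_sum:
  assumes "finite F" "F \<subseteq> A" "\<And>i. i \<in> A \<Longrightarrow> i \<notin> F \<Longrightarrow> mcoeff (f i) \<gamma> = 0"
  shows "mcoeff (formal_sum A f) \<gamma> = (\<Sum>i\<in>F. mcoeff (f i) \<gamma>)"
  unfolding formal_sum_def mcoeff_Mps using assms
  by (intro sum.mono_neutral_left) auto

lemma degree_part_formal_sum:
  assumes "finite_in_each_degree A f"
  shows "degree_part n (formal_sum A f) = (\<Sum>i\<in>{i \<in> A. degree_part n (f i) \<noteq> 0}. degree_part n (f i))"
proof (rule mps_eqI)
  fix \<gamma>
  have fin: "finite {i \<in> A. degree_part n (f i) \<noteq> 0}"
    using assms by (simp add: finite_in_each_degree_def)
  show "mcoeff (degree_part n (formal_sum A f)) \<gamma> =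
      mcoeff (\<Sum>i\<in>{i \<in> A. degree_part n (f i) \<noteq> 0}. degree_part n (f i)) \<gamma>"
  proof (cases "mdeg \<gamma> = n")
    case True
    have "mcoeff (formal_sum A f) \<gamma> = (\<Sum>i\<in>{i \<in> A. degree_part n (f i) \<noteq> 0}. mcoeff (f i) \<gamma>)"
      using fin True by (intro mcoeff_formal_sum) (auto simp: degree_part_neq_0_iff)
    then show ?thesis using True by simp
  qed simp
qed

lemma mult_coeff_neq_0_imp:
  assumes "mcoeff (f * g) \<gamma> \<noteq> 0"
  obtains \<beta> \<beta>' where "\<beta> + \<beta>' = \<gamma>" "mcoeff f \<beta> \<noteq> 0" "mcoeff g \<beta>' \<noteq> 0"
proof -
  have "\<exists>x\<in>splits \<gamma>. mcoeff f (fst x) * mcoeff g (snd x) \<noteq> 0"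
    using assms unfolding mcoeff_mult case_prod_beta by (meson sum.neutral)
  then obtain x where "x \<in> splits \<gamma>" "mcoeff f (fst x) * mcoeff g (snd x) \<noteq> 0" by blast
  moreover from this have "mcoeff f (fst x) \<noteq> 0" "mcoeff g (snd x) \<noteq> 0" by auto
  ultimately show ?thesis using that by (cases x) auto
qed

lemma finite_in_each_degree_mult:
  assumes "finite_in_each_degree A f"
  shows "finite_in_each_degree A (\<lambda>i. f i * g)"
  unfolding finite_in_each_degree_def
proof
  fix n
  have "{i \<in> A. degree_part n (f i * g) \<noteq> 0} \<subseteq> (\<Union>m\<le>n. {i \<in> A. degree_part m (f i) \<noteq> 0})"
  proof clarify
    fix i assume i: "i \<in> A" "degree_part n (f i * g) \<noteq> 0"
    then obtain \<gamma> where "mdeg \<gamma> = n" "mcoeff (f i * g) \<gamma> \<noteq> 0" by (auto simp: degree_part_neq_0_iff)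
    moreover from this(2) obtain \<beta> \<beta>' where "\<beta> + \<beta>' = \<gamma>" "mcoeff (f i) \<beta> \<noteq> 0" by (rule mult_coeff_neq_0_imp)
    ultimately show "i \<in> (\<Union>m\<le>n. {i \<in> A. degree_part m (f i) \<noteq> 0})"
      using i(1) by (intro UN_I[of "mdeg \<beta>"]) (auto simp: degree_part_neq_0_iff)
  qed
  then show "finite {i \<in> A. degree_part n (f i * g) \<noteq> 0}"
    using assms by (auto simp: finite_in_each_degree_def intro: finite_subset)
qed

lemma formal_sum_mult:
  fixes f :: "'i \<Rightarrow> ('v, 'a::comm_ring_1) mps"
  assumes "finite_in_each_degree A f"
  shows "formal_sum A f * g = formal_sum A (\<lambda>i. f i * g)"
proof (rule mps_eqI)
  fix \<gamma> :: "'v \<Rightarrow>\<^sub>0 nat"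
  \<comment> \<open>Only degrees up to \<open>mdeg \<gamma>\<close> can enter this coefficient of a
    product, so one finite set serves all splittings.\<close>
  define F where "F = (\<Union>m\<le>mdeg \<gamma>. {i \<in> A. degree_part m (f i) \<noteq> 0})"
  have F: "finite F" "F \<subseteq> A" using assms by (auto simp: F_def finite_in_each_degree_def)
  have 0: "mcoeff (f i) \<beta> = 0" if "i \<in> A" "i \<notin> F" "mdeg \<beta> \<le> mdeg \<gamma>" for i \<beta>
    using that by (auto simp: F_def degree_part_neq_0_iff)
  have "mcoeff (formal_sum A f * g) \<gamma> = (\<Sum>x\<in>splits \<gamma>. \<Sum>i\<in>F. mcoeff (f i) (fst x) * mcoeff g (snd x))"
    unfolding mcoeff_mult
  proof (intro sum.cong refl, clarify)
    fix \<beta> \<beta>' assume "(\<beta>, \<beta>') \<in> splits \<gamma>"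
    then have "mdeg \<beta> \<le> mdeg \<gamma>" by (auto simp: splits_def)
    then have "mcoeff (formal_sum A f) \<beta> = (\<Sum>i\<in>F. mcoeff (f i) \<beta>)"
      using F 0 by (intro mcoeff_formal_sum) auto
    then show "mcoeff (formal_sum A f) \<beta> * mcoeff g \<beta>' =
        (\<Sum>i\<in>F. mcoeff (f i) (fst (\<beta>, \<beta>')) * mcoeff g (snd (\<beta>, \<beta>')))"
      by (simp add: sum_distrib_right)
  qed
  also have "\<dots> = (\<Sum>i\<in>F. mcoeff (f i * g) \<gamma>)"
    by (subst sum.swap) (simp add: mcoeff_mult case_prod_beta)
  also have "\<dots> = mcoeff (formal_sum A (\<lambda>i. f i * g)) \<gamma>"
  proof (rule mcoeff_formal_sum[symmetric])
    fix i assume i: "i \<in> A" "i \<notin> F"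
    show "mcoeff (f i * g) \<gamma> = 0"
    proof (rule ccontr)
      assume "mcoeff (f i * g) \<gamma> \<noteq> 0"
      then obtain \<beta> \<beta>' where "\<beta> + \<beta>' = \<gamma>" "mcoeff (f i) \<beta> \<noteq> 0" by (rule mult_coeff_neq_0_imp)
      with 0[OF i, of \<beta>] show False by auto
    qed
  qed (use F in auto)
  finally show "mcoeff (formal_sum A f * g) \<gamma> = mcoeff (formal_sum A (\<lambda>i. f i * g)) \<gamma>" .
qed

text \<open>The substitute for calculating in the quotient: a factor may be exchanged for one that
  agrees with it at bounded exponents only, since no others arise from splitting a bounded
  \<open>\<alpha>\<close>.\<close>

lemma mcoeff_mult_cong:
  assumes "\<And>\<beta> \<gamma>. (\<beta>, \<gamma>) \<in> splits \<alpha> \<Longrightarrow> mcoeff f \<beta> = mcoeff f' \<beta> \<and> mcoeff g \<gamma> = mcoeff g' \<gamma>"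
  shows "mcoeff (f * g) \<alpha> = mcoeff (f' * g') \<alpha>"
  unfolding mcoeff_mult using assms by (intro sum.cong) auto

lemma degree_part_tensor:
  "degree_part n (tensor f g) = (\<Sum>i\<le>n. tensor (degree_part i f) (degree_part (n - i) g))"
proof (rule mps_eqI_join)
  fix \<beta> \<gamma>
  have "mcoeff (\<Sum>i\<le>n. tensor (degree_part i f) (degree_part (n - i) g)) (join \<beta> \<gamma>) =
      (\<Sum>i\<le>n. if mdeg \<beta> = i then (if mdeg \<gamma> = n - mdeg \<beta> then mcoeff f \<beta> * mcoeff g \<gamma> else 0) else 0)"
    unfolding mcoeff_sum by (intro sum.cong) auto
  also have "\<dots> = mcoeff (degree_part n (tensor f g)) (join \<beta> \<gamma>)" by auto
  finally show "mcoeff (degree_part n (tensor f g)) (join \<beta> \<gamma>) =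
      mcoeff (\<Sum>i\<le>n. tensor (degree_part i f) (degree_part (n - i) g)) (join \<beta> \<gamma>)" ..
qed

lemma span_image_obtain:
  fixes G :: "'i \<Rightarrow> ('v, 'a::field) mps"
  assumes "x \<in> mps.span (G ` S)"
  obtains C c where "finite C" "C \<subseteq> S" "x = (\<Sum>i\<in>C. mscale (c i) (G i))"
proof -
  obtain t r where t: "finite t" "t \<subseteq> G ` S" "x = (\<Sum>a\<in>t. mscale (r a) a)"
    using assms unfolding mps.span_explicit by blast
  then obtain C where C: "C \<subseteq> S" "inj_on G C" "t = G ` C" by (auto simp: subset_image_inj)
  then have "finite C" using t(1) finite_imageD by blast
  with C that[of C "\<lambda>i. r (G i)"] t(3) show ?thesis by (simp add: sum.reindex)
qed

lemma mcoeff_quot_quot_kernel: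
  fixes T :: "(nat + nat, 'a::field_char_0) mps"
  assumes "T \<in> quot_quot_kernel k" "exps_le k \<beta>" "exps_le k \<gamma>"
  shows "mcoeff T (join \<beta> \<gamma>) = 0"
  using assms(1) unfolding quot_quot_kernel_def
proof (induction rule: mps.span_induct_alt)
  case (step c x y)
  then obtain f g where "x = tensor f g" "f \<in> Lam_ideal k \<or> g \<in> Lam_ideal k" by auto
  then have "mcoeff x (join \<beta> \<gamma>) = 0" using assms(2,3) by (auto simp: Lam_ideal_iff)
  then show ?case using step.IH by simp
qed simp

section \<open>Degrees of \<open>k\<close>-Schur functions\<close>

lemma diagram_Sigma: "diagram \<nu> = Sigma {..<length \<nu>} (\<lambda>i. {..<\<nu> ! i})"
  by (auto simp: diagram_def)

lemma card_diagram: "card (diagram \<nu>) = sum_list \<nu>"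
  by (simp add: diagram_Sigma sum_list_sum_nth lessThan_atLeast0)

lemma finite_diagram [simp]: "finite (diagram \<nu>)"
  by (simp add: diagram_Sigma)

lemma pieri_set_sum_list: "\<beta> \<in> pieri_set k r \<alpha> \<Longrightarrow> sum_list \<beta> = sum_list \<alpha> + r"
  unfolding pieri_set_def horizontal_strip_def
  using card_mono[OF finite_diagram, of "diagram \<alpha>" \<beta>] by (auto simp: card_Diff_subset card_diagram)

lemma finite_bounded_partitions_le: "finite {\<nu> \<in> bounded_partitions k. sum_list \<nu> \<le> n}"
proof (rule finite_subset)
  show "{\<nu> \<in> bounded_partitions k. sum_list \<nu> \<le> n} \<subseteq> {xs. set xs \<subseteq> {..k} \<and> length xs \<le> n}"
  proof
    fix \<nu> assume \<nu>: "\<nu> \<in> {\<nu> \<in> bounded_partitions k. sum_list \<nu> \<le> n}"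
    then have "length \<nu> \<le> sum_list \<nu>"
      using size_le_sum_mset[of "mset \<nu>"] by (auto simp: bounded_partitions_def partitions_def sum_mset_sum_list)
    with \<nu> show "\<nu> \<in> {xs. set xs \<subseteq> {..k} \<and> length xs \<le> n}" by (auto simp: bounded_partitions_def)
  qed
qed (simp add: finite_lists_length_le)

lemma Hprod_homogeneous: "mcoeff (Hprod M) \<alpha> \<noteq> 0 \<Longrightarrow> mdeg \<alpha> = sum_mset M"
proof (induction M arbitrary: \<alpha>)
  case empty
  then show ?case by (auto simp: mcoeff_one split: if_splits)
next
  case (add r M)
  from add.prems obtain \<beta> \<gamma> where "\<beta> + \<gamma> = \<alpha>" "mcoeff (hsym r :: (nat, 'a) mps) \<beta> \<noteq> 0" "mcoeff (Hprod M :: (nat, 'a) mps) \<gamma> \<noteq> 0"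
    by (auto elim: mult_coeff_neq_0_imp)
  then show ?case using add.IH[of \<gamma>] by (auto simp: mcoeff_hsym split: if_splits)
qed

locale dual_kschur =
  fixes k :: nat and s Ft :: "nat list \<Rightarrow> (nat, 'a::field_char_0) mps"
  assumes kschur: "is_kschur k s" and dual: "is_dual_kschur k s Ft"
begin

lemma s_Lam_sub: "\<nu> \<in> bounded_partitions k \<Longrightarrow> s \<nu> \<in> Lam_sub k"
  using kschur unfolding is_kschur_def by (metis imageI mps.span_base)

lemma s_Lam: "\<nu> \<in> bounded_partitions k \<Longrightarrow> s \<nu> \<in> Lam"
  using s_Lam_sub Lam_sub_Lam by blast

lemma Ft_Lam: "\<nu> \<in> bounded_partitions k \<Longrightarrow> Ft \<nu> \<in> Lam"
  using dual by (simp add: is_dual_kschur_def)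

lemma hall_s_Ft: "\<nu> \<in> bounded_partitions k \<Longrightarrow> \<mu> \<in> bounded_partitions k \<Longrightarrow>
    hall (s \<nu>) (Ft \<mu>) = (if \<nu> = \<mu> then 1 else 0)"
  using dual by (simp add: is_dual_kschur_def)

lemma hall_sum_s_Ft:
  assumes "finite B" "B \<subseteq> bounded_partitions k" "\<mu> \<in> bounded_partitions k"
  shows "hall (\<Sum>\<nu>\<in>B. mscale (c \<nu>) (s \<nu>)) (Ft \<mu>) = (if \<mu> \<in> B then c \<mu> else 0)"
proof -
  have "hall (\<Sum>\<nu>\<in>B. mscale (c \<nu>) (s \<nu>)) (Ft \<mu>) = (\<Sum>\<nu>\<in>B. c \<nu> * hall (s \<nu>) (Ft \<mu>))"
    using assms by (intro hall_sum Ft_Lam s_Lam) auto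
  also have "\<dots> = (\<Sum>\<nu>\<in>B. if \<nu> = \<mu> then c \<mu> else 0)"
    using assms by (intro sum.cong) (auto simp: hall_s_Ft subset_iff)
  finally show ?thesis using assms(1) by simp
qed

section \<open>Coordinates and degrees in the k-Schur basis\<close>

definition supp :: "(nat, 'a) mps \<Rightarrow> nat list set" where
  "supp x = {\<nu> \<in> bounded_partitions k. hall x (Ft \<nu>) \<noteq> 0}"

text \<open>The \<open>Ft \<nu>\<close> are the coordinate functionals of the basis. The freedom in
  \<open>B\<close> allows several elements to be expanded over one common index set.\<close>

lemma expand_kschur:
  assumes "x \<in> Lam_sub k"
  shows "finite (supp x)"
    and "finite B \<Longrightarrow> supp x \<subseteq> B \<Longrightarrow> B \<subseteq> bounded_partitions k \<Longrightarrow> x = (\<Sum>\<nu>\<in>B. mscale (hall x (Ft \<nu>)) (s \<nu>))"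
proof -
  have "x \<in> mps.span (s ` bounded_partitions k)"
    using assms kschur by (simp add: is_kschur_def)
  then obtain C c where C: "finite C" "C \<subseteq> bounded_partitions k" and x: "x = (\<Sum>\<nu>\<in>C. mscale (c \<nu>) (s \<nu>))"
    by (rule span_image_obtain)
  have hall: "hall x (Ft \<mu>) = (if \<mu> \<in> C then c \<mu> else 0)" if "\<mu> \<in> bounded_partitions k" for \<mu>
    unfolding x using hall_sum_s_Ft C that by blast
  have "supp x \<subseteq> C" by (auto simp: supp_def hall split: if_splits)
  then show "finite (supp x)" using C(1) finite_subset by blast
  assume B: "finite B" "supp x \<subseteq> B" "B \<subseteq> bounded_partitions k"
  have "c \<nu> = 0" if "\<nu> \<in> C - supp x" for \<nu>
    using hall[of \<nu>] that C(2) by (auto simp: supp_def)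
  then have "(\<Sum>\<nu>\<in>C. mscale (c \<nu>) (s \<nu>)) = (\<Sum>\<nu>\<in>supp x. mscale (c \<nu>) (s \<nu>))"
    using C(1) \<open>supp x \<subseteq> C\<close> by (intro sum.mono_neutral_right) auto
  then have "x = (\<Sum>\<nu>\<in>supp x. mscale (c \<nu>) (s \<nu>))" using x by simp
  also have "\<dots> = (\<Sum>\<nu>\<in>supp x. mscale (hall x (Ft \<nu>)) (s \<nu>))"
    using hall \<open>supp x \<subseteq> C\<close> by (intro sum.cong) (auto simp: supp_def)
  also have "\<dots> = (\<Sum>\<nu>\<in>B. mscale (hall x (Ft \<nu>)) (s \<nu>))"
    using B by (intro sum.mono_neutral_left) (auto simp: supp_def)
  finally show "x = (\<Sum>\<nu>\<in>B. mscale (hall x (Ft \<nu>)) (s \<nu>))" .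
qed

text \<open>Starting from \<open>s [] = 1\<close>, each factor \<open>hsym r\<close> raises the size
  of every index by exactly \<open>r\<close>.\<close>

lemma Hprod_in_span_s:
  assumes "M \<in> parts_bounded k"
  shows "Hprod M \<in> mps.span (s ` {\<nu> \<in> bounded_partitions k. sum_list \<nu> = sum_mset M})"
  using assms
proof (induction M)
  case empty
  have "s [] = 1" using kschur by (simp add: is_kschur_def)
  moreover have "[] \<in> bounded_partitions k" by (simp add: bounded_partitions_def partitions_def)
  ultimately show ?case by (force intro!: mps.span_base simp: image_iff)
next
  case (add r M)
  let ?W = "mps.span (s ` {\<nu> \<in> bounded_partitions k. sum_list \<nu> = r + sum_mset M})"
  have r: "r \<in> {1..k}" and M: "M \<in> parts_bounded k" using add.prems by (auto simp: parts_bounded_def)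
  have "hsym r * Hprod M \<in> ?W"
    using add.IH[OF M]
  proof (induction rule: mps.span_induct_alt)
    case (step c x y)
    then obtain \<nu> where \<nu>: "x = s \<nu>" "\<nu> \<in> bounded_partitions k" "sum_list \<nu> = sum_mset M" by auto
    have "hsym r * x = (\<Sum>\<beta>\<in>pieri_set k r \<nu>. s \<beta>)"
      using kschur r \<nu> by (simp add: is_kschur_def)
    also have "\<dots> \<in> ?W"
      using pieri_set_sum_list[of _ k r \<nu>] \<nu>(3)
      by (intro mps.span_sum mps.span_base) (auto simp: pieri_set_def)
    finally show ?case using step.IH by (simp add: distrib_left mps.span_add mps.span_scale)
  qed (simp add: mps.span_zero)
  then show ?case by simp
qed

text \<open>Both sides are linear in \<open>x\<close>, so complete products suffice. Such a product
  is homogeneous and has coordinates only at indices of the same size.\<close>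

lemma degree_part_expand:
  assumes "x \<in> Lam_sub k"
  shows "degree_part m x = (\<Sum>\<nu>\<in>{\<nu> \<in> bounded_partitions k. sum_list \<nu> = m}. mscale (hall x (Ft \<nu>)) (s \<nu>))"
proof -
  \<comment> \<open>Membership in \<open>Lam\<close> is carried along because \<open>hall\<close> is
    additive only there.\<close>
  have "x \<in> Lam \<and> degree_part m x = (\<Sum>\<nu>\<in>{\<nu> \<in> bounded_partitions k. sum_list \<nu> = m}. mscale (hall x (Ft \<nu>)) (s \<nu>))"
    using assms unfolding Lam_sub_eq
  proof (induction rule: mps.span_induct_alt)
    case base
    then show ?case by (auto simp: degree_part_simps hall_zero Ft_Lam intro!: sum.neutral)
  next
    case (step c x y)
    let ?B = "\<lambda>m. {\<nu> \<in> bounded_partitions k. sum_list \<nu> = m}"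
    have fin: "finite (?B m)" for m
      by (rule finite_subset[OF _ finite_bounded_partitions_le[of k m]]) auto
    from step obtain M where M: "x = Hprod M" "M \<in> parts_bounded k" by auto
    have "x \<in> mps.span (s ` ?B (sum_mset M))"
      using Hprod_in_span_s[OF M(2)] M(1) by simp
    then obtain C d where C: "finite C" "C \<subseteq> ?B (sum_mset M)" "x = (\<Sum>\<nu>\<in>C. mscale (d \<nu>) (s \<nu>))"
      by (rule span_image_obtain)
    have supp: "supp x \<subseteq> ?B (sum_mset M)"
      using C(2) hall_sum_s_Ft[of C _ d] C(1) unfolding C(3)
      by (auto simp: supp_def subset_iff split: if_splits)
    have x: "degree_part m x = (\<Sum>\<nu>\<in>?B m. mscale (hall x (Ft \<nu>)) (s \<nu>))"
    proof (cases "m = sum_mset M")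
      case True
      have "degree_part m x = x"
        by (rule mps_eqI) (use Hprod_homogeneous[of M] True M(1) in auto)
      moreover have "x = (\<Sum>\<nu>\<in>?B m. mscale (hall x (Ft \<nu>)) (s \<nu>))"
        using fin supp True M by (intro expand_kschur(2)) (auto simp: Hprod_in_Lam_sub)
      ultimately show ?thesis by simp
    next
      case False
      then have "degree_part m x = 0"
        by (intro mps_eqI) (use Hprod_homogeneous[of M] M(1) in auto)
      moreover have "hall x (Ft \<nu>) = 0" if "\<nu> \<in> ?B m" for \<nu>
        using supp that False by (auto simp: supp_def)
      ultimately show ?thesis by simp
    qed
    have "x \<in> Lam" using M by simp
    have "y \<in> Lam" using step.IH by simp
    have "hall (mscale c x + y) (Ft \<nu>) = c * hall x (Ft \<nu>) + hall y (Ft \<nu>)" if "\<nu> \<in> ?B m" for \<nu>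
      using that \<open>x \<in> Lam\<close> \<open>y \<in> Lam\<close> by (simp add: hall_simps Ft_Lam)
    then show ?case
      using \<open>x \<in> Lam\<close> \<open>y \<in> Lam\<close>
      by (simp add: degree_part_simps x step.IH mps.scale_left_distrib sum.distrib mps.scale_sum_right)
  qed
  then show ?thesis ..
qed

lemma degree_part_Lam_sub: "(x :: (nat, 'a) mps) \<in> Lam_sub k \<Longrightarrow> degree_part m x \<in> Lam_sub k"
  unfolding degree_part_expand
  by (intro mps.subspace_sum mps.subspace_scale) (auto intro: s_Lam_sub)

text \<open>The only nonzero coordinate of \<open>s \<nu>\<close> sits at \<open>\<nu>\<close>, so
  \<open>degree_part_expand\<close> leaves nothing in any other degree.\<close>

lemma s_homogeneous:
  assumes "\<nu> \<in> bounded_partitions k" "mcoeff (s \<nu>) \<alpha> \<noteq> 0"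
  shows "mdeg \<alpha> = sum_list \<nu>"
proof (rule ccontr)
  assume ne: "mdeg \<alpha> \<noteq> sum_list \<nu>"
  have "degree_part (mdeg \<alpha>) (s \<nu>) = 0"
    unfolding degree_part_expand[OF s_Lam_sub[OF assms(1)]]
    using ne assms(1) by (intro sum.neutral) (auto simp: hall_s_Ft)
  then have "mcoeff (degree_part (mdeg \<alpha>) (s \<nu>)) \<alpha> = 0" by simp
  with assms(2) show False by simp
qed

lemma finite_Cauchy: "finite_in_each_degree (bounded_partitions k) (\<lambda>\<nu>. inX (s \<nu>) * inY (Ft \<nu>))"
  unfolding finite_in_each_degree_def
proof
  fix n
  have "{\<nu> \<in> bounded_partitions k. degree_part n (inX (s \<nu>) * inY (Ft \<nu>)) \<noteq> 0} \<subseteq>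
      {\<nu> \<in> bounded_partitions k. sum_list \<nu> \<le> n}"
  proof clarify
    fix \<nu> assume \<nu>: "\<nu> \<in> bounded_partitions k" "degree_part n (inX (s \<nu>) * inY (Ft \<nu>)) \<noteq> 0"
    then obtain \<beta> \<gamma> where "mdeg (join \<beta> \<gamma>) = n" "mcoeff (tensor (s \<nu>) (Ft \<nu>)) (join \<beta> \<gamma>) \<noteq> 0"
      unfolding inX_inY degree_part_neq_0_iff by (metis join_cases)
    then show "sum_list \<nu> \<le> n" using s_homogeneous[OF \<nu>(1), of \<beta>] by auto
  qed
  then show "finite {\<nu> \<in> bounded_partitions k. degree_part n (inX (s \<nu>) * inY (Ft \<nu>)) \<noteq> 0}"
    using finite_bounded_partitions_le finite_subset by blast
qed

section \<open>Tensors modulo the ideal\<close>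

lemma tensor_span_expand:
  fixes T :: "(nat + nat, 'a) mps"
  assumes "T \<in> tensor_span (Lam_sub k) Lam"
  obtains B G where "finite B" "B \<subseteq> bounded_partitions k" "\<And>\<nu>. G \<nu> \<in> Lam" "T = (\<Sum>\<nu>\<in>B. tensor (s \<nu>) (G \<nu>))"
proof -
  have "\<exists>B G. finite B \<and> B \<subseteq> bounded_partitions k \<and> (\<forall>\<nu>. G \<nu> \<in> Lam) \<and> T = (\<Sum>\<nu>\<in>B. tensor (s \<nu>) (G \<nu>))"
    using assms unfolding tensor_span_def
  proof (induction rule: mps.span_induct_alt)
    case base
    then show ?case by (intro exI[of _ "{}"] exI[of _ "\<lambda>_. 0"]) auto
  next
    case (step c x y)
    from step.IH obtain B G where B: "finite B" "B \<subseteq> bounded_partitions k" "\<And>\<nu>. G \<nu> \<in> Lam"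
      and y: "y = (\<Sum>\<nu>\<in>B. tensor (s \<nu>) (G \<nu>))" by blast
    from step obtain f g where x: "x = tensor f g" "f \<in> Lam_sub k" "g \<in> Lam" by auto
    \<comment> \<open>The values of \<open>G\<close> outside \<open>B\<close> do not enter
      \<open>y\<close>, so they are cut off before summing over the larger set.\<close>
    let ?B = "B \<union> supp f" and ?G = "\<lambda>\<nu>. mscale (c * hall f (Ft \<nu>)) g + (if \<nu> \<in> B then G \<nu> else 0)"
    have fin: "finite ?B" and sub: "?B \<subseteq> bounded_partitions k"
      using B expand_kschur(1)[OF x(2)] by (auto simp: supp_def)
    have f: "f = (\<Sum>\<nu>\<in>?B. mscale (hall f (Ft \<nu>)) (s \<nu>))"
      using fin sub x(2) by (intro expand_kschur(2)) auto
    have "y = (\<Sum>\<nu>\<in>?B. tensor (s \<nu>) (if \<nu> \<in> B then G \<nu> else 0))"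
      unfolding y using fin by (intro sum.mono_neutral_cong_left) auto
    moreover have "mscale c x = (\<Sum>\<nu>\<in>?B. tensor (s \<nu>) (mscale (c * hall f (Ft \<nu>)) g))"
      unfolding x(1) by (subst f) (simp add: tensor_sum_left tensor_scale mps.scale_sum_right)
    ultimately have "mscale c x + y = (\<Sum>\<nu>\<in>?B. tensor (s \<nu>) (?G \<nu>))"
      by (simp only: tensor_add sum.distrib)
    moreover have "\<forall>\<nu>. ?G \<nu> \<in> Lam" using B x by auto
    ultimately show ?case using fin sub by (intro exI[of _ ?B] exI[of _ ?G] conjI)
  qed
  then show ?thesis using that by blast
qed

text \<open>Write \<open>T\<close> as a sum of tensors \<open>tensor (s \<nu>) (G \<nu>)\<close>. A
  vanishing coefficient in \<open>Y\<close> is then a linear relation among the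
  \<open>s \<nu>\<close>; pairing with \<open>Ft \<mu>\<close> kills each coefficient, so each
  \<open>G \<nu>\<close> lies in the ideal.\<close>

lemma sub_quot_kernelI:
  fixes T :: "(nat + nat, 'a) mps"
  assumes "T \<in> tensor_span (Lam_sub k) Lam" "\<And>\<xi> \<alpha>. exps_le k \<alpha> \<Longrightarrow> mcoeff T (join \<xi> \<alpha>) = 0"
  shows "T \<in> sub_quot_kernel k"
proof -
  obtain B G where B: "finite B" "B \<subseteq> bounded_partitions k" "\<And>\<nu>. G \<nu> \<in> Lam"
    and T: "T = (\<Sum>\<nu>\<in>B. tensor (s \<nu>) (G \<nu>))"
    using tensor_span_expand[OF assms(1)] by blast
  have "mcoeff (G \<mu>) \<alpha> = 0" if \<mu>: "\<mu> \<in> B" and \<alpha>: "exps_le k \<alpha>" for \<mu> \<alpha>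
  proof -
    have "(\<Sum>\<nu>\<in>B. mscale (mcoeff (G \<nu>) \<alpha>) (s \<nu>)) = 0"
      using assms(2)[OF \<alpha>] by (intro mps_eqI) (simp add: T mult.commute)
    then have "hall (\<Sum>\<nu>\<in>B. mscale (mcoeff (G \<nu>) \<alpha>) (s \<nu>)) (Ft \<mu>) = 0"
      using \<mu> B(2) by (simp add: hall_zero Ft_Lam subset_iff)
    then show ?thesis using hall_sum_s_Ft[OF B(1,2), of \<mu> "\<lambda>\<nu>. mcoeff (G \<nu>) \<alpha>"] \<mu> B(2) by auto
  qed
  then have "G \<nu> \<in> Lam_ideal k" if "\<nu> \<in> B" for \<nu> using that B by (simp add: Lam_ideal_iff)
  then show ?thesis
    unfolding T sub_quot_kernel_def using B(2) s_Lam_sub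
    by (intro mps.span_sum mps.span_base) blast
qed

lemma degree_part_tensor_span:
  fixes T :: "(nat + nat, 'a) mps"
  assumes "T \<in> tensor_span (Lam_sub k) Lam"
  shows "degree_part n T \<in> tensor_span (Lam_sub k) Lam"
  using assms unfolding tensor_span_def
proof (induction rule: mps.span_induct_alt)
  case (step c x y)
  then obtain f g where "x = tensor f g" "f \<in> Lam_sub k" "g \<in> Lam" by auto
  then have "degree_part n x \<in> mps.span {tensor f g |f g. f \<in> Lam_sub k \<and> g \<in> Lam}"
    using degree_part_Lam_sub[of f] Lam_degree_part[of g]
    by (simp only: degree_part_tensor) (intro mps.span_sum mps.span_base, blast)
  then show ?case using step.IH by (simp add: degree_part_simps mps.span_add mps.span_scale)
qed (simp add: degree_part_simps mps.span_zero)

end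

section \<open>Skew elements\<close>

lemma hall_sum_unscaled:
  fixes u :: "(nat, 'a::field_char_0) mps"
  assumes "u \<in> Lam" "\<And>i. i \<in> A \<Longrightarrow> f i \<in> Lam"
  shows "hall (\<Sum>i\<in>A. f i) u = (\<Sum>i\<in>A. hall (f i) u)"
  using hall_sum(1)[OF assms, where c = "\<lambda>_. 1"] by simp

lemma inY_inY_inX: "inY a * inY b * inX c = tensor c (a * b)"
  by (simp add: tensor_mult)

locale skew_kschur = dual_kschur +
  fixes sk Fsk :: "nat list \<Rightarrow> nat list \<Rightarrow> (nat, 'a) mps"
  assumes skew: "is_skew_kschur k s sk" and skew_dual: "is_skew_dual_kschur k Ft Fsk"
begin

abbreviation BP :: "nat list set" where "BP \<equiv> bounded_partitions k"

definition sk_supp :: "nat list \<Rightarrow> nat list set" where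
  "sk_supp \<nu> = {\<mu> \<in> BP. sk \<nu> \<mu> \<noteq> 0}"

definition Fsk_supp :: "nat list \<Rightarrow> nat list set" where
  "Fsk_supp \<nu> = {\<mu> \<in> BP. Fsk \<nu> \<mu> \<noteq> 0}"

lemma finite_supps:
  assumes "\<nu> \<in> BP"
  shows "finite (sk_supp \<nu>)" "finite (Fsk_supp \<nu>)"
  using assms skew skew_dual by (auto simp: is_skew_kschur_def is_skew_dual_kschur_def sk_supp_def Fsk_supp_def)

lemma sk_Lam_sub: "\<nu> \<in> BP \<Longrightarrow> \<mu> \<in> BP \<Longrightarrow> sk \<nu> \<mu> \<in> Lam_sub k"
  using skew by (simp add: is_skew_kschur_def)

lemma Fsk_Lam: "\<nu> \<in> BP \<Longrightarrow> \<mu> \<in> BP \<Longrightarrow> Fsk \<nu> \<mu> \<in> Lam"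
  using skew_dual by (simp add: is_skew_dual_kschur_def)

lemma coproduct_s: "\<nu> \<in> BP \<Longrightarrow> coproduct (s \<nu>) = (\<Sum>\<mu>\<in>sk_supp \<nu>. tensor (sk \<nu> \<mu>) (s \<mu>))"
  using skew by (simp add: is_skew_kschur_def sk_supp_def)

lemma coproduct_Ft: "\<nu> \<in> BP \<Longrightarrow>
    coproduct (Ft \<nu>) - (\<Sum>\<mu>\<in>Fsk_supp \<nu>. tensor (Fsk \<nu> \<mu>) (Ft \<mu>)) \<in> quot_quot_kernel k"
  using skew_dual by (simp add: is_skew_dual_kschur_def Fsk_supp_def)

lemma sliceX_coproduct_s:
  "\<rho> \<in> BP \<Longrightarrow> sliceX \<xi> (coproduct (s \<rho>)) = (\<Sum>\<mu>\<in>sk_supp \<rho>. mscale (mcoeff (sk \<rho> \<mu>) \<xi>) (s \<mu>))"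
  by (simp add: coproduct_s sliceX_sum slice_simps)

text \<open>The component of the coproduct along \<open>s \<mu>\<close>, taken at one monomial in
  \<open>X\<close> at a time, is an ordinary pairing in the other alphabet.\<close>

lemma hall_sliceX_coproduct_s:
  assumes "\<rho> \<in> BP" "\<mu> \<in> BP"
  shows "hall (sliceX \<xi> (coproduct (s \<rho>))) (Ft \<mu>) = mcoeff (sk \<rho> \<mu>) \<xi>"
proof -
  have "hall (sliceX \<xi> (coproduct (s \<rho>))) (Ft \<mu>) = (if \<mu> \<in> sk_supp \<rho> then mcoeff (sk \<rho> \<mu>) \<xi> else 0)"
    unfolding sliceX_coproduct_s[OF assms(1)] using finite_supps assms
    by (intro hall_sum_s_Ft) (auto simp: sk_supp_def)
  then show ?thesis using assms by (auto simp: sk_supp_def)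
qed

text \<open>Fixing the exponent \<open>\<xi>\<close> in \<open>X\<close> lowers the degree of
  \<open>s \<rho>\<close> by \<open>mdeg \<xi>\<close>, so the slice has coordinates only at indices
  of the remaining size.\<close>

lemma sk_homogeneous:
  assumes "\<rho> \<in> BP" "\<mu> \<in> BP" "mcoeff (sk \<rho> \<mu>) \<xi> \<noteq> 0"
  shows "mdeg \<xi> + sum_list \<mu> = sum_list \<rho>"
proof (rule ccontr)
  assume ne: "mdeg \<xi> + sum_list \<mu> \<noteq> sum_list \<rho>"
  define x where "x = sliceX \<xi> (coproduct (s \<rho>))"
  let ?B = "{\<nu> \<in> BP. sum_list \<nu> = sum_list \<mu>}"
  have x: "x \<in> Lam_sub k"
    unfolding x_def sliceX_coproduct_s[OF assms(1)]
    by (intro mps.subspace_sum mps.subspace_scale) (auto simp: sk_supp_def intro: s_Lam_sub)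
  have "mcoeff (s \<rho>) (Poly_Mapping.map_key sum_decode (join \<xi> \<alpha>)) = 0" if "mdeg \<alpha> = sum_list \<mu>" for \<alpha>
  proof (rule ccontr)
    assume "mcoeff (s \<rho>) (Poly_Mapping.map_key sum_decode (join \<xi> \<alpha>)) \<noteq> 0"
    from s_homogeneous[OF assms(1) this] show False
      using ne that by (simp add: mdeg_map_key bij_sum_decode)
  qed
  then have "degree_part (sum_list \<mu>) x = 0"
    by (intro mps_eqI) (simp add: x_def mcoeff_coproduct)
  then have "(\<Sum>\<nu>\<in>?B. mscale (hall x (Ft \<nu>)) (s \<nu>)) = 0"
    using degree_part_expand[OF x] by simp
  then have "hall (\<Sum>\<nu>\<in>?B. mscale (hall x (Ft \<nu>)) (s \<nu>)) (Ft \<mu>) = 0"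
    using assms(2) by (simp add: hall_zero Ft_Lam)
  moreover have "finite ?B"
    by (rule finite_subset[OF _ finite_bounded_partitions_le[of k "sum_list \<mu>"]]) auto
  ultimately have "hall x (Ft \<mu>) = 0"
    using hall_sum_s_Ft[of ?B \<mu> "\<lambda>\<nu>. hall x (Ft \<nu>)"] assms(2) by auto
  then show False using assms by (simp add: x_def hall_sliceX_coproduct_s)
qed

text \<open>Multiplication by \<open>s\<^sub>\<theta>\<close> is adjoint to skewing by \<open>s\<^sub>\<theta>\<close>.\<close>

lemma mcoeff_Fsk:
  assumes "\<mu> \<in> BP" "\<theta> \<in> BP" "exps_le k \<epsilon>"
    and C: "finite C" "C \<subseteq> parts_bounded k" and s\<theta>: "s \<theta> = (\<Sum>N\<in>C. mscale (b N) (Hprod N))"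
  shows "mcoeff (Fsk \<mu> \<theta>) \<epsilon> = (\<Sum>N\<in>C. b N * gcoeff (Ft \<mu>) (mtype \<epsilon> + N))"
    and "mcoeff (Fsk \<mu> \<theta>) \<epsilon> = hall (hmono \<epsilon> * s \<theta>) (Ft \<mu>)"
proof -
  have parts: "N \<in> parts" if "N \<in> C" for N using that C parts_bounded_subset by blast
  have hall: "hall (s \<theta>) (Ft \<theta>') = (\<Sum>N\<in>C. b N * gcoeff (Ft \<theta>') N)" if "\<theta>' \<in> BP" for \<theta>'
    unfolding s\<theta> using that by (subst hall_sum(1)) (auto simp: Ft_Lam hall_Hprod parts)
  have "gcoeff (Ft \<mu>) (mtype \<epsilon> + N) = (\<Sum>\<theta>'\<in>Fsk_supp \<mu>. mcoeff (Fsk \<mu> \<theta>') \<epsilon> * gcoeff (Ft \<theta>') N)" if N: "N \<in> C" for N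
  proof -
    have t: "mtype (exps_of N) = N" using parts[OF N] by (simp add: parts_def mtype_exps_of)
    then have "exps_le k (exps_of N)" using N C by (auto simp: exps_le_iff_mtype)
    \<comment> \<open>The coproduct of a representative is known only modulo the kernel, so it is
      compared at bounded exponents; this is why \<open>s \<theta>\<close> is expanded in bounded
      \<open>Hprod N\<close>.\<close>
    from mcoeff_quot_quot_kernel[OF coproduct_Ft[OF assms(1)] assms(3) this]
    have "mcoeff (coproduct (Ft \<mu>)) (join \<epsilon> (exps_of N)) =
        (\<Sum>\<theta>'\<in>Fsk_supp \<mu>. mcoeff (Fsk \<mu> \<theta>') \<epsilon> * mcoeff (Ft \<theta>') (exps_of N))"
      by simp
    then show ?thesis using assms(1) by (simp add: Lam_coproduct Ft_Lam t gcoeff_def[symmetric])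
  qed
  then have "(\<Sum>N\<in>C. b N * gcoeff (Ft \<mu>) (mtype \<epsilon> + N)) =
      (\<Sum>N\<in>C. \<Sum>\<theta>'\<in>Fsk_supp \<mu>. mcoeff (Fsk \<mu> \<theta>') \<epsilon> * (b N * gcoeff (Ft \<theta>') N))"
    by (intro sum.cong) (auto simp: sum_distrib_left mult_ac)
  also have "\<dots> = (\<Sum>\<theta>'\<in>Fsk_supp \<mu>. mcoeff (Fsk \<mu> \<theta>') \<epsilon> * (\<Sum>N\<in>C. b N * gcoeff (Ft \<theta>') N))"
    by (subst sum.swap) (simp add: sum_distrib_left)
  \<comment> \<open>The inner sum is \<open>hall (s \<theta>) (Ft \<theta>')\<close>, so duality
    leaves a single index.\<close>
  also have "\<dots> = (\<Sum>\<theta>'\<in>Fsk_supp \<mu>. if \<theta> = \<theta>' then mcoeff (Fsk \<mu> \<theta>) \<epsilon> else 0)"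
  proof (rule sum.cong[OF refl])
    fix \<theta>' assume "\<theta>' \<in> Fsk_supp \<mu>"
    then have "\<theta>' \<in> BP" by (simp add: Fsk_supp_def)
    then show "mcoeff (Fsk \<mu> \<theta>') \<epsilon> * (\<Sum>N\<in>C. b N * gcoeff (Ft \<theta>') N) =
        (if \<theta> = \<theta>' then mcoeff (Fsk \<mu> \<theta>) \<epsilon> else 0)"
      using assms(2) by (simp add: hall_s_Ft flip: hall)
  qed
  also have "\<dots> = mcoeff (Fsk \<mu> \<theta>) \<epsilon>"
    using finite_supps(2)[OF assms(1)] assms(2) by (auto simp: Fsk_supp_def)
  finally show 1: "mcoeff (Fsk \<mu> \<theta>) \<epsilon> = (\<Sum>N\<in>C. b N * gcoeff (Ft \<mu>) (mtype \<epsilon> + N))" by simp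
  have "hmono \<epsilon> * s \<theta> = (\<Sum>N\<in>C. mscale (b N) (Hprod (mtype \<epsilon> + N)))"
    by (simp add: s\<theta> sum_distrib_left Hprod_add)
  then have "hall (hmono \<epsilon> * s \<theta>) (Ft \<mu>) = (\<Sum>N\<in>C. b N * gcoeff (Ft \<mu>) (mtype \<epsilon> + N))"
    using assms(1) by (simp add: hall_sum Ft_Lam hall_Hprod parts)
  with 1 show "mcoeff (Fsk \<mu> \<theta>) \<epsilon> = hall (hmono \<epsilon> * s \<theta>) (Ft \<mu>)" by simp
qed

lemma s_Hprod_expansion:
  assumes "\<theta> \<in> BP"
  obtains C b where "finite C" "C \<subseteq> parts_bounded k" "s \<theta> = (\<Sum>N\<in>C. mscale (b N) (Hprod N))"
  using s_Lam_sub[OF assms] unfolding Lam_sub_eq by (rule span_image_obtain)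

lemma mcoeff_Fsk_hall:
  assumes "\<mu> \<in> BP" "\<theta> \<in> BP" "exps_le k \<epsilon>"
  shows "mcoeff (Fsk \<mu> \<theta>) \<epsilon> = hall (hmono \<epsilon> * s \<theta>) (Ft \<mu>)"
  using s_Hprod_expansion[OF assms(2)] mcoeff_Fsk(2)[OF assms] by metis

text \<open>Removes indices outside \<open>Fsk_supp \<eta>\<close>; as \<open>antipode\<close> is a
  choice, even this value has to be derived.\<close>

lemma antipode_zero: "antipode (0 :: (nat, 'a) mps) = 0"
proof -
  obtain S :: "(nat, 'a) mps \<Rightarrow> (nat, 'a) mps"
    where lin: "\<And>f g. S (f + g) = S f + S g" "\<And>c f. S (mscale c f) = mscale c (S f)"
      and S: "\<And>f. f \<in> Lam \<Longrightarrow> S f = antipode f" "is_antipode S"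
    using antipode_linear_ext by blast
  show ?thesis using lin(2)[of 0 0] S(1)[of 0] by simp
qed

text \<open>The antipode axiom for \<open>F\<^sub>\<eta>\<close>, with the last factor of the iterated coproduct paired with \<open>s\<^sub>\<theta>\<close>.\<close>

lemma antipode_Fsk_inverse:
  assumes "\<eta> \<in> BP" "\<theta> \<in> BP" "exps_le k \<zeta>"
  shows "(\<Sum>\<mu>\<in>Fsk_supp \<eta>. mcoeff (antipode (Fsk \<eta> \<mu>) * Fsk \<mu> \<theta>) \<zeta>) = (if \<eta> = \<theta> \<and> \<zeta> = 0 then 1 else 0)"
proof -
  obtain S :: "(nat, 'a) mps \<Rightarrow> (nat, 'a) mps"
    where lin: "\<And>f g. S (f + g) = S f + S g" "\<And>c f. S (mscale c f) = mscale c (S f)"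
      and S: "\<And>f. f \<in> Lam \<Longrightarrow> S f = antipode f" and anti: "is_antipode S"
    using antipode_linear_ext by blast
  obtain C b where C: "finite C" "C \<subseteq> parts_bounded k" "s \<theta> = (\<Sum>N\<in>C. mscale (b N) (Hprod N))"
    using s_Hprod_expansion[OF assms(2)] by blast
  have parts: "N \<in> parts" if "N \<in> C" for N using that C parts_bounded_subset by blast
  \<comment> \<open>Antipode on the first factor, skewing by \<open>Hprod N\<close> on the second,
    then multiplication. Weighting with \<open>b N\<close> and summing over \<open>C\<close> amounts
    to skewing by \<open>s \<theta>\<close>.\<close>
  define J where "J N T = apply_mult S (hskew2 N T)" for N T
  have J_simps: "J N (T + U) = J N T + J N U" "J N (mscale c T) = mscale c (J N T)"
    "J N (tensor f g) = S f * hskew N g" for N T U c f g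
    by (simp_all add: J_def hskew2_simps apply_mult_simps lin apply_mult_tensor)
  have J0: "J N 0 = 0" for N using J_simps(2)[of N 0 0] by simp
  have J_sum: "J N (\<Sum>i\<in>A. T i) = (\<Sum>i\<in>A. J N (T i))" for N and T :: "nat list \<Rightarrow> _" and A
    by (induction A rule: infinite_finite_induct) (auto simp: J0 J_simps)
  \<comment> \<open>At a bounded exponent \<open>J N\<close> respects the quotient: \<open>S\<close>
    maps the ideal into itself because it negates each \<open>psym j\<close>, and skewing reads
    coefficients at \<open>mtype \<gamma> + N\<close>, which stays bounded since \<open>N\<close>
    is.\<close>
  have J_ker: "mcoeff (J N T) \<zeta> = 0" if T: "T \<in> quot_quot_kernel k" and N: "N \<in> C" for N T
    using T unfolding quot_quot_kernel_def
  proof (induction rule: mps.span_induct_alt)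
    case (step c x y)
    then obtain f g where x: "x = tensor f g" "f \<in> Lam" "g \<in> Lam" "f \<in> Lam_ideal k \<or> g \<in> Lam_ideal k" by auto
    have "mcoeff (S f * hskew N g) \<zeta> = 0"
      using x(4)
    proof
      assume f: "f \<in> Lam_ideal k"
      then have "S f \<in> Lam_ideal k"
        unfolding Lam_ideal_def
      proof (induction rule: mps.span_induct_alt)
        case base
        then show ?case using lin(2)[of 0 0] by (simp add: mps.span_zero)
      next
        case (step c u v)
        then obtain f' j where u: "u = f' * psym j" "f' \<in> Lam" "k < j" by auto
        then have "S u = (- S f') * psym j"
          using anti by (simp add: is_antipode_def)
        moreover have "- S f' \<in> Lam" using anti u(2) by (simp add: is_antipode_def)
        ultimately have "S u \<in> mps.span {f * psym j |f j. f \<in> Lam \<and> k < j}"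
          using u(3) by (intro mps.span_base) blast
        then show ?case using step.IH by (simp add: lin mps.span_add mps.span_scale)
      qed
      then have "mcoeff (S f) \<beta> = 0" if "(\<beta>, \<gamma>) \<in> splits \<zeta>" for \<beta> \<gamma>
        using exps_le_splits[OF assms(3) that] by (simp add: Lam_ideal_iff)
      then show ?thesis unfolding mcoeff_mult by (intro sum.neutral) auto
    next
      assume g: "g \<in> Lam_ideal k"
      have "mcoeff (hskew N g) \<gamma> = 0" if "(\<beta>, \<gamma>) \<in> splits \<zeta>" for \<beta> \<gamma>
      proof -
        have "mtype \<gamma> + N \<in> parts_bounded k"
          using exps_le_splits[OF assms(3) that] N C(2) by (auto simp: exps_le_iff_mtype parts_bounded_def)
        moreover from this have "mtype (exps_of (mtype \<gamma> + N)) = mtype \<gamma> + N"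
          using parts_bounded_subset by (intro mtype_exps_of) (auto simp: parts_bounded_def)
        ultimately have "exps_le k (exps_of (mtype \<gamma> + N))" by (simp add: exps_le_iff_mtype)
        then show ?thesis using g parts[OF N] by (simp add: Lam_hskew_mcoeff Lam_ideal_iff gcoeff_def)
      qed
      then show ?thesis unfolding mcoeff_mult by (intro sum.neutral) auto
    qed
    then show ?case using step.IH by (simp add: x(1) J_simps)
  qed (simp add: J0)
  \<comment> \<open>Modulo the kernel \<open>J N\<close> may be applied to the coproduct itself,
    where the antipode axiom evaluates it.\<close>
  have J_Ft: "(\<Sum>\<mu>\<in>Fsk_supp \<eta>. mcoeff (S (Fsk \<eta> \<mu>) * hskew N (Ft \<mu>)) \<zeta>) =
      (if \<zeta> = 0 then gcoeff (Ft \<eta>) N else 0)" if N: "N \<in> C" for N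
  proof -
    define T where "T = (\<Sum>\<mu>\<in>Fsk_supp \<eta>. tensor (Fsk \<eta> \<mu>) (Ft \<mu>))"
    have "coproduct (Ft \<eta>) = (coproduct (Ft \<eta>) - T) + T" by simp
    then have "J N (coproduct (Ft \<eta>)) = J N (coproduct (Ft \<eta>) - T) + J N T" by (metis J_simps(1))
    then have "mcoeff (J N (coproduct (Ft \<eta>))) \<zeta> = mcoeff (J N T) \<zeta>"
      using J_ker[OF coproduct_Ft[OF assms(1)] N] by (simp add: T_def)
    moreover have "J N (coproduct (Ft \<eta>)) = mscale (gcoeff (Ft \<eta>) N) 1"
      unfolding J_def using Ft_Lam[OF assms(1)] parts[OF N]
      by (intro apply_mult_hskew2_coproduct lin anti)
    ultimately have "mcoeff (J N T) \<zeta> = (if \<zeta> = 0 then gcoeff (Ft \<eta>) N else 0)"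
      by (auto simp: mcoeff_one split: if_splits)
    then show ?thesis by (simp add: T_def J_sum J_simps)
  qed
  have "(\<Sum>\<mu>\<in>Fsk_supp \<eta>. mcoeff (antipode (Fsk \<eta> \<mu>) * Fsk \<mu> \<theta>) \<zeta>) =
      (\<Sum>\<mu>\<in>Fsk_supp \<eta>. \<Sum>N\<in>C. b N * mcoeff (S (Fsk \<eta> \<mu>) * hskew N (Ft \<mu>)) \<zeta>)"
  proof (rule sum.cong[OF refl])
    fix \<mu> assume "\<mu> \<in> Fsk_supp \<eta>"
    then have \<mu>: "\<mu> \<in> BP" by (simp add: Fsk_supp_def)
    have "mcoeff (antipode (Fsk \<eta> \<mu>) * Fsk \<mu> \<theta>) \<zeta> =
        mcoeff (S (Fsk \<eta> \<mu>) * (\<Sum>N\<in>C. mscale (b N) (hskew N (Ft \<mu>)))) \<zeta>"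
    proof (rule mcoeff_mult_cong)
      fix \<beta> \<gamma> assume "(\<beta>, \<gamma>) \<in> splits \<zeta>"
      then have "exps_le k \<gamma>" using exps_le_splits assms(3) by blast
      then have "mcoeff (Fsk \<mu> \<theta>) \<gamma> = mcoeff (\<Sum>N\<in>C. mscale (b N) (hskew N (Ft \<mu>))) \<gamma>"
        using mcoeff_Fsk(1)[OF \<mu> assms(2) _ C] \<mu> by (simp add: Lam_hskew_mcoeff Ft_Lam parts)
      then show "mcoeff (antipode (Fsk \<eta> \<mu>)) \<beta> = mcoeff (S (Fsk \<eta> \<mu>)) \<beta> \<and>
          mcoeff (Fsk \<mu> \<theta>) \<gamma> = mcoeff (\<Sum>N\<in>C. mscale (b N) (hskew N (Ft \<mu>))) \<gamma>"
        using S Fsk_Lam \<mu> assms(1) by simp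
    qed
    then show "mcoeff (antipode (Fsk \<eta> \<mu>) * Fsk \<mu> \<theta>) \<zeta> =
        (\<Sum>N\<in>C. b N * mcoeff (S (Fsk \<eta> \<mu>) * hskew N (Ft \<mu>)) \<zeta>)"
      by (simp add: sum_distrib_left)
  qed
  also have "\<dots> = (\<Sum>N\<in>C. b N * (if \<zeta> = 0 then gcoeff (Ft \<eta>) N else 0))"
    by (subst sum.swap) (simp add: J_Ft flip: sum_distrib_left)
  also have "\<dots> = (if \<zeta> = 0 then hall (s \<theta>) (Ft \<eta>) else 0)"
    unfolding C(3) using assms(1) by (auto simp: hall_sum Ft_Lam hall_Hprod parts)
  finally show ?thesis using assms by (auto simp: hall_s_Ft)
qed

text \<open>The coproduct of \<open>hmono \<gamma> * s \<kappa>\<close> is computed twice: from its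
  k-Schur expansion over \<open>R\<close>, and by multiplicativity. The components along
  \<open>s \<mu>\<close> at the monomial \<open>\<xi>\<close> are then compared.\<close>

lemma sum_hall_sk:
  assumes "\<kappa> \<in> BP" "\<mu> \<in> BP" "exps_le k \<gamma>"
    and R: "finite R" "R \<subseteq> BP" "supp (hmono \<gamma> * s \<kappa>) \<subseteq> R"
  shows "(\<Sum>\<rho>\<in>R. hall (hmono \<gamma> * s \<kappa>) (Ft \<rho>) * mcoeff (sk \<rho> \<mu>) \<xi>) =
    (\<Sum>(\<delta>, \<epsilon>)\<in>splits \<gamma>. \<Sum>\<theta>\<in>sk_supp \<kappa>. mcoeff (hmono \<delta> * sk \<kappa> \<theta>) \<xi> * hall (hmono \<epsilon> * s \<theta>) (Ft \<mu>))"
proof -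
  define x where "x = hmono \<gamma> * s \<kappa>"
  have x: "x \<in> Lam_sub k"
    unfolding x_def using assms by (intro Lam_sub_mult Hprod_in_Lam_sub s_Lam_sub) (simp add: exps_le_iff_mtype)
  have "coproduct x = (\<Sum>\<rho>\<in>R. mscale (hall x (Ft \<rho>)) (coproduct (s \<rho>)))"
    by (subst expand_kschur(2)[OF x R(1) R(3)[folded x_def] R(2)]) (simp add: coproduct_sum coproduct_simps)
  then have "hall (sliceX \<xi> (coproduct x)) (Ft \<mu>) = hall (\<Sum>\<rho>\<in>R. mscale (hall x (Ft \<rho>)) (sliceX \<xi> (coproduct (s \<rho>)))) (Ft \<mu>)"
    by (simp add: sliceX_sum slice_simps)
  also have "\<dots> = (\<Sum>\<rho>\<in>R. hall x (Ft \<rho>) * hall (sliceX \<xi> (coproduct (s \<rho>))) (Ft \<mu>))"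
  proof (rule hall_sum(1))
    fix \<rho> assume "\<rho> \<in> R"
    then show "sliceX \<xi> (coproduct (s \<rho>)) \<in> Lam"
      using R(2) by (subst sliceX_coproduct_s) (auto simp: sk_supp_def intro!: Lam_sum Lam_mscale s_Lam)
  qed (use assms Ft_Lam in auto)
  also have "\<dots> = (\<Sum>\<rho>\<in>R. hall x (Ft \<rho>) * mcoeff (sk \<rho> \<mu>) \<xi>)"
    using R(2) assms(2) by (intro sum.cong) (auto simp: hall_sliceX_coproduct_s)
  finally have 1: "hall (sliceX \<xi> (coproduct x)) (Ft \<mu>) = (\<Sum>\<rho>\<in>R. hall x (Ft \<rho>) * mcoeff (sk \<rho> \<mu>) \<xi>)" .
  have "coproduct x = (\<Sum>p\<in>splits \<gamma>. \<Sum>\<theta>\<in>sk_supp \<kappa>. tensor (hmono (fst p) * sk \<kappa> \<theta>) (hmono (snd p) * s \<theta>))"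
    using assms(1) by (simp add: x_def coproduct_mult coproduct_hmono coproduct_s sum_product tensor_mult case_prod_beta)
  then have "sliceX \<xi> (coproduct x) =
      (\<Sum>p\<in>splits \<gamma>. \<Sum>\<theta>\<in>sk_supp \<kappa>. mscale (mcoeff (hmono (fst p) * sk \<kappa> \<theta>) \<xi>) (hmono (snd p) * s \<theta>))"
    by (simp add: sliceX_sum slice_simps)
  also have "hall \<dots> (Ft \<mu>) = (\<Sum>p\<in>splits \<gamma>. hall (\<Sum>\<theta>\<in>sk_supp \<kappa>. mscale (mcoeff (hmono (fst p) * sk \<kappa> \<theta>) \<xi>) (hmono (snd p) * s \<theta>)) (Ft \<mu>))"
    using assms by (intro hall_sum_unscaled Lam_sum Lam_mscale Lam_mult) (auto simp: Ft_Lam sk_supp_def s_Lam)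
  also have "\<dots> = (\<Sum>p\<in>splits \<gamma>. \<Sum>\<theta>\<in>sk_supp \<kappa>. mcoeff (hmono (fst p) * sk \<kappa> \<theta>) \<xi> * hall (hmono (snd p) * s \<theta>) (Ft \<mu>))"
    using assms by (intro sum.cong refl hall_sum) (auto simp: Ft_Lam sk_supp_def s_Lam)
  finally show ?thesis using 1 by (simp add: x_def case_prod_beta)
qed

text \<open>The first factor confines \<open>\<mu>\<close> to the finite set
  \<open>Fsk_supp \<eta>\<close>. For given \<open>\<mu>\<close>, homogeneity of
  \<open>sk \<rho> \<mu>\<close> bounds the size of \<open>\<rho>\<close> by
  \<open>n + sum_list \<mu>\<close>.\<close>

lemma finite_skew_sum:
  assumes "\<kappa> \<in> BP" "\<eta> \<in> BP"
  shows "finite_in_each_degree (BP \<times> BP)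
    (\<lambda>(\<rho>, \<mu>). inY (antipode (Fsk \<eta> \<mu>)) * inY (Fsk \<rho> \<kappa>) * inX (sk \<rho> \<mu>))"
  unfolding finite_in_each_degree_def
proof
  fix n
  let ?t = "\<lambda>(\<rho>, \<mu>). inY (antipode (Fsk \<eta> \<mu>)) * inY (Fsk \<rho> \<kappa>) * inX (sk \<rho> \<mu>)"
  have "{i \<in> BP \<times> BP. degree_part n (?t i) \<noteq> 0} \<subseteq>
      (\<Union>\<mu>\<in>Fsk_supp \<eta>. {\<rho> \<in> BP. sum_list \<rho> \<le> n + sum_list \<mu>} \<times> {\<mu>})"
  proof clarify
    fix \<rho> \<mu> assume BP: "\<rho> \<in> BP" "\<mu> \<in> BP"
      and "degree_part n (inY (antipode (Fsk \<eta> \<mu>)) * inY (Fsk \<rho> \<kappa>) * inX (sk \<rho> \<mu>)) \<noteq> 0"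
    then obtain \<xi> \<alpha> where d: "mdeg (join \<xi> \<alpha>) = n"
      and nz: "mcoeff (tensor (sk \<rho> \<mu>) (antipode (Fsk \<eta> \<mu>) * Fsk \<rho> \<kappa>)) (join \<xi> \<alpha>) \<noteq> 0"
      unfolding inY_inY_inX degree_part_neq_0_iff by (metis join_cases)
    have "Fsk \<eta> \<mu> \<noteq> 0" using nz by (auto simp: antipode_zero)
    moreover have "mcoeff (sk \<rho> \<mu>) \<xi> \<noteq> 0" using nz by auto
    then have "mdeg \<xi> + sum_list \<mu> = sum_list \<rho>" using sk_homogeneous BP by blast
    ultimately show "(\<rho>, \<mu>) \<in> (\<Union>\<mu>\<in>Fsk_supp \<eta>. {\<rho> \<in> BP. sum_list \<rho> \<le> n + sum_list \<mu>} \<times> {\<mu>})"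
      using d BP by (auto simp: Fsk_supp_def)
  qed
  moreover have "finite (\<Union>\<mu>\<in>Fsk_supp \<eta>. {\<rho> \<in> BP. sum_list \<rho> \<le> n + sum_list \<mu>} \<times> {\<mu>})"
    using finite_supps(2)[OF assms(2)] finite_bounded_partitions_le by blast
  ultimately show "finite {i \<in> BP \<times> BP. degree_part n (?t i) \<noteq> 0}" by (rule finite_subset)
qed

text \<open>The reproducing property of the kernel: its coefficient at \<open>\<alpha>\<close> in
  \<open>Y\<close> is the k-Schur expansion of \<open>hmono \<alpha>\<close>.\<close>

lemma mcoeff_left_side:
  assumes "\<kappa> \<in> BP" "\<eta> \<in> BP" "exps_le k \<alpha>"
  shows "mcoeff (Cauchy_kernel k s Ft * inX (sk \<kappa> \<eta>)) (join \<xi> \<alpha>) = mcoeff (hmono \<alpha> * sk \<kappa> \<eta>) \<xi>"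
proof -
  have h: "hmono \<alpha> \<in> Lam_sub k"
    using assms by (intro Hprod_in_Lam_sub) (simp add: exps_le_iff_mtype)
  have Ft: "mcoeff (Ft \<nu>) \<alpha> = hall (hmono \<alpha>) (Ft \<nu>)" if "\<nu> \<in> BP" for \<nu>
    using that by (simp add: hall_Hprod Ft_Lam Lam_mcoeff)
  have "Cauchy_kernel k s Ft * inX (sk \<kappa> \<eta>) = formal_sum BP (\<lambda>\<nu>. tensor (s \<nu> * sk \<kappa> \<eta>) (Ft \<nu>))"
    unfolding Cauchy_kernel_def formal_sum_mult[OF finite_Cauchy] by (simp add: tensor_mult)
  also have "mcoeff \<dots> (join \<xi> \<alpha>) = (\<Sum>\<nu>\<in>supp (hmono \<alpha>). mcoeff (tensor (s \<nu> * sk \<kappa> \<eta>) (Ft \<nu>)) (join \<xi> \<alpha>))"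
    using expand_kschur(1)[OF h] by (intro mcoeff_formal_sum) (auto simp: supp_def Ft)
  also have "\<dots> = mcoeff ((\<Sum>\<nu>\<in>supp (hmono \<alpha>). mscale (hall (hmono \<alpha>) (Ft \<nu>)) (s \<nu>)) * sk \<kappa> \<eta>) \<xi>"
    by (simp add: sum_distrib_right) (intro sum.cong, auto simp: supp_def Ft)
  also have "(\<Sum>\<nu>\<in>supp (hmono \<alpha>). mscale (hall (hmono \<alpha>) (Ft \<nu>)) (s \<nu>)) = hmono \<alpha>"
    using expand_kschur[OF h] by (simp add: supp_def)
  finally show ?thesis .
qed

text \<open>With \<open>\<xi>\<close> fixed the factors in \<open>X\<close> are scalars, so the
  calculation runs among power series in \<open>Y\<close>, observed only at bounded
  exponents.\<close>

lemma mcoeff_right_side: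
  assumes "\<kappa> \<in> BP" "\<eta> \<in> BP" "exps_le k \<alpha>"
  shows "mcoeff (formal_sum (BP \<times> BP)
      (\<lambda>(\<rho>, \<mu>). inY (antipode (Fsk \<eta> \<mu>)) * inY (Fsk \<rho> \<kappa>) * inX (sk \<rho> \<mu>))) (join \<xi> \<alpha>) =
    mcoeff (hmono \<alpha> * sk \<kappa> \<eta>) \<xi>"
proof -
  let ?t = "\<lambda>(\<rho>, \<mu>). inY (antipode (Fsk \<eta> \<mu>)) * inY (Fsk \<rho> \<kappa>) * inX (sk \<rho> \<mu>)"
  let ?x = "\<lambda>\<gamma>. hmono \<gamma> * s \<kappa>"
  \<comment> \<open>A common finite index set for all splittings: for \<open>\<rho>\<close> outside
    it, the coefficients of \<open>Fsk \<rho> \<kappa>\<close> at every occurring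
    \<open>\<gamma>\<close> vanish.\<close>
  define R where "R = (\<Union>(\<beta>, \<gamma>)\<in>splits \<alpha>. supp (?x \<gamma>))"
  have x: "?x \<gamma> \<in> Lam_sub k" if "exps_le k \<gamma>" for \<gamma>
    using that assms by (intro Lam_sub_mult Hprod_in_Lam_sub s_Lam_sub) (simp add: exps_le_iff_mtype)
  have le: "exps_le k \<beta>" "exps_le k \<gamma>" if "(\<beta>, \<gamma>) \<in> splits \<alpha>" for \<beta> \<gamma>
    using exps_le_splits[OF assms(3) that] by auto
  have R: "finite R" "R \<subseteq> BP" "\<And>\<beta> \<gamma>. (\<beta>, \<gamma>) \<in> splits \<alpha> \<Longrightarrow> supp (?x \<gamma>) \<subseteq> R"
    using expand_kschur(1)[OF x] le unfolding R_def
    by (auto simp: case_prod_beta) (auto simp: supp_def splits_def)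
  \<comment> \<open>A bookkeeping series in \<open>Y\<close>: its coefficient at
    \<open>\<delta>\<close> is the scalar attached to \<open>hmono \<delta>\<close>. With it the sum
    over \<open>splits\<close> from \<open>sum_hall_sk\<close> becomes the product of
    \<open>P \<theta>\<close> and \<open>Fsk \<mu> \<theta>\<close>.\<close>
  define P where "P \<theta> = Mps (\<lambda>\<delta>. mcoeff (hmono \<delta> * sk \<kappa> \<theta>) \<xi>)" for \<theta>
  have "mcoeff (formal_sum (BP \<times> BP) ?t) (join \<xi> \<alpha>) = (\<Sum>i\<in>R \<times> Fsk_supp \<eta>. mcoeff (?t i) (join \<xi> \<alpha>))"
  proof (rule mcoeff_formal_sum)
    show "finite (R \<times> Fsk_supp \<eta>)" using R finite_supps assms by auto
    show "R \<times> Fsk_supp \<eta> \<subseteq> BP \<times> BP" using R by (auto simp: Fsk_supp_def)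
    fix i assume i: "i \<in> BP \<times> BP" "i \<notin> R \<times> Fsk_supp \<eta>"
    then obtain \<rho> \<mu> where \<rho>\<mu>: "i = (\<rho>, \<mu>)" "\<rho> \<in> BP" "\<mu> \<in> BP" by auto
    have "mcoeff (antipode (Fsk \<eta> \<mu>) * Fsk \<rho> \<kappa>) \<alpha> = 0"
    proof (cases "\<mu> \<in> Fsk_supp \<eta>")
      case False
      then show ?thesis using \<rho>\<mu> by (simp add: Fsk_supp_def antipode_zero)
    next
      case True
      have "mcoeff (Fsk \<rho> \<kappa>) \<gamma> = 0" if "(\<beta>, \<gamma>) \<in> splits \<alpha>" for \<beta> \<gamma>
      proof -
        have "\<rho> \<notin> supp (?x \<gamma>)" using R(3)[OF that] True i \<rho>\<mu>(1) by auto
        then show ?thesis using \<rho>\<mu> le[OF that] assms(1) by (simp add: supp_def mcoeff_Fsk_hall)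
      qed
      then show ?thesis unfolding mcoeff_mult by (intro sum.neutral) auto
    qed
    then show "mcoeff (?t i) (join \<xi> \<alpha>) = 0" by (simp add: \<rho>\<mu>(1) inY_inY_inX)
  qed
  also have "\<dots> = (\<Sum>\<mu>\<in>Fsk_supp \<eta>. \<Sum>\<rho>\<in>R. mcoeff (sk \<rho> \<mu>) \<xi> * mcoeff (antipode (Fsk \<eta> \<mu>) * Fsk \<rho> \<kappa>) \<alpha>)"
    by (subst sum.swap) (simp add: sum.cartesian_product case_prod_beta inY_inY_inX)
  also have "\<dots> = (\<Sum>\<mu>\<in>Fsk_supp \<eta>. mcoeff (\<Sum>\<theta>\<in>sk_supp \<kappa>. P \<theta> * (antipode (Fsk \<eta> \<mu>) * Fsk \<mu> \<theta>)) \<alpha>)"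
  proof (rule sum.cong[OF refl])
    fix \<mu> assume "\<mu> \<in> Fsk_supp \<eta>"
    then have \<mu>: "\<mu> \<in> BP" by (simp add: Fsk_supp_def)
    have "(\<Sum>\<rho>\<in>R. mcoeff (sk \<rho> \<mu>) \<xi> * mcoeff (antipode (Fsk \<eta> \<mu>) * Fsk \<rho> \<kappa>) \<alpha>) =
        mcoeff (antipode (Fsk \<eta> \<mu>) * (\<Sum>\<rho>\<in>R. mscale (mcoeff (sk \<rho> \<mu>) \<xi>) (Fsk \<rho> \<kappa>))) \<alpha>"
      by (simp add: sum_distrib_left)
    also have "\<dots> = mcoeff (antipode (Fsk \<eta> \<mu>) * (\<Sum>\<theta>\<in>sk_supp \<kappa>. P \<theta> * Fsk \<mu> \<theta>)) \<alpha>"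
    proof (rule mcoeff_mult_cong)
      fix \<beta> \<gamma> assume bc: "(\<beta>, \<gamma>) \<in> splits \<alpha>"
      have "mcoeff (\<Sum>\<rho>\<in>R. mscale (mcoeff (sk \<rho> \<mu>) \<xi>) (Fsk \<rho> \<kappa>)) \<gamma> =
          (\<Sum>\<rho>\<in>R. hall (?x \<gamma>) (Ft \<rho>) * mcoeff (sk \<rho> \<mu>) \<xi>)"
        unfolding mcoeff_sum using R(2) le(2)[OF bc] assms(1)
        by (intro sum.cong) (auto simp: mcoeff_Fsk_hall mult.commute)
      also have "\<dots> = (\<Sum>(\<delta>, \<epsilon>)\<in>splits \<gamma>. \<Sum>\<theta>\<in>sk_supp \<kappa>.
          mcoeff (hmono \<delta> * sk \<kappa> \<theta>) \<xi> * hall (hmono \<epsilon> * s \<theta>) (Ft \<mu>))"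
        by (rule sum_hall_sk[OF assms(1) \<mu> le(2)[OF bc] R(1,2) R(3)[OF bc]])
      also have "\<dots> = (\<Sum>x\<in>splits \<gamma>. \<Sum>\<theta>\<in>sk_supp \<kappa>. mcoeff (P \<theta>) (fst x) * mcoeff (Fsk \<mu> \<theta>) (snd x))"
      proof (intro sum.cong refl, clarify, intro sum.cong refl)
        fix \<delta> \<epsilon> \<theta> assume "(\<delta>, \<epsilon>) \<in> splits \<gamma>" "\<theta> \<in> sk_supp \<kappa>"
        then have "exps_le k \<epsilon>" "\<theta> \<in> BP"
          using exps_le_splits[OF le(2)[OF bc]] by (auto simp: sk_supp_def)
        then show "mcoeff (hmono \<delta> * sk \<kappa> \<theta>) \<xi> * hall (hmono \<epsilon> * s \<theta>) (Ft \<mu>) =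
            mcoeff (P \<theta>) (fst (\<delta>, \<epsilon>)) * mcoeff (Fsk \<mu> \<theta>) (snd (\<delta>, \<epsilon>))"
          using \<mu> by (simp add: P_def mcoeff_Fsk_hall)
      qed
      also have "\<dots> = mcoeff (\<Sum>\<theta>\<in>sk_supp \<kappa>. P \<theta> * Fsk \<mu> \<theta>) \<gamma>"
        by (subst sum.swap) (simp add: mcoeff_mult case_prod_beta)
      finally show "mcoeff (antipode (Fsk \<eta> \<mu>)) \<beta> = mcoeff (antipode (Fsk \<eta> \<mu>)) \<beta> \<and>
          mcoeff (\<Sum>\<rho>\<in>R. mscale (mcoeff (sk \<rho> \<mu>) \<xi>) (Fsk \<rho> \<kappa>)) \<gamma> =
          mcoeff (\<Sum>\<theta>\<in>sk_supp \<kappa>. P \<theta> * Fsk \<mu> \<theta>) \<gamma>" by simp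
    qed
    also have "antipode (Fsk \<eta> \<mu>) * (\<Sum>\<theta>\<in>sk_supp \<kappa>. P \<theta> * Fsk \<mu> \<theta>) =
        (\<Sum>\<theta>\<in>sk_supp \<kappa>. P \<theta> * (antipode (Fsk \<eta> \<mu>) * Fsk \<mu> \<theta>))"
      by (simp add: sum_distrib_left mult_ac)
    finally show "(\<Sum>\<rho>\<in>R. mcoeff (sk \<rho> \<mu>) \<xi> * mcoeff (antipode (Fsk \<eta> \<mu>) * Fsk \<rho> \<kappa>) \<alpha>) =
        mcoeff (\<Sum>\<theta>\<in>sk_supp \<kappa>. P \<theta> * (antipode (Fsk \<eta> \<mu>) * Fsk \<mu> \<theta>)) \<alpha>" .
  qed
  also have "\<dots> = (\<Sum>\<theta>\<in>sk_supp \<kappa>. mcoeff (P \<theta> * (\<Sum>\<mu>\<in>Fsk_supp \<eta>. antipode (Fsk \<eta> \<mu>) * Fsk \<mu> \<theta>)) \<alpha>)"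
    by (simp add: sum_distrib_left) (rule sum.swap)
  \<comment> \<open>The inverse relation holds only at bounded exponents, so it is inserted under
    the product.\<close>
  also have "\<dots> = (\<Sum>\<theta>\<in>sk_supp \<kappa>. mcoeff (P \<theta> * (if \<eta> = \<theta> then 1 else 0)) \<alpha>)"
  proof (intro sum.cong refl mcoeff_mult_cong conjI)
    fix \<theta> \<beta> \<gamma> assume "\<theta> \<in> sk_supp \<kappa>" "(\<beta>, \<gamma>) \<in> splits \<alpha>"
    then show "mcoeff (\<Sum>\<mu>\<in>Fsk_supp \<eta>. antipode (Fsk \<eta> \<mu>) * Fsk \<mu> \<theta>) \<gamma> = mcoeff (if \<eta> = \<theta> then 1 else 0) \<gamma>"
      using antipode_Fsk_inverse[OF assms(2), of \<theta> \<gamma>] le by (simp add: sk_supp_def mcoeff_one)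
  qed
  also have "\<dots> = (\<Sum>\<theta>\<in>sk_supp \<kappa>. if \<eta> = \<theta> then mcoeff (P \<eta>) \<alpha> else 0)"
    by (intro sum.cong) auto
  also have "\<dots> = mcoeff (P \<eta>) \<alpha>"
    using finite_supps(1)[OF assms(1)] assms(2) by (auto simp: sk_supp_def P_def)
  finally show ?thesis by (simp add: P_def)
qed

text \<open>The coefficient criterion applies only to finite sums of tensors. Hence each homogeneous
  part of both sides is first shown to be such a sum, by finiteness in each degree and the grading
  of \<open>Lam_sub k\<close>.\<close>

lemma kschur_identity:
  assumes "\<kappa> \<in> BP" "\<eta> \<in> BP"
  shows "sub_quot_eq k (Cauchy_kernel k s Ft * inX (sk \<kappa> \<eta>))
    (formal_sum (BP \<times> BP) (\<lambda>(\<rho>, \<mu>). inY (antipode (Fsk \<eta> \<mu>)) * inY (Fsk \<rho> \<kappa>) * inX (sk \<rho> \<mu>)))"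
    (is "sub_quot_eq k ?U ?V")
  unfolding sub_quot_eq_def
proof
  fix n
  let ?TS = "tensor_span (Lam_sub k) Lam :: (nat + nat, 'a) mps set"
  have base: "tensor f g \<in> ?TS" if "f \<in> Lam_sub k" "g \<in> Lam" for f g
    unfolding tensor_span_def using that by (intro mps.span_base) blast
  have Cauchy: "?U = formal_sum BP (\<lambda>\<nu>. inX (s \<nu>) * inY (Ft \<nu>) * inX (sk \<kappa> \<eta>))"
    unfolding Cauchy_kernel_def by (rule formal_sum_mult[OF finite_Cauchy])
  have "degree_part n ?U \<in> ?TS"
    unfolding Cauchy degree_part_formal_sum[OF finite_in_each_degree_mult[OF finite_Cauchy]]
    unfolding tensor_span_def
  proof (rule mps.span_sum, fold tensor_span_def)
    fix \<nu> assume "\<nu> \<in> {\<nu> \<in> BP. degree_part n (inX (s \<nu>) * inY (Ft \<nu>) * inX (sk \<kappa> \<eta>)) \<noteq> 0}"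
    then show "degree_part n (inX (s \<nu>) * inY (Ft \<nu>) * inX (sk \<kappa> \<eta>)) \<in> ?TS"
      using assms unfolding inX_inY tensor_mult
      by (intro degree_part_tensor_span base) (auto intro: Lam_sub_mult s_Lam_sub sk_Lam_sub Ft_Lam)
  qed
  moreover have "degree_part n ?V \<in> ?TS"
    unfolding degree_part_formal_sum[OF finite_skew_sum[OF assms]]
    unfolding tensor_span_def
  proof (rule mps.span_sum, fold tensor_span_def)
    fix i assume "i \<in> {i \<in> BP \<times> BP. degree_part n (case i of (\<rho>, \<mu>) \<Rightarrow> inY (antipode (Fsk \<eta> \<mu>)) * inY (Fsk \<rho> \<kappa>) * inX (sk \<rho> \<mu>)) \<noteq> 0}"
    then obtain \<rho> \<mu> where i: "i = (\<rho>, \<mu>)" "\<rho> \<in> BP" "\<mu> \<in> BP" by auto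
    have "antipode (Fsk \<eta> \<mu>) \<in> Lam"
      using antipode_linear_ext Fsk_Lam[OF assms(2) i(3)] unfolding is_antipode_def by metis
    then have "degree_part n (tensor (sk \<rho> \<mu>) (antipode (Fsk \<eta> \<mu>) * Fsk \<rho> \<kappa>)) \<in> ?TS"
      using i assms by (intro degree_part_tensor_span base sk_Lam_sub Lam_mult Fsk_Lam)
    then show "degree_part n (case i of (\<rho>, \<mu>) \<Rightarrow> inY (antipode (Fsk \<eta> \<mu>)) * inY (Fsk \<rho> \<kappa>) * inX (sk \<rho> \<mu>)) \<in> ?TS"
      unfolding i(1) prod.case inY_inY_inX .
  qed
  ultimately have "degree_part n (?U - ?V) \<in> ?TS"
    unfolding degree_part_simps tensor_span_def by (rule mps.span_diff)
  then show "degree_part n (?U - ?V) \<in> sub_quot_kernel k"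
  proof (rule sub_quot_kernelI)
    fix \<xi> \<alpha> :: "nat \<Rightarrow>\<^sub>0 nat" assume "exps_le k \<alpha>"
    then have "mcoeff (?U - ?V) (join \<xi> \<alpha>) = 0"
      using mcoeff_left_side[OF assms] mcoeff_right_side[OF assms] by simp
    then show "mcoeff (degree_part n (?U - ?V)) (join \<xi> \<alpha>) = 0" unfolding mcoeff_degree_part by simp
  qed
qed

end

theorem theorem5p4:
  fixes k :: nat
    and s Ft :: "nat list \<Rightarrow> (nat, 'a::field_char_0) mps"
    and sk Fsk :: "nat list \<Rightarrow> nat list \<Rightarrow> (nat, 'a) mps"
    and lam eta :: "nat list"
  assumes "1 \<le> k"
    and "is_kschur k s"
    and "is_dual_kschur k s Ft"
    and "is_skew_kschur k s sk"
    and "is_skew_dual_kschur k Ft Fsk"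
    and "lam \<in> bounded_partitions k"
    and "eta \<in> bounded_partitions k"
  shows "finite_in_each_degree (bounded_partitions k) (\<lambda>\<nu>. inX (s \<nu>) * inY (Ft \<nu>)) \<and>
         finite_in_each_degree (bounded_partitions k \<times> bounded_partitions k)
           (\<lambda>(\<rho>, \<mu>). inY (antipode (Fsk eta \<mu>)) * inY (Fsk \<rho> lam) * inX (sk \<rho> \<mu>)) \<and>
         sub_quot_eq k
           (Cauchy_kernel k s Ft * inX (sk lam eta))
           (formal_sum (bounded_partitions k \<times> bounded_partitions k)
              (\<lambda>(\<rho>, \<mu>). inY (antipode (Fsk eta \<mu>)) * inY (Fsk \<rho> lam) * inX (sk \<rho> \<mu>)))"
proof -
  interpret skew_kschur k s Ft sk Fsk
    using assms by unfold_locales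
  show ?thesis
    using finite_Cauchy finite_skew_sum kschur_identity assms by blast
qed

end
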